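(* Let $p\ge1$ and let $\mathfrak{g}$ be a finite-dimensional real solvable Lie algebra whose nilradical $\mathfrak{n}$ is the Heisenberg Lie algebra $\mathfrak{h}_{2p+1}$, with centre $\mathfrak{z}=\mathbb{R}Z$. For $X\in\mathfrak{g}$ let $\lambda(X)\in\mathbb{R}$ be defined by $[X,Z]=\lambda(X)Z$, and let $d_1(X),\dots,d_{2p}(X)\in\mathbb{C}$ be the eigenvalues, listed with algebraic multiplicity, of the linear map $\Phi(X)\in\operatorname{End}(\mathfrak{n}/\mathfrak{z})$ induced by the restriction of $\operatorname{ad}_X$ to $\mathfrak{n}$. Then $\mathfrak{g}$ admits an inner product of negative Ricci curvature if and only if there exists $Y\in\mathfrak{g}$ such that $$\lambda(Y)+\sum_{i:\ \operatorname{Re} d_i(Y)<0}\operatorname{Re} d_i(Y)>0 .$$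
   Context: The nilradical of $\mathfrak{g}$ is its maximal nilpotent ideal. The Heisenberg Lie algebra $\mathfrak{h}_{2p+1}$, $p\ge1$, is the real Lie algebra of dimension $2p+1$ with a basis $\{X_1,\dots,X_{2p},Z\}$ such that $[X_i,X_{p+i}]=Z$ for $i=1,\dots,p$, $[X_i,X_j]=0$ if $|i-j|\ne p$, and $Z$ spans the centre $\mathfrak{z}$. For every $X\in\mathfrak{g}$, the operator $\operatorname{ad}_X$ preserves $\mathfrak{n}$ and $\mathfrak{z}$, so $\lambda(X)$ and the induced map $\Phi(X)$ on $\mathfrak{n}/\mathfrak{z}$ are well defined. Ricci curvature: given an inner product $\langle\cdot,\cdot\rangle$ on a finite-dimensional real Lie algebra $\mathfrak{g}$, let $B$ be the Killing form of $\mathfrak{g}$, let $H\in\mathfrak{g}$ be defined by $\langle H,X\rangle=\operatorname{Tr}\operatorname{ad}_X$ for all $X\in\mathfrak g$, and let $\{E_i\}$ be any orthonormal basis of $(\mathfrak{g},\langle\cdot,\cdot\rangle)$. The Ricci curvature of the metric Lie algebra $(\mathfrak{g},\langle\cdot,\cdot\rangle)$ is the quadratic form $$\mathrm{ric}(X)=-\langle[H,X],X\rangle-\tfrac12 B(X,X)-\tfrac12\sum_i\|[X,E_i]\|^2+\tfrac14\sum_{i,j}\langle[E_i,E_j],X\rangle^2 ,\quad X\in\mathfrak g$$ (this is the Ricci curvature at the identity of the corresponding left-invariant metric on a Lie group with Lie algebra $\mathfrak{g}$). The inner product $\langle\cdot,\cdot\rangle$ is said to be of negative Ricci curvature if $\mathrm{ric}(X)<0$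 for all $X\ne0$. *)

theory Defs
  imports "HOL-Analysis.Analysis" "Jordan_Normal_Form.Char_Poly"
begin

text \<open>
  A finite-dimensional real Lie algebra is a bracket on a Euclidean space. The type's own inner
  product only serves to provide coordinates; it is unrelated to the bracket and to the inner
  products of metric Lie algebras, which are explicit bilinear forms.
\<close>

definition lie_bracket :: "('a::euclidean_space \<Rightarrow> 'a \<Rightarrow> 'a) \<Rightarrow> bool" where
  "lie_bracket br \<longleftrightarrow> bilinear br \<and> (\<forall>x. br x x = 0) \<and>
     (\<forall>x y z. br x (br y z) + br y (br z x) + br z (br x y) = 0)"

definition bracket_span :: "('a::euclidean_space \<Rightarrow> 'a \<Rightarrow> 'a) \<Rightarrow> 'a set \<Rightarrow> 'a set \<Rightarrow> 'a set" where
  "bracket_span br A B = span {br x y | x y. x \<in> A \<and> y \<in> B}"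

primrec derived_series :: "('a::euclidean_space \<Rightarrow> 'a \<Rightarrow> 'a) \<Rightarrow> nat \<Rightarrow> 'a set" where
  "derived_series br 0 = UNIV"
| "derived_series br (Suc k) = bracket_span br (derived_series br k) (derived_series br k)"

definition solvable_lie :: "('a::euclidean_space \<Rightarrow> 'a \<Rightarrow> 'a) \<Rightarrow> bool" where
  "solvable_lie br \<longleftrightarrow> (\<exists>k. derived_series br k = {0})"

primrec lower_central_series ::
    "('a::euclidean_space \<Rightarrow> 'a \<Rightarrow> 'a) \<Rightarrow> 'a set \<Rightarrow> nat \<Rightarrow> 'a set" where
  "lower_central_series br I 0 = I"
| "lower_central_series br I (Suc k) = bracket_span br I (lower_central_series br I k)"

definition lie_ideal :: "('a::euclidean_space \<Rightarrow> 'a \<Rightarrow> 'a) \<Rightarrow> 'a set \<Rightarrow> bool" where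
  "lie_ideal br I \<longleftrightarrow> subspace I \<and> (\<forall>x. \<forall>y\<in>I. br x y \<in> I)"

definition nilpotent_ideal :: "('a::euclidean_space \<Rightarrow> 'a \<Rightarrow> 'a) \<Rightarrow> 'a set \<Rightarrow> bool" where
  "nilpotent_ideal br I \<longleftrightarrow> lie_ideal br I \<and> (\<exists>k. lower_central_series br I k = {0})"

definition is_nilradical :: "('a::euclidean_space \<Rightarrow> 'a \<Rightarrow> 'a) \<Rightarrow> 'a set \<Rightarrow> bool" where
  "is_nilradical br n \<longleftrightarrow> nilpotent_ideal br n \<and> (\<forall>I. nilpotent_ideal br I \<longrightarrow> I \<subseteq> n)"

definition lie_centre :: "('a::euclidean_space \<Rightarrow> 'a \<Rightarrow> 'a) \<Rightarrow> 'a set \<Rightarrow> 'a set" where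
  "lie_centre br n = {z \<in> n. \<forall>x\<in>n. br z x = 0}"

definition heisenberg_basis ::
    "('a::euclidean_space \<Rightarrow> 'a \<Rightarrow> 'a) \<Rightarrow> 'a set \<Rightarrow> nat \<Rightarrow> (nat \<Rightarrow> 'a) \<Rightarrow> 'a \<Rightarrow> bool" where
  "heisenberg_basis br n p X Z \<longleftrightarrow>
     inj_on X {1..2*p} \<and> Z \<notin> X ` {1..2*p} \<and>
     independent (insert Z (X ` {1..2*p})) \<and> span (insert Z (X ` {1..2*p})) = n \<and>
     (\<forall>i\<in>{1..p}. br (X i) (X (p + i)) = Z) \<and>
     (\<forall>i\<in>{1..2*p}. \<forall>j\<in>{1..2*p}. \<bar>int i - int j\<bar> \<noteq> int p \<longrightarrow> br (X i) (X j) = 0) \<and>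
     lie_centre br n = span {Z}"

definition lambda_coeff :: "('a::euclidean_space \<Rightarrow> 'a \<Rightarrow> 'a) \<Rightarrow> 'a \<Rightarrow> 'a \<Rightarrow> real" where
  "lambda_coeff br Z Y = (THE c. br Y Z = c *\<^sub>R Z)"

text \<open>
  The matrix, in the basis \<open>X\<^sub>1 + \<zz>, \<dots>, X\<^sub>2\<^sub>p + \<zz>\<close> of the quotient, of the map
  that \<open>ad Y\<close> induces on \<open>\<nn>/\<zz>\<close>: the column of \<open>X\<^sub>j\<close> consists of the coordinates
  of \<open>[Y, X\<^sub>j]\<close> with the \<open>Z\<close>-coordinate dropped (matrix indices start at 0).
\<close>

definition Phi_matrix ::
    "('a::euclidean_space \<Rightarrow> 'a \<Rightarrow> 'a) \<Rightarrow> nat \<Rightarrow> (nat \<Rightarrow> 'a) \<Rightarrow> 'a \<Rightarrow> 'a \<Rightarrow> real mat" where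
  "Phi_matrix br p X Z Y = mat (2*p) (2*p) (\<lambda>(i, j).
     representation (insert Z (X ` {1..2*p})) (br Y (X (Suc j))) (X (Suc i)))"

text \<open>The complex eigenvalues with algebraic multiplicity.\<close>

definition complex_eigenvalues :: "real mat \<Rightarrow> complex multiset" where
  "complex_eigenvalues A = proots (char_poly (map_mat complex_of_real A))"

definition lin_trace :: "('a::euclidean_space \<Rightarrow> 'a) \<Rightarrow> real" where
  "lin_trace f = (\<Sum>b\<in>Basis. inner (f b) b)"

definition killing_form :: "('a::euclidean_space \<Rightarrow> 'a \<Rightarrow> 'a) \<Rightarrow> 'a \<Rightarrow> 'a \<Rightarrow> real" where
  "killing_form br x y = lin_trace (\<lambda>v. br x (br y v))"

definition inner_product :: "('a::euclidean_space \<Rightarrow> 'a \<Rightarrow> real) \<Rightarrow> bool" where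
  "inner_product ip \<longleftrightarrow> bilinear ip \<and> (\<forall>x y. ip x y = ip y x) \<and> (\<forall>x. x \<noteq> 0 \<longrightarrow> ip x x > 0)"

definition orthonormal_basis :: "('a::euclidean_space \<Rightarrow> 'a \<Rightarrow> real) \<Rightarrow> 'a set \<Rightarrow> bool" where
  "orthonormal_basis ip E \<longleftrightarrow> finite E \<and> span E = UNIV \<and>
     (\<forall>x\<in>E. \<forall>y\<in>E. ip x y = (if x = y then 1 else 0))"

definition mean_curvature_vector ::
    "('a::euclidean_space \<Rightarrow> 'a \<Rightarrow> 'a) \<Rightarrow> ('a \<Rightarrow> 'a \<Rightarrow> real) \<Rightarrow> 'a" where
  "mean_curvature_vector br ip = (THE h. \<forall>x. ip h x = lin_trace (br x))"

definition ricci_wrt ::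
    "('a::euclidean_space \<Rightarrow> 'a \<Rightarrow> 'a) \<Rightarrow> ('a \<Rightarrow> 'a \<Rightarrow> real) \<Rightarrow> 'a set \<Rightarrow> 'a \<Rightarrow> real" where
  "ricci_wrt br ip E x =
     - ip (br (mean_curvature_vector br ip) x) x
     - 1/2 * killing_form br x x
     - 1/2 * (\<Sum>e\<in>E. ip (br x e) (br x e))
     + 1/4 * (\<Sum>e\<in>E. \<Sum>f\<in>E. (ip (br e f) x)\<^sup>2)"

definition ricci ::
    "('a::euclidean_space \<Rightarrow> 'a \<Rightarrow> 'a) \<Rightarrow> ('a \<Rightarrow> 'a \<Rightarrow> real) \<Rightarrow> 'a \<Rightarrow> real" where
  "ricci br ip x = ricci_wrt br ip (SOME E. orthonormal_basis ip E) x"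

definition negative_ricci ::
    "('a::euclidean_space \<Rightarrow> 'a \<Rightarrow> 'a) \<Rightarrow> ('a \<Rightarrow> 'a \<Rightarrow> real) \<Rightarrow> bool" where
  "negative_ricci br ip \<longleftrightarrow> (\<forall>x. x \<noteq> 0 \<longrightarrow> ricci br ip x < 0)"

lemma bilinear_lsum:
  assumes "bilinear f"
  shows "f (\<Sum>b\<in>B. c b *\<^sub>R b) y = (\<Sum>b\<in>B. c b *\<^sub>R f b y)"
proof -
  have lin: "linear (\<lambda>x. f x y)" using assms by (simp add: bilinear_def)
  show ?thesis
    using linear_sum[OF lin, of "\<lambda>b. c b *\<^sub>R b" B] linear_cmul[OF lin] by simp
qed

lemma bilinear_rsum:
  assumes "bilinear f"
  shows "f x (\<Sum>b\<in>B. c b *\<^sub>R b) = (\<Sum>b\<in>B. c b *\<^sub>R f x b)"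
proof -
  have lin: "linear (f x)" using assms by (simp add: bilinear_def)
  show ?thesis
    using linear_sum[OF lin, of "\<lambda>b. c b *\<^sub>R b" B] linear_cmul[OF lin] by simp
qed

lemma lambda_coeff_bracket:
  assumes "lie_bracket br" "lie_ideal br n" "heisenberg_basis br n p X Z"
  shows "br Y Z = lambda_coeff br Z Y *\<^sub>R Z"
proof -
  have bil: "bilinear br" and alt: "\<And>x. br x x = 0"
    and jac: "\<And>x y z. br x (br y z) + br y (br z x) + br z (br x y) = 0"
    using assms(1) by (auto simp: lie_bracket_def)
  have anti: "br x y = - br y x" for x y
  proof -
    have "0 = br (x + y) (x + y)" by (simp only: alt)
    also have "\<dots> = br x x + br x y + (br y x + br y y)"
      by (simp only: bilinear_ladd[OF bil] bilinear_radd[OF bil] ac_simps)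
    also have "\<dots> = br x y + br y x" by (simp only: alt add_0 add_0_right)
    finally have "br x y + br y x = 0" by (rule sym)
    then show ?thesis by (simp add: eq_neg_iff_add_eq_0)
  qed
  have Z: "Z \<noteq> 0" and centre: "lie_centre br n = span {Z}"
    using assms(3) by (auto simp: heisenberg_basis_def dependent_zero)
  have Zc: "Z \<in> lie_centre br n" unfolding centre by (simp add: span_base)
  have "br (br Y Z) x = 0" if "x \<in> n" for x
  proof -
    have "br x Y \<in> n"
      using that assms(2) anti[of x Y] by (auto simp: lie_ideal_def subspace_neg)
    then have "br Z (br x Y) = 0" and "br Z x = 0"
      using Zc that by (auto simp: lie_centre_def)
    moreover have "br x (br Y Z) + br Y (br Z x) + br Z (br x Y) = 0" by (rule jac)
    ultimately have "br x (br Y Z) = 0" by (simp add: bilinear_rzero[OF bil])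
    then show ?thesis using anti[of "br Y Z" x] by simp
  qed
  then have "br Y Z \<in> span {Z}"
    using Zc assms(2) unfolding centre[symmetric] by (auto simp: lie_centre_def lie_ideal_def)
  then obtain c where "br Y Z = c *\<^sub>R Z" by (auto simp: span_singleton)
  then have "\<exists>!c. br Y Z = c *\<^sub>R Z" using Z by auto
  then show ?thesis unfolding lambda_coeff_def by (rule theI')
qed

lemma Phi_matrix_column:
  assumes "lie_ideal br n" "heisenberg_basis br n p X Z" "j < 2*p"
  shows "br Y (X (Suc j)) - (\<Sum>i<2*p. Phi_matrix br p X Z Y $$ (i, j) *\<^sub>R X (Suc i))
           \<in> lie_centre br n"
proof -
  let ?S = "X ` {1..2*p}"
  let ?v = "br Y (X (Suc j))"
  let ?r = "representation (insert Z ?S) ?v"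
  have ind: "independent (insert Z ?S)" and sp: "span (insert Z ?S) = n"
    and inj: "inj_on X {1..2*p}" and ZS: "Z \<notin> ?S"
    and centre: "lie_centre br n = span {Z}"
    using assms(2) by (auto simp: heisenberg_basis_def)
  have "X (Suc j) \<in> n" using assms(3) unfolding sp[symmetric] by (auto intro!: span_base)
  then have "?v \<in> span (insert Z ?S)" using assms(1) unfolding sp by (simp add: lie_ideal_def)
  then have "(\<Sum>b\<in>insert Z ?S. ?r b *\<^sub>R b) = ?v"
    by (intro real_vector.sum_representation_eq[OF ind]) auto
  then have "?v = ?r Z *\<^sub>R Z + (\<Sum>b\<in>?S. ?r b *\<^sub>R b)" using ZS by simp
  also have "(\<Sum>b\<in>?S. ?r b *\<^sub>R b) = (\<Sum>i\<in>{1..2*p}. ?r (X i) *\<^sub>R X i)"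
    unfolding sum.reindex[OF inj] by simp
  also have "\<dots> = (\<Sum>i<2*p. ?r (X (Suc i)) *\<^sub>R X (Suc i))"
    by (rule sum.reindex_bij_witness[of _ Suc "\<lambda>i. i - 1"]) auto
  also have "\<dots> = (\<Sum>i<2*p. Phi_matrix br p X Z Y $$ (i, j) *\<^sub>R X (Suc i))"
    using assms(3) by (intro sum.cong) (auto simp: Phi_matrix_def)
  finally have "?v - (\<Sum>i<2*p. Phi_matrix br p X Z Y $$ (i, j) *\<^sub>R X (Suc i)) = ?r Z *\<^sub>R Z"
    by (rule iffD2[OF diff_eq_eq])
  then show ?thesis unfolding centre by (simp only: span_scale span_base singletonI)
qed

lemma orthonormal_basis_exists:
  assumes ip: "inner_product ip"
  shows "\<exists>E. orthonormal_basis ip E"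
proof -
  have bil: "bilinear ip" and sym: "\<And>x y. ip x y = ip y x"
    and pos: "\<And>x. x \<noteq> 0 \<Longrightarrow> ip x x > 0"
    using ip by (auto simp: inner_product_def)
  define ON where "ON E \<longleftrightarrow> finite E \<and> (\<forall>x\<in>E. \<forall>y\<in>E. ip x y = (if x = y then 1 else 0))" for E
  have lsum: "ip (\<Sum>b\<in>E. c b *\<^sub>R b) a = (\<Sum>b\<in>E. c b * ip b a)" for E c a
    by (simp add: bilinear_lsum[OF bil])
  have coeff: "ip (\<Sum>b\<in>E. c b *\<^sub>R b) a = c a" if "ON E" "a \<in> E" for E c a
  proof -
    have "ip (\<Sum>b\<in>E. c b *\<^sub>R b) a = (\<Sum>b\<in>E. if b = a then c b else 0)"
      unfolding lsum using that by (intro sum.cong) (auto simp: ON_def)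
    then show ?thesis using that by (simp add: ON_def)
  qed
  have indep: "independent E" if "ON E" for E
  proof (subst independent_explicit, intro conjI allI impI ballI)
    show "finite E" using that by (simp add: ON_def)
    fix c a assume "(\<Sum>b\<in>E. c b *\<^sub>R b) = 0" "a \<in> E"
    then show "c a = 0" using coeff[OF that, of a c] by (simp add: bilinear_lzero[OF bil])
  qed
  have "\<exists>E. ON E \<and> (\<forall>F. ON F \<longrightarrow> card F \<le> card E)"
  proof (rule ex_has_greatest_nat)
    show "ON {}" by (simp add: ON_def)
    show "\<forall>F. ON F \<longrightarrow> card F < Suc DIM('a)"
      using indep independent_bound less_Suc_eq_le by blast
  qed
  then obtain E where E: "ON E" and max: "\<And>F. ON F \<Longrightarrow> card F \<le> card E" by blast
  have "x \<in> span E" for x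
  proof (rule ccontr)
    assume x: "x \<notin> span E"
    define s where "s = (\<Sum>b\<in>E. ip x b *\<^sub>R b)"
    define y where "y = x - s"
    have "s \<in> span E" unfolding s_def by (intro span_sum span_scale span_base)
    then have y: "y \<notin> span E" using x span_add[of y E s] by (auto simp: y_def)
    then have "y \<noteq> 0" by (auto simp: span_zero)
    then have yy: "ip y y > 0" by (rule pos)
    define u where "u = (1 / sqrt (ip y y)) *\<^sub>R y"
    have ya: "ip y a = 0" if "a \<in> E" for a
      using coeff[OF E that, of "ip x"] by (simp add: y_def s_def bilinear_lsub[OF bil])
    have ua: "ip u a = 0" if "a \<in> E" for a
      using ya[OF that] by (simp add: u_def bilinear_lmul[OF bil])
    have uu: "ip u u = 1"
      using yy by (simp add: u_def bilinear_lmul[OF bil] bilinear_rmul[OF bil])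
    have "u \<notin> E" using ua uu by force
    moreover have "ON (insert u E)"
      using E ua uu sym \<open>u \<notin> E\<close> by (auto simp: ON_def)
    ultimately show False using max[of "insert u E"] E by (simp add: ON_def)
  qed
  then show ?thesis using E by (auto simp: ON_def orthonormal_basis_def)
qed

lemma orthonormal_expansion:
  assumes ip: "inner_product ip" and E: "orthonormal_basis ip E"
  shows "x = (\<Sum>e\<in>E. ip x e *\<^sub>R e)"
proof -
  have bil: "bilinear ip" using ip by (simp add: inner_product_def)
  have fin: "finite E" and on: "\<And>x y. x \<in> E \<Longrightarrow> y \<in> E \<Longrightarrow> ip x y = (if x = y then 1 else 0)"
    using E by (auto simp: orthonormal_basis_def)
  have "x \<in> span E" using E by (simp add: orthonormal_basis_def)
  then obtain c where x: "x = (\<Sum>b\<in>E. c b *\<^sub>R b)" using span_finite[OF fin] by auto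
  have c: "ip x a = c a" if "a \<in> E" for a
  proof -
    have "ip x a = (\<Sum>b\<in>E. c b * ip b a)"
      unfolding x by (simp add: bilinear_lsum[OF bil])
    also have "\<dots> = (\<Sum>b\<in>E. if b = a then c b else 0)"
      using that on by (intro sum.cong) auto
    finally show ?thesis using that fin by simp
  qed
  show ?thesis by (rule trans[OF x], rule sum.cong) (simp_all add: c)
qed

lemma mean_curvature_vector:
  assumes br: "bilinear br" and ip: "inner_product ip"
  shows "ip (mean_curvature_vector br ip) x = lin_trace (br x)"
proof -
  have bil: "bilinear ip" and sym: "\<And>x y. ip x y = ip y x"
    and pos: "\<And>x. x \<noteq> 0 \<Longrightarrow> ip x x > 0"
    using ip by (auto simp: inner_product_def)
  obtain E where E: "orthonormal_basis ip E" using orthonormal_basis_exists[OF ip] by blast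
  have lin: "linear (\<lambda>x. lin_trace (br x))"
    by (rule linearI) (simp_all add: lin_trace_def bilinear_ladd[OF br] bilinear_lmul[OF br]
        inner_add_left sum.distrib sum_distrib_left)
  have "\<exists>!h. \<forall>x. ip h x = lin_trace (br x)"
  proof
    show "\<forall>x. ip (\<Sum>e\<in>E. lin_trace (br e) *\<^sub>R e) x = lin_trace (br x)"
    proof
      fix x
      have "ip (\<Sum>e\<in>E. lin_trace (br e) *\<^sub>R e) x = (\<Sum>e\<in>E. ip x e * lin_trace (br e))"
        unfolding bilinear_lsum[OF bil] by (simp add: sym[of x] mult.commute)
      also have "\<dots> = lin_trace (br (\<Sum>e\<in>E. ip x e *\<^sub>R e))"
        using linear_sum[OF lin, of "\<lambda>e. ip x e *\<^sub>R e" E] linear_cmul[OF lin] by simp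
      finally show "ip (\<Sum>e\<in>E. lin_trace (br e) *\<^sub>R e) x = lin_trace (br x)"
        by (simp only: orthonormal_expansion[OF ip E, of x, symmetric])
    qed
  next
    fix h assume h: "\<forall>x. ip h x = lin_trace (br x)"
    let ?h = "\<Sum>e\<in>E. lin_trace (br e) *\<^sub>R e"
    have "h = (\<Sum>e\<in>E. ip h e *\<^sub>R e)" by (rule orthonormal_expansion[OF ip E])
    also have "\<dots> = ?h" by (simp only: h)
    finally show "h = ?h" .
  qed
  from theI'[OF this] show ?thesis unfolding mean_curvature_vector_def by blast
qed

lemma orthonormal_sum_indep:
  assumes ip: "inner_product ip" and E: "orthonormal_basis ip E" and F: "orthonormal_basis ip F"
    and q: "bilinear q"
  shows "(\<Sum>e\<in>E. q e e) = (\<Sum>f\<in>F. q f (f::'a::euclidean_space) :: real)"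
proof -
  have sym: "\<And>x y. ip x y = ip y x" using ip by (simp add: inner_product_def)
  have exl: "q x y = (\<Sum>b\<in>B. ip x b * q b y)" if B: "orthonormal_basis ip B" for x y B
    using arg_cong[OF orthonormal_expansion[OF ip B, of x], of "\<lambda>v. q v y"]
    by (simp add: bilinear_lsum[OF q])
  have exr: "q x y = (\<Sum>b\<in>B. ip y b * q x b)" if B: "orthonormal_basis ip B" for x y B
    using arg_cong[OF orthonormal_expansion[OF ip B, of y], of "q x"]
    by (simp add: bilinear_rsum[OF q])
  have "(\<Sum>e\<in>E. q e e) = (\<Sum>e\<in>E. \<Sum>f\<in>F. ip f e * q f e)"
    by (intro sum.cong refl, subst exl[OF F], simp add: sym)
  also have "\<dots> = (\<Sum>f\<in>F. \<Sum>e\<in>E. ip f e * q f e)" by (rule sum.swap)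
  also have "\<dots> = (\<Sum>f\<in>F. q f f)" by (simp add: exr[OF E, symmetric])
  finally show ?thesis .
qed

lemma ricci_eq:
  assumes br: "bilinear br" and ip: "inner_product ip" and E: "orthonormal_basis ip E"
  shows "ricci br ip x = ricci_wrt br ip E x"
proof -
  define F where "F = (SOME E. orthonormal_basis ip E)"
  have F: "orthonormal_basis ip F" unfolding F_def by (rule someI[of _ E]) (rule E)
  have bil: "bilinear ip" using ip by (simp add: inner_product_def)
  note simps = bilinear_ladd[OF br] bilinear_radd[OF br] bilinear_lmul[OF br] bilinear_rmul[OF br]
    bilinear_ladd[OF bil] bilinear_radd[OF bil] bilinear_lmul[OF bil] bilinear_rmul[OF bil]
  have "bilinear (\<lambda>v w. ip (br x v) (br x w))"
    unfolding bilinear_def by (intro conjI allI linearI) (simp_all add: simps)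
  from orthonormal_sum_indep[OF ip F E this]
  have 1: "(\<Sum>e\<in>F. ip (br x e) (br x e)) = (\<Sum>e\<in>E. ip (br x e) (br x e))" .
  have "bilinear (\<lambda>v w. ip (br e v) x * ip (br e w) x)" for e
    unfolding bilinear_def by (intro conjI allI linearI) (simp_all add: simps algebra_simps)
  from orthonormal_sum_indep[OF ip F E this]
  have 2: "(\<Sum>f\<in>F. (ip (br e f) x)\<^sup>2) = (\<Sum>f\<in>E. (ip (br e f) x)\<^sup>2)" for e
    by (simp add: power2_eq_square)
  have "bilinear (\<lambda>v w. \<Sum>f\<in>E. ip (br v f) x * ip (br w f) x)"
    unfolding bilinear_def
    by (intro conjI allI linearI) (simp_all add: simps algebra_simps sum.distrib sum_distrib_left)
  from orthonormal_sum_indep[OF ip F E this]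
  have 3: "(\<Sum>e\<in>F. \<Sum>f\<in>E. (ip (br e f) x)\<^sup>2) = (\<Sum>e\<in>E. \<Sum>f\<in>E. (ip (br e f) x)\<^sup>2)"
    by (simp add: power2_eq_square)
  show ?thesis unfolding ricci_def F_def[symmetric] ricci_wrt_def by (simp add: 1 2 3)
qed

end

theory Submission imports Defs "Jordan_Normal_Form.Schur_Decomposition" begin

text \<open>
  The brackets between elements of the nilradical are governed by a symplectic form
  \<open>\<omega>\<close> on \<open>v \<cong> \<nn>/\<zz>\<close>, and each \<open>\<Phi> A\<close> scales it infinitesimally by \<open>\<lambda>(A)\<close>. Hence the
  real parts of the eigenvalues of \<open>\<Phi> Y\<close> pair up as \<open>r \<leftrightarrow> \<lambda>(Y) - r\<close>: the span
  of generalised eigenvectors with real part in \<open>S\<close> is orthogonal under \<open>\<omega>\<close> to the one for \<open>R\<close>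
  unless some \<open>a \<in> S\<close> and \<open>b \<in> R\<close> add up to \<open>\<lambda>(Y)\<close> (\<open>omega_re_spaces\<close>). Since the bracket of a
  solvable Lie algebra takes values in its nilradical (\<open>derived_algebra_nilpotent\<close>, a form of Lie's
  theorem over the reals), the maps \<open>\<Phi> A\<close> commute with each other.

  Necessity. If \<open>W\<close> is a nonzero abelian ideal of a metric Lie algebra of negative Ricci curvature,
  then the trace of \<open>ad H\<close> on \<open>W\<close> is positive, where \<open>H\<close> is the mean curvature vector: in the sum of
  the Ricci curvatures over an orthonormal basis of \<open>W\<close> the Killing term vanishes and the two quadratic
  terms cancel up to a nonnegative remainder (\<open>abelian_ideal_trace_pos\<close>). For \<open>W = \<zz>\<close> this says
  \<open>\<lambda>(H) > 0\<close>. Consequently the vectors whose class lies in the nonpositive part of \<open>\<Phi> H\<close> form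
  an abelian ideal containing \<open>\<zz>\<close>, and the trace on this ideal is exactly \<open>\<lambda>(H)\<close> plus the sum of the
  negative real parts. So \<open>Y = H\<close> works.

  Sufficiency. The negative real parts sum to at most zero, so \<open>\<lambda>(Y) > 0\<close>. Split \<open>v\<close> by the real
  parts of \<open>\<Phi> Y\<close> into a low part (at most \<open>0\<close>), a middle part (strictly between \<open>0\<close> and
  \<open>\<lambda>(Y)\<close>) and a high part (at least \<open>\<lambda>(Y)\<close>). The low and high parts are dual under \<open>\<omega>\<close>, the middle
  part is orthogonal to both. On the low and middle parts choose bases in which all \<open>\<Phi> A\<close> are
  simultaneously block triangular with diagonal blocks of the form scalar plus skew
  (\<open>commuting_family_flag\<close>); on the high part take the dual basis of the low one. A grading of the
  basis then makes every structure constant respect degrees, and rescaling by powers of a small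
  parameter degenerates \<open>\<gg>\<close> to a graded algebra in which the \<open>\<Phi> A\<close> are normal, the middle part is
  central in the nilradical, and low and high basis vectors pair off. Negativity of the Ricci form is an
  open condition on structure constants, so it may be checked on the limit
  (\<open>negative_ricci_by_contraction\<close>).

  In the limit the Ricci form is block diagonal (\<open>ricci_form_semidirect\<close>). The term \<open>[H, \<cdot>]\<close> contributes
  \<open>- d\<^sub>i(Y)\<close> to a vector of the basis, which has the wrong sign on the low part, and the bracket
  \<open>[e, f e] = c Z\<close> lowers the curvature of \<open>e\<close> and \<open>f e\<close> by \<open>c\<^sup>2/2\<close> while it raises that of \<open>Z\<close>. The
  constants \<open>c\<close> can be large enough for the low part and still small enough for \<open>Z\<close> precisely because
  \<open>\<lambda>(Y)\<close> exceeds minus the sum of the negative real parts. The remaining directions, a complement of the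
  nilradical, need that no element of it acts on the limit by a skew map annihilating \<open>Z\<close>. Rescaling low and middle
  basis vectors by slightly different factors destroys all skew-symmetry, so that an offending element would
  act nilpotently and would lie in the nilradical.
\<close>

hide_const (open) VectorSpace.subspace Matrix.orthogonal
hide_fact (open) VectorSpace.subspace_def Matrix.orthogonal_def

section \<open>Polynomials of an operator\<close>

text \<open>
  The value \<open>p(T)\<close> of a polynomial at an operator, applied to a vector. Horner's scheme makes
  the defining recursion the one of \<open>pCons\<close>.
\<close>

definition op_poly :: "real poly \<Rightarrow> ('a::real_vector \<Rightarrow> 'a) \<Rightarrow> 'a \<Rightarrow> 'a" where
  "op_poly p T = fold_coeffs (\<lambda>a f x. a *\<^sub>R x + T (f x)) p (\<lambda>_. 0)"

lemma op_poly_0 [simp]: "op_poly 0 T x = 0"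
  by (simp add: op_poly_def)

lemma op_poly_pCons:
  assumes "linear T"
  shows "op_poly (pCons a p) T x = a *\<^sub>R x + T (op_poly p T x)"
  by (cases "p = 0 \<and> a = 0") (auto simp: op_poly_def linear_0[OF assms])

lemma op_poly_add:
  assumes "linear T"
  shows "op_poly (p + q) T x = op_poly p T x + op_poly q T x"
  by (induction p q rule: poly_induct2)
    (simp_all add: op_poly_pCons[OF assms] linear_add[OF assms] algebra_simps)

lemma op_poly_smult:
  assumes "linear T"
  shows "op_poly (Polynomial.smult c p) T x = c *\<^sub>R op_poly p T x"
  by (induction p)
    (simp_all add: op_poly_pCons[OF assms] linear_cmul[OF assms] scaleR_add_right)

lemma op_poly_mult:
  assumes "linear T"
  shows "op_poly (p * q) T x = op_poly p T (op_poly q T x)"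
  by (induction p)
    (simp_all add: op_poly_pCons[OF assms] op_poly_add[OF assms] op_poly_smult[OF assms] mult_pCons_left)

lemma op_poly_monom:
  assumes "linear T"
  shows "op_poly (Polynomial.monom c i) T x = c *\<^sub>R (T ^^ i) x"
  by (induction i)
    (simp_all add: monom_0 monom_Suc op_poly_pCons[OF assms] linear_cmul[OF assms] linear_0[OF assms])

lemma op_poly_in_subspace:
  assumes "linear T" "subspace V" "\<And>x. x \<in> V \<Longrightarrow> T x \<in> V" "x \<in> V"
  shows "op_poly p T x \<in> V"
  using assms
  by (induction p) (auto simp: op_poly_pCons[OF assms(1)] subspace_0 intro!: subspace_add subspace_scale)

lemma linear_relation_exists:
  fixes f :: "nat \<Rightarrow> 'a::euclidean_space"
  shows "\<exists>c. (\<exists>i\<le>DIM('a). c i \<noteq> 0) \<and> (\<Sum>i\<le>DIM('a). c i *\<^sub>R f i) = 0"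
proof (cases "inj_on f {..DIM('a)}")
  case False
  then obtain i j where ij: "i \<le> DIM('a)" "j \<le> DIM('a)" "i \<noteq> j" "f i = f j"
    by (auto simp: inj_on_def)
  define c where "c k = (if k = i then 1 else if k = j then -1 else 0 :: real)" for k
  have "(\<Sum>k\<le>DIM('a). c k *\<^sub>R f k) = (\<Sum>k\<in>{i, j}. c k *\<^sub>R f k)"
    by (rule sum.mono_neutral_right) (use ij in \<open>auto simp: c_def\<close>)
  then show ?thesis using ij by (intro exI[of _ c]) (auto simp: c_def)
next
  case True
  then have "card (f ` {..DIM('a)}) = Suc (DIM('a))" by (simp add: card_image)
  then have "dependent (f ` {..DIM('a)})" using independent_bound[of "f ` {..DIM('a)}"] by linarith
  then obtain u v where uv: "v \<in> f ` {..DIM('a)}" "u v \<noteq> 0"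
      "(\<Sum>v\<in>f ` {..DIM('a)}. u v *\<^sub>R v) = 0"
    by (subst (asm) real_vector.dependent_finite) auto
  then show ?thesis
    by (intro exI[of _ "u \<circ> f"]) (auto simp: sum.reindex[OF True])
qed

section \<open>Real quadratic factors\<close>

text \<open>
  The operator \<open>(T - a)\<^sup>2 + b\<^sup>2\<close>, which annihilates the eigenvectors for \<open>a \<plusminus> i b\<close>. Allowing
  \<open>b = 0\<close> covers real eigenvalues as well, so that generalised eigenspaces can be handled by real part without
  complexifying the space.
\<close>

definition quad_op :: "real \<Rightarrow> real \<Rightarrow> ('a::real_vector \<Rightarrow> 'a) \<Rightarrow> 'a \<Rightarrow> 'a" where
  "quad_op a b T x = T (T x) - (2 * a) *\<^sub>R T x + (a\<^sup>2 + b\<^sup>2) *\<^sub>R x"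

fun quad_prod :: "(real \<times> real) list \<Rightarrow> ('a::real_vector \<Rightarrow> 'a) \<Rightarrow> 'a \<Rightarrow> 'a" where
  "quad_prod [] T x = x"
| "quad_prod (ab # L) T x = quad_op (fst ab) (snd ab) T (quad_prod L T x)"

lemma quad_op_eq_op_poly:
  assumes "linear T"
  shows "quad_op a b T x = op_poly [: a\<^sup>2 + b\<^sup>2, - 2 * a, 1 :] T x"
  by (simp add: quad_op_def op_poly_pCons[OF assms] linear_add[OF assms] linear_cmul[OF assms]
      linear_diff[OF assms] linear_neg[OF assms] linear_0[OF assms])

lemma linear_quad_op: "linear T \<Longrightarrow> linear (quad_op a b T)"
  by (intro linearI) (simp_all add: quad_op_def linear_add linear_cmul algebra_simps)

lemma linear_quad_prod: "linear T \<Longrightarrow> linear (quad_prod L T)"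
proof (induction L)
  case Nil then show ?case by (intro linearI) auto
next
  case (Cons ab L)
  then have "linear (quad_op (fst ab) (snd ab) T \<circ> quad_prod L T)"
    by (intro linear_compose) (auto intro: linear_quad_op)
  then show ?case by (simp add: o_def cong: )
qed

lemma quad_op_in_subspace:
  "subspace V \<Longrightarrow> (\<And>x. x \<in> V \<Longrightarrow> T x \<in> V) \<Longrightarrow> x \<in> V \<Longrightarrow> quad_op a b T x \<in> V"
  unfolding quad_op_def by (intro subspace_add subspace_diff subspace_scale) auto

lemma quad_prod_in_subspace:
  "subspace V \<Longrightarrow> (\<And>x. x \<in> V \<Longrightarrow> T x \<in> V) \<Longrightarrow> x \<in> V \<Longrightarrow> quad_prod L T x \<in> V"
  by (induction L) (auto intro!: quad_op_in_subspace)

lemma quad_op_commutes: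
  assumes "linear S" "\<And>x. x \<in> V \<Longrightarrow> T x \<in> V" "\<And>x. x \<in> V \<Longrightarrow> S (T x) = T (S x)" "x \<in> V"
  shows "S (quad_op a b T x) = quad_op a b T (S x)"
  using assms by (simp add: quad_op_def linear_add linear_diff linear_cmul)

lemma quad_prod_commutes:
  assumes "linear S" "subspace V" "\<And>x. x \<in> V \<Longrightarrow> T x \<in> V" "\<And>x. x \<in> V \<Longrightarrow> S (T x) = T (S x)" "x \<in> V"
  shows "S (quad_prod L T x) = quad_prod L T (S x)"
proof (induction L)
  case (Cons ab L)
  have "quad_prod L T x \<in> V" by (rule quad_prod_in_subspace) (use assms in auto)
  then show ?case using Cons quad_op_commutes[of S V T "quad_prod L T x"] assms by simp
qed simp

lemma quad_prod_append: "quad_prod (L @ M) T x = quad_prod L T (quad_prod M T x)"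
  by (induction L) auto

lemma quad_prod_swap:
  assumes "linear T"
  shows "quad_prod L T (quad_prod M T x) = quad_prod M T (quad_prod L T x)"
proof -
  have 1: "T (quad_prod M T y) = quad_prod M T (T y)" for y
    by (rule quad_prod_commutes[of T UNIV]) (use assms in auto)
  show ?thesis
    by (rule quad_prod_commutes[of "quad_prod L T" UNIV, symmetric, THEN sym])
      (use assms linear_quad_prod[OF assms] quad_prod_commutes[of T UNIV T] in auto)
qed

lemma scaleR_double:
  "(2 * c) *\<^sub>R (x::'a::real_vector) = c *\<^sub>R x + c *\<^sub>R x"
  "(c * 2) *\<^sub>R x = c *\<^sub>R x + c *\<^sub>R x"
  "(b * (c * 2)) *\<^sub>R x = (b * c) *\<^sub>R x + (b * c) *\<^sub>R x"
  by (simp_all only: mult_2 mult_2_right scaleR_add_left distrib_left)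

lemma of_real_poly_mult:
  "map_poly complex_of_real (p * q) = map_poly complex_of_real p * map_poly complex_of_real q"
proof -
  interpret map_poly_comm_ring_hom "of_real :: real \<Rightarrow> complex" ..
  show ?thesis by (rule hom_mult)
qed

lemma of_real_poly_add:
  "map_poly complex_of_real (p + q) = map_poly complex_of_real p + map_poly complex_of_real q"
proof -
  interpret map_poly_comm_ring_hom "of_real :: real \<Rightarrow> complex" ..
  show ?thesis by (rule hom_add)
qed

lemma real_poly_quadratic_factor:
  assumes z: "poly (map_poly complex_of_real p) z = 0" and im: "Im z \<noteq> 0"
  shows "\<exists>s. p = [: (Re z)\<^sup>2 + (Im z)\<^sup>2, - 2 * Re z, 1 :] * s"
proof -
  define q where "q = [: (Re z)\<^sup>2 + (Im z)\<^sup>2, - 2 * Re z, 1 :]"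
  define r where "r = p mod q"
  have dq: "degree q = 2" by (simp add: q_def)
  have p: "p = q * (p div q) + r" unfolding r_def by (rule mult_div_mod_eq[symmetric])
  have qz: "poly (map_poly complex_of_real q) z = 0"
    by (simp add: q_def map_poly_pCons complex_eq_iff power2_eq_square algebra_simps)
  have "map_poly complex_of_real p = map_poly complex_of_real q * map_poly complex_of_real (p div q)
      + map_poly complex_of_real r"
    by (rule trans[OF arg_cong[OF p, of "map_poly complex_of_real"]])
      (simp only: of_real_poly_add of_real_poly_mult)
  then have "poly (map_poly complex_of_real p) z = poly (map_poly complex_of_real r) z"
    using qz by simp
  then have rz: "poly (map_poly complex_of_real r) z = 0" using z by simp
  have "q \<noteq> 0" using dq by (metis degree_0 zero_neq_numeral)
  then have "r = 0 \<or> degree r < degree q" unfolding r_def by (rule degree_mod_less)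
  then have dr: "degree r \<le> 1"
  proof
    assume "r = 0" then show ?thesis by (simp only: degree_0 le0)
  next
    assume "degree r < degree q" then show ?thesis unfolding dq by linarith
  qed
  define r0 r1 where "r0 = coeff r 0" and "r1 = coeff r 1"
  have r01: "r = [:r0, r1:]"
  proof (rule poly_eqI)
    fix n show "coeff r n = coeff [:r0, r1:] n"
      using dr by (auto simp: r0_def r1_def coeff_pCons coeff_eq_0 split: nat.splits)
  qed
  have "map_poly complex_of_real r = [:complex_of_real r0, complex_of_real r1:]"
    by (rule poly_eqI) (simp add: r01 coeff_map_poly coeff_pCons split: nat.split)
  then have "complex_of_real r0 + z * complex_of_real r1 = 0" using rz by simp
  then have "r0 + r1 * Re z = 0" "r1 * Im z = 0"
    by (auto simp: complex_eq_iff algebra_simps)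
  then have "r = 0" using im r01 by auto
  then have "q dvd p" unfolding r_def by (rule mod_0_imp_dvd)
  then show ?thesis unfolding q_def dvd_def .
qed

text \<open>
  A minimal polynomial of the restriction has a complex root. A real root \<open>a\<close> gives an eigenvector, and
  a conjugate pair of roots gives a real quadratic factor; minimality makes the complementary factor nonzero on
  some vector.
\<close>

lemma quad_op_kernel_exists:
  fixes T :: "'a::euclidean_space \<Rightarrow> 'a"
  assumes lin: "linear T" and V: "subspace V" "\<And>x. x \<in> V \<Longrightarrow> T x \<in> V" and ne: "V \<noteq> {0}"
  shows "\<exists>a b. \<exists>x\<in>V. x \<noteq> 0 \<and> quad_op a b T x = 0"
proof -
  define ann where "ann p \<longleftrightarrow> p \<noteq> 0 \<and> (\<exists>x\<in>V. x \<noteq> 0 \<and> op_poly p T x = 0)" for p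
  obtain x0 where x0: "x0 \<in> V" "x0 \<noteq> 0" using ne V(1) subspace_0 by blast
  obtain c where c: "\<exists>i\<le>DIM('a). c i \<noteq> 0" "(\<Sum>i\<le>DIM('a). c i *\<^sub>R (T ^^ i) x0) = 0"
    using linear_relation_exists[of "\<lambda>i. (T ^^ i) x0"] by blast
  define p0 where "p0 = (\<Sum>i\<le>DIM('a). Polynomial.monom (c i) i)"
  have "op_poly (\<Sum>i\<in>A. Polynomial.monom (c i) i) T x0 = (\<Sum>i\<in>A. c i *\<^sub>R (T ^^ i) x0)" if "finite A" for A
    using that by induction (simp_all add: op_poly_add[OF lin] op_poly_monom[OF lin])
  then have "op_poly p0 T x0 = 0" using c(2) by (simp add: p0_def)
  moreover have "p0 \<noteq> 0"
  proof -
    obtain i where i: "i \<le> DIM('a)" "c i \<noteq> 0" using c(1) by blast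
    have "coeff p0 i = (\<Sum>j\<le>DIM('a). if j = i then c j else 0)" by (simp only: p0_def coeff_sum coeff_monom)
    then have "coeff p0 i = c i" using i by simp
    then show ?thesis using i by auto
  qed
  ultimately have "ann p0" using x0 by (auto simp: ann_def)
  then obtain p where p: "ann p" and min: "\<And>q. ann q \<Longrightarrow> degree p \<le> degree q"
    using ex_has_least_nat[of ann p0 degree] by blast
  obtain x where x: "x \<in> V" "x \<noteq> 0" "op_poly p T x = 0" and pn: "p \<noteq> 0"
    using p by (auto simp: ann_def)
  have dp: "degree p \<noteq> 0"
  proof
    assume "degree p = 0"
    then obtain d where "p = [:d:]" by (rule degree_eq_zeroE)
    then show False using x pn by (simp add: op_poly_pCons[OF lin] linear_0[OF lin])
  qed
  let ?cp = "map_poly complex_of_real p"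
  have "degree ?cp = degree p" by (simp add: degree_map_poly)
  then have "\<not> constant (poly ?cp)" using dp by (simp add: constant_degree)
  then obtain z where z: "poly ?cp z = 0" using fundamental_theorem_of_algebra by blast
  have factor: "\<exists>y\<in>V. y \<noteq> 0 \<and> op_poly q T y = 0" if "p = q * s" "degree q > 0" for q s
  proof (intro bexI conjI)
    show "op_poly q T (op_poly s T x) = 0" using x that by (simp add: op_poly_mult[OF lin, symmetric])
    show "op_poly s T x \<in> V" using x by (intro op_poly_in_subspace lin V)
    have "s \<noteq> 0" "q \<noteq> 0" using that pn by auto
    then have "degree s < degree p" using that by (simp add: degree_mult_eq)
    then have "\<not> ann s" using min[of s] by auto
    then show "op_poly s T x \<noteq> 0" using x \<open>s \<noteq> 0\<close> by (auto simp: ann_def)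
  qed
  show ?thesis
  proof (cases "Im z = 0")
    case True
    then have "z = of_real (Re z)" by (simp add: complex_eq_iff)
    then have "complex_of_real (poly p (Re z)) = 0"
      using z of_real_hom.poly_map_poly[of p "Re z", where ?'a = complex] by simp
    then have "[:- Re z, 1:] dvd p" by (simp only: of_real_eq_0_iff poly_eq_0_iff_dvd)
    then obtain s where "p = [:- Re z, 1:] * s" unfolding dvd_def by blast
    from factor[OF this] obtain y where y: "y \<in> V" "y \<noteq> 0" "op_poly [:- Re z, 1:] T y = 0"
      by auto
    then have "T y = Re z *\<^sub>R y" by (simp add: op_poly_pCons[OF lin] linear_0[OF lin])
    then have "quad_op (Re z) 0 T y = 0"
      by (simp add: quad_op_def linear_cmul[OF lin] power2_eq_square scaleR_double mult.assoc)
    then show ?thesis using y by blast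
  next
    case False
    then obtain s where "p = [: (Re z)\<^sup>2 + (Im z)\<^sup>2, - 2 * Re z, 1 :] * s"
      using real_poly_quadratic_factor[OF z] by blast
    from factor[OF this] show ?thesis by (auto simp: quad_op_eq_op_poly[OF lin])
  qed
qed

text \<open>
  For a vector \<open>x\<close> in both kernels the two quadratic equations differ by a linear one, so \<open>x\<close> would be
  an eigenvector with real eigenvalue, which forces both real parts to equal that eigenvalue.
\<close>

lemma quad_op_kernels_disjoint:
  assumes lin: "linear T" and x: "quad_op a b T x = 0" "quad_op a' b' T x = 0" and ne: "a \<noteq> a'"
  shows "x = 0"
proof -
  define y where "y = T x - a *\<^sub>R x"
  have Tx: "T x = y + a *\<^sub>R x" by (simp add: y_def)
  have Ty: "T y = a *\<^sub>R y - (b\<^sup>2) *\<^sub>R x"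
  proof -
    have "T y = T (T x) - a *\<^sub>R T x" by (simp add: y_def linear_diff[OF lin] linear_cmul[OF lin])
    also have "\<dots> = quad_op a b T x + a *\<^sub>R y - (b\<^sup>2) *\<^sub>R x"
      by (simp add: quad_op_def y_def power2_eq_square scaleR_diff_right scaleR_add_left scaleR_double)
    finally show ?thesis using x by simp
  qed
  define k where "k = 2 * (a - a')"
  define m where "m = (b\<^sup>2 - b'\<^sup>2 - (a - a')\<^sup>2) / k"
  have k: "k \<noteq> 0" using ne by (simp add: k_def)
  have "T (T x) = a *\<^sub>R y - (b\<^sup>2) *\<^sub>R x + a *\<^sub>R (y + a *\<^sub>R x)"
    by (simp only: Tx linear_add[OF lin] linear_cmul[OF lin] Ty)
  then have "quad_op a' b' T x = k *\<^sub>R y - (b\<^sup>2 - b'\<^sup>2 - (a - a')\<^sup>2) *\<^sub>R x"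
    unfolding quad_op_def k_def
    by (simp add: Tx power2_eq_square algebra_simps scaleR_double)
  then have "k *\<^sub>R y = (b\<^sup>2 - b'\<^sup>2 - (a - a')\<^sup>2) *\<^sub>R x" using x by simp
  then have "(1 / k) *\<^sub>R (k *\<^sub>R y) = m *\<^sub>R x" by (simp add: m_def)
  then have "y = m *\<^sub>R x" using k by simp
  then have "T y = m *\<^sub>R (y + a *\<^sub>R x)" using linear_cmul[OF lin, of m x] Tx by simp
  then have "(m * m + b\<^sup>2) *\<^sub>R x = 0"
    using Ty \<open>y = m *\<^sub>R x\<close> by (simp add: algebra_simps)
  then have "x = 0 \<or> m * m + b\<^sup>2 = 0" by auto
  moreover have False if "m * m + b\<^sup>2 = 0"
  proof -
    have "m = 0" "b = 0" using that
      by (auto simp: power2_eq_square sum_squares_eq_zero_iff)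
    then have "b'\<^sup>2 + (a - a')\<^sup>2 = 0" using k by (simp add: m_def flip: eq_neg_iff_add_eq_0)
    then show False using ne by (simp add: sum_power2_eq_zero_iff)
  qed
  ultimately show ?thesis by blast
qed

lemma quad_prod_kernel_quad_op:
  assumes lin: "linear T" and x: "quad_op a b T x = 0" "quad_prod L T x = 0" "x \<noteq> 0"
  shows "a \<in> fst ` set L"
  using x
proof (induction L)
  case (Cons ab L)
  have qc: "quad_op a b T (quad_prod L T x) = quad_prod L T (quad_op a b T x)"
    using quad_prod_swap[OF lin, of "[(a, b)]" L x] by simp
  show ?case
  proof (cases "quad_prod L T x = 0")
    case True then show ?thesis using Cons by auto
  next
    case False
    have "quad_op a b T (quad_prod L T x) = 0" using qc Cons linear_0[OF linear_quad_prod[OF lin]] by simp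
    then have "a = fst ab" using quad_op_kernels_disjoint[OF lin, of a b "quad_prod L T x" "fst ab" "snd ab"]
      Cons False by auto
    then show ?thesis by simp
  qed
qed simp

lemma quad_prod_kernels_disjoint:
  assumes lin: "linear T" and "fst ` set L \<inter> fst ` set M = {}"
    and "quad_prod L T x = 0" "quad_prod M T x = 0"
  shows "x = 0"
  using assms(2-)
proof (induction L arbitrary: x)
  case (Cons ab L)
  have "quad_prod M T (quad_prod L T x) = 0"
    using quad_prod_swap[OF lin, of M L x] Cons.prems linear_0[OF linear_quad_prod[OF lin]] by simp
  then have "quad_prod L T x = 0"
    using quad_prod_kernel_quad_op[OF lin, of "fst ab" "snd ab" "quad_prod L T x" M] Cons.prems by auto
  then show ?case using Cons by auto
qed simp

lemma dim_kernel_image: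
  fixes f :: "'a::euclidean_space \<Rightarrow> 'b::euclidean_space"
  assumes lin: "linear f" and V: "subspace V"
  shows "dim {x \<in> V. f x = 0} + dim (f ` V) = dim V"
proof -
  let ?K = "{x \<in> V. f x = 0}"
  let ?W = "{y \<in> V. \<forall>x\<in>?K. orthogonal x y}"
  have K: "subspace ?K"
    using V by (auto simp: subspace_def linear_0[OF lin] linear_add[OF lin] linear_cmul[OF lin])
  have W: "subspace ?W"
    using V by (auto simp: subspace_def orthogonal_def inner_add_right)
  have "f ` V = f ` ?W"
  proof (intro equalityI subsetI)
    fix u assume "u \<in> f ` V"
    then obtain x where x: "x \<in> V" "u = f x" by auto
    obtain y z where yz: "x = y + z" "y \<in> span ?K" "\<And>w. w \<in> span ?K \<Longrightarrow> orthogonal z w"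
      by (rule orthogonal_subspace_decomp_exists[of ?K x]) blast
    have y: "y \<in> V" "f y = 0" using yz(2) K by (auto simp: span_eq_iff[THEN iffD2])
    have "z \<in> V" using subspace_diff[OF V x(1) y(1)] yz(1) by simp
    then have "z \<in> ?W" using yz(3) by (auto simp: orthogonal_commute intro: span_base)
    moreover have "u = f z" using x yz(1) y by (simp add: linear_add[OF lin])
    ultimately show "u \<in> f ` ?W" by blast
  qed auto
  moreover have "inj_on f (span ?W)"
  proof (rule inj_onI)
    fix x y assume "x \<in> span ?W" "y \<in> span ?W" "f x = f y"
    then have "x \<in> ?W" "y \<in> ?W" using W by (simp_all only: span_eq_iff[THEN iffD2])
    then have "x - y \<in> ?W" using W by (rule subspace_diff[rotated])
    moreover have "f (x - y) = 0" using \<open>f x = f y\<close> by (simp add: linear_diff[OF lin])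
    ultimately have "orthogonal (x - y) (x - y)" by blast
    then show "x = y" by (simp add: orthogonal_def)
  qed
  ultimately have "dim (f ` V) = dim ?W" using dim_image_eq[OF lin, of ?W] by simp
  then show ?thesis using dim_subspace_orthogonal_to_vectors[OF K V] by auto
qed

text \<open>
  Divide out one quadratic kernel at a time: the image of \<open>V\<close> under the operator that annihilates a vector has smaller
  dimension. This replaces the factorisation of the characteristic polynomial.
\<close>

lemma annihilating_quad_prod:
  fixes T :: "'a::euclidean_space \<Rightarrow> 'a"
  assumes lin: "linear T"
  shows "subspace V \<Longrightarrow> (\<And>x. x \<in> V \<Longrightarrow> T x \<in> V) \<Longrightarrow> \<exists>L. \<forall>x\<in>V. quad_prod L T x = 0"
proof (induction "dim V" arbitrary: V rule: less_induct)
  case less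
  show ?case
  proof (cases "V = {0}")
    case True
    then show ?thesis by (intro exI[of _ "[]"]) auto
  next
    case False
    obtain a b x where x: "x \<in> V" "x \<noteq> 0" "quad_op a b T x = 0"
      using quad_op_kernel_exists[OF lin less.prems False] by blast
    let ?q = "quad_op a b T"
    have lq: "linear ?q" by (rule linear_quad_op[OF lin])
    have sub: "subspace (?q ` V)" by (rule linear_subspace_image[OF lq less.prems(1)])
    have "?q ` V \<subseteq> V" using less.prems by (auto intro: quad_op_in_subspace)
    have inv: "T y \<in> ?q ` V" if y: "y \<in> ?q ` V" for y
    proof -
      obtain w where w: "w \<in> V" "y = ?q w" using y by auto
      have "T (?q w) = ?q (T w)"
        by (rule quad_op_commutes[of T UNIV]) (use lin in auto)
      then show ?thesis using w less.prems by auto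
    qed
    have "dim (?q ` V) \<noteq> dim V"
    proof
      assume "dim (?q ` V) = dim V"
      then have eq: "?q ` V = V" 
        by (intro subspace_dim_equal sub less.prems \<open>?q ` V \<subseteq> V\<close>) auto
      have "dim {v \<in> V. ?q v = 0} + dim (?q ` V) = dim V"
        by (rule dim_kernel_image[OF lq less.prems(1)])
      then have "dim {v \<in> V. ?q v = 0} = 0" using eq by simp
      then show False using x by (auto simp: dim_eq_0)
    qed
    then have "dim (?q ` V) < dim V" using dim_subset[OF \<open>?q ` V \<subseteq> V\<close>] by simp
    from less.hyps[OF this sub inv] obtain L where "\<forall>y\<in>?q ` V. quad_prod L T y = 0" by blast
    then have "\<forall>y\<in>V. quad_prod (L @ [(a, b)]) T y = 0" by (simp add: quad_prod_append)
    then show ?thesis by blast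
  qed
qed

section \<open>Splitting by real parts\<close>

text \<open>
  The sum of the generalised eigenspaces whose eigenvalues have real part in \<open>S\<close>.
\<close>

definition re_space :: "real set \<Rightarrow> ('a::euclidean_space \<Rightarrow> 'a) \<Rightarrow> 'a set \<Rightarrow> 'a set" where
  "re_space S T V = {x \<in> V. \<exists>L. fst ` set L \<subseteq> S \<and> quad_prod L T x = 0}"

lemma re_space_subset: "re_space S T V \<subseteq> V"
  by (auto simp: re_space_def)

lemma quad_prod_zero: "linear T \<Longrightarrow> quad_prod L T 0 = 0"
  using linear_0[OF linear_quad_prod] .

lemma subspace_re_space:
  assumes "linear T" "subspace V"
  shows "subspace (re_space S T V)"
proof (unfold subspace_def, intro conjI ballI allI)
  show "0 \<in> re_space S T V" using assms by (auto simp: re_space_def subspace_0 intro!: exI[of _ "[]"])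
next
  fix x y assume "x \<in> re_space S T V" "y \<in> re_space S T V"
  then obtain L M where LM: "x \<in> V" "fst ` set L \<subseteq> S" "quad_prod L T x = 0"
      "y \<in> V" "fst ` set M \<subseteq> S" "quad_prod M T y = 0"
    by (auto simp: re_space_def)
  have "quad_prod (L @ M) T (x + y) = quad_prod M T (quad_prod L T x) + quad_prod L T (quad_prod M T y)"
    using quad_prod_swap[OF assms(1), of L M x]
    by (simp add: quad_prod_append linear_add[OF linear_quad_prod[OF assms(1)]])
  then have "quad_prod (L @ M) T (x + y) = 0" using LM by (simp add: quad_prod_zero[OF assms(1)])
  moreover have "x + y \<in> V" using LM subspace_add[OF assms(2)] by blast
  moreover have "fst ` set (L @ M) \<subseteq> S" using LM by (simp add: image_Un)
  ultimately show "x + y \<in> re_space S T V" unfolding re_space_def by blast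
next
  fix c x assume "x \<in> re_space S T V"
  then show "c *\<^sub>R x \<in> re_space S T V"
    using subspace_scale[OF assms(2)]
    by (auto simp: re_space_def linear_cmul[OF linear_quad_prod[OF assms(1)]])
qed

lemma re_space_invariant:
  assumes "linear S" "subspace V" "\<And>x. x \<in> V \<Longrightarrow> T x \<in> V" "\<And>x. x \<in> V \<Longrightarrow> S x \<in> V"
    and "\<And>x. x \<in> V \<Longrightarrow> S (T x) = T (S x)" "x \<in> re_space R T V"
  shows "S x \<in> re_space R T V"
proof -
  obtain L where L: "x \<in> V" "fst ` set L \<subseteq> R" "quad_prod L T x = 0"
    using assms(6) by (auto simp: re_space_def)
  have "quad_prod L T (S x) = S (quad_prod L T x)"
    by (rule quad_prod_commutes[of S V T, symmetric]) (use assms L in auto)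
  then show ?thesis using L assms(4) linear_0[OF assms(1)] by (auto simp: re_space_def)
qed

lemma re_space_disjoint:
  assumes "linear T" "S \<inter> R = {}" "x \<in> re_space S T V" "x \<in> re_space R T V"
  shows "x = 0"
  using assms quad_prod_kernels_disjoint[OF assms(1)] unfolding re_space_def
  by (smt (verit, best) disjoint_iff mem_Collect_eq subset_iff)

lemma quad_prod_filter:
  assumes "linear T"
  shows "quad_prod (filter P L) T (quad_prod (filter (\<lambda>x. \<not> P x) L) T x) = quad_prod L T x"
proof (induction L)
  case (Cons ab L)
  show ?case
  proof (cases "P ab")
    case False
    have "quad_prod (filter P L) T (quad_prod [ab] T (quad_prod (filter (\<lambda>x. \<not> P x) L) T x))
      = quad_prod [ab] T (quad_prod (filter P L) T (quad_prod (filter (\<lambda>x. \<not> P x) L) T x))"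
      by (rule quad_prod_swap[OF assms])
    then show ?thesis using False Cons by simp
  qed (use Cons in simp)
qed simp

lemma re_space_annihilator:
  assumes lin: "linear T" and V: "subspace V" "\<And>x. x \<in> V \<Longrightarrow> T x \<in> V"
  shows "\<exists>L. fst ` set L \<subseteq> S \<and> (\<forall>x\<in>re_space S T V. quad_prod L T x = 0)"
proof -
  obtain L where L: "\<forall>x\<in>V. quad_prod L T x = 0" using annihilating_quad_prod[OF lin V] by blast
  let ?L1 = "filter (\<lambda>ab. fst ab \<in> S) L" and ?L2 = "filter (\<lambda>ab. fst ab \<notin> S) L"
  have "quad_prod ?L1 T x = 0" if "x \<in> re_space S T V" for x
  proof -
    have xV: "x \<in> V" and "\<exists>M. fst ` set M \<subseteq> S \<and> quad_prod M T x = 0"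
      using that unfolding re_space_def by blast+
    then obtain M where M: "x \<in> V" "fst ` set M \<subseteq> S" "quad_prod M T x = 0" by blast
    have "quad_prod M T (quad_prod ?L1 T x) = 0"
      using quad_prod_swap[OF lin, of M ?L1 x] M by (simp add: quad_prod_zero[OF lin])
    moreover have "quad_prod ?L2 T (quad_prod ?L1 T x) = 0"
      using quad_prod_filter[OF lin, of "\<lambda>ab. fst ab \<in> S" L x] L M(1) quad_prod_swap[OF lin, of ?L1 ?L2 x]
      by simp
    moreover have "fst ` set M \<inter> fst ` set ?L2 = {}" using M(2) by auto
    ultimately show ?thesis using quad_prod_kernels_disjoint[OF lin] by blast
  qed
  then show ?thesis by (intro exI[of _ ?L1]) auto
qed

lemma re_space_Int:
  assumes lin: "linear T" and x: "x \<in> re_space S T V" "x \<in> re_space R T V"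
  shows "x \<in> re_space (S \<inter> R) T V"
proof -
  obtain L M where LM: "x \<in> V" "fst ` set L \<subseteq> S" "quad_prod L T x = 0"
      "fst ` set M \<subseteq> R" "quad_prod M T x = 0"
    using x by (auto simp: re_space_def)
  let ?L1 = "filter (\<lambda>ab. fst ab \<in> R) L" and ?L2 = "filter (\<lambda>ab. fst ab \<notin> R) L"
  have "quad_prod M T (quad_prod ?L1 T x) = 0"
    using quad_prod_swap[OF lin, of M ?L1 x] LM by (simp add: quad_prod_zero[OF lin])
  moreover have "quad_prod ?L2 T (quad_prod ?L1 T x) = 0"
    using quad_prod_filter[OF lin, of "\<lambda>ab. fst ab \<in> R" L x] LM quad_prod_swap[OF lin, of ?L1 ?L2 x]
    by simp
  moreover have "fst ` set M \<inter> fst ` set ?L2 = {}" using LM by auto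
  ultimately have "quad_prod ?L1 T x = 0" using quad_prod_kernels_disjoint[OF lin] by blast
  moreover have "fst ` set ?L1 \<subseteq> S \<inter> R" using LM by auto
  ultimately show ?thesis using LM unfolding re_space_def by blast
qed

text \<open>
  Split an annihilating product into the factors with real part in \<open>S\<close> and the others. The kernel of the first
  group lies in one space and its image in the other, so rank and nullity give enough dimension for the sum.
\<close>

lemma re_space_decomposition:
  assumes lin: "linear T" and V: "subspace V" "\<And>x. x \<in> V \<Longrightarrow> T x \<in> V" and x: "x \<in> V"
  shows "\<exists>y\<in>re_space S T V. \<exists>z\<in>re_space (- S) T V. x = y + z"
proof -
  obtain L where L: "\<forall>x\<in>V. quad_prod L T x = 0" using annihilating_quad_prod[OF lin V] by blast
  let ?L1 = "filter (\<lambda>ab. fst ab \<in> S) L" and ?L2 = "filter (\<lambda>ab. fst ab \<notin> S) L"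
  let ?A = "re_space S T V" and ?B = "re_space (- S) T V"
  have sA: "subspace ?A" and sB: "subspace ?B" by (auto intro: subspace_re_space lin V)
  have "{x \<in> V. quad_prod ?L1 T x = 0} \<subseteq> ?A" by (auto simp: re_space_def intro!: exI[of _ ?L1])
  then have dA: "dim {x \<in> V. quad_prod ?L1 T x = 0} \<le> dim ?A" by (rule dim_subset)
  have "quad_prod ?L1 T ` V \<subseteq> ?B"
  proof (intro subsetI, elim imageE)
    fix u y assume y: "u = quad_prod ?L1 T y" "y \<in> V"
    have "quad_prod ?L2 T (quad_prod ?L1 T y) = 0"
      using quad_prod_filter[OF lin, of "\<lambda>ab. fst ab \<in> S" L y] L y quad_prod_swap[OF lin, of ?L1 ?L2 y]
      by simp
    moreover have "u \<in> V" unfolding y by (intro quad_prod_in_subspace V y)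
    ultimately show "u \<in> ?B" using y by (auto simp: re_space_def intro!: exI[of _ ?L2])
  qed
  then have dB: "dim (quad_prod ?L1 T ` V) \<le> dim ?B" by (rule dim_subset)
  let ?C = "{y + z |y z. y \<in> ?A \<and> z \<in> ?B}"
  have "?A \<inter> ?B = {0}" using re_space_disjoint[OF lin, of S "- S"] subspace_0[OF sA] subspace_0[OF sB] by auto
  then have "dim ?C = dim ?A + dim ?B" using dim_sums_Int[OF sA sB] by simp
  moreover have "dim V = dim {x \<in> V. quad_prod ?L1 T x = 0} + dim (quad_prod ?L1 T ` V)"
    by (rule dim_kernel_image[symmetric]) (auto intro: linear_quad_prod lin V)
  ultimately have "dim V \<le> dim ?C" using dA dB by linarith
  moreover have "?C \<subseteq> V" using V(1) by (auto simp: re_space_def intro: subspace_add)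
  ultimately have "?C = V" using subspace_sums[OF sA sB] V(1) by (intro subspace_dim_equal) auto
  then show ?thesis using x by blast
qed

section \<open>Flags for commuting families\<close>

text \<open>
  A basis adapted to a flag of invariant subspaces of the family \<open>\<phi>\<close>, indexed by \<open>lev\<close>, such that the
  matrices on the graded pieces are scalar plus skew. The property \<open>rate\<close> says that the scalar is the real part of an
  eigenvalue.
\<close>

locale flag_basis =
  fixes \<phi> :: "'c \<Rightarrow> 'a::euclidean_space \<Rightarrow> 'a" and V B :: "'a set"
    and lev :: "'a \<Rightarrow> nat" and d :: "'c \<Rightarrow> 'a \<Rightarrow> 'a \<Rightarrow> real"
  assumes fin: "finite B" and ind: "independent B" and sp: "span B = V"
    and exp: "b \<in> B \<Longrightarrow> \<phi> c b = (\<Sum>b'\<in>B. d c b b' *\<^sub>R b')"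
    and tri: "b \<in> B \<Longrightarrow> b' \<in> B \<Longrightarrow> d c b b' \<noteq> 0 \<Longrightarrow> lev b' \<le> lev b"
    and skew: "b \<in> B \<Longrightarrow> b' \<in> B \<Longrightarrow> lev b = lev b' \<Longrightarrow> b \<noteq> b' \<Longrightarrow> d c b b' = - d c b' b"
    and diag: "b \<in> B \<Longrightarrow> b' \<in> B \<Longrightarrow> lev b = lev b' \<Longrightarrow> d c b b = d c b' b'"
    and rate: "(\<forall>x\<in>V. quad_prod L (\<phi> c) x = 0) \<Longrightarrow> b \<in> B \<Longrightarrow> d c b b \<in> fst ` set L"

text \<open>
  Schur's lemma. Every member acts by a root of one quadratic polynomial, since its kernel is invariant. If not all
  members are scalar, one of them yields a complex structure \<open>J\<close>, every member is \<open>a + s J\<close>, and the plane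
  spanned by \<open>x\<close> and \<open>J x\<close> is the whole space; in this basis \<open>J\<close> is skew.
\<close>

lemma irreducible_commuting_family:
  fixes \<phi> :: "'c \<Rightarrow> 'a::euclidean_space \<Rightarrow> 'a"
  assumes lin: "\<And>c. linear (\<phi> c)" and U: "subspace U" "U \<noteq> {0}" 
    and inv: "\<And>c x. x \<in> U \<Longrightarrow> \<phi> c x \<in> U"
    and comm: "\<And>c d x. x \<in> U \<Longrightarrow> \<phi> c (\<phi> d x) = \<phi> d (\<phi> c x)"
    and irr: "\<And>W. subspace W \<Longrightarrow> W \<subseteq> U \<Longrightarrow> W \<noteq> {0} \<Longrightarrow> (\<And>c x. x \<in> W \<Longrightarrow> \<phi> c x \<in> W) \<Longrightarrow> W = U"
  shows "\<exists>B d. flag_basis \<phi> U B (\<lambda>_. 0) d"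
proof -
  have kernel: "{x \<in> U. f x = 0} = U"
    if f: "linear f" "\<And>c x. x \<in> U \<Longrightarrow> \<phi> c (f x) = f (\<phi> c x)" and x: "x \<in> U" "x \<noteq> 0" "f x = 0" for f x
  proof (rule irr)
    show "subspace {x \<in> U. f x = 0}"
      using U(1) f(1) by (auto simp: subspace_def linear_0 linear_add linear_cmul)
    fix c y assume "y \<in> {x \<in> U. f x = 0}"
    then show "\<phi> c y \<in> {x \<in> U. f x = 0}" using f(2)[of y c] inv linear_0[OF lin] by auto
  qed (use x in auto)
  have "\<exists>a b. \<forall>x\<in>U. quad_op a b (\<phi> c) x = 0" for c
  proof -
    obtain a b x where x: "x \<in> U" "x \<noteq> 0" "quad_op a b (\<phi> c) x = 0"
      using quad_op_kernel_exists[OF lin U(1) inv U(2)] by blast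
    have "{x \<in> U. quad_op a b (\<phi> c) x = 0} = U"
    proof (rule kernel)
      fix d y assume "y \<in> U"
      then show "\<phi> d (quad_op a b (\<phi> c) y) = quad_op a b (\<phi> c) (\<phi> d y)"
        by (intro quad_op_commutes[of "\<phi> d" U]) (use lin inv comm in auto)
    qed (use x lin in \<open>auto intro: linear_quad_op\<close>)
    then show ?thesis by auto
  qed
  then obtain a \<beta> where q: "\<And>c x. x \<in> U \<Longrightarrow> quad_op (a c) (\<beta> c) (\<phi> c) x = 0" by metis
  have rate: "a c \<in> fst ` set L" if "\<forall>x\<in>U. quad_prod L (\<phi> c) x = 0" for c L
  proof -
    obtain x where "x \<in> U" "x \<noteq> 0" using U subspace_0 by blast
    then show ?thesis using quad_prod_kernel_quad_op[OF lin] q that by blast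
  qed
  define N where "N c x = \<phi> c x - a c *\<^sub>R x" for c x
  have linN: "linear (N c)" for c
    by (intro linearI) (simp_all add: N_def linear_add[OF lin] linear_cmul[OF lin] algebra_simps)
  have NU: "N c x \<in> U" if "x \<in> U" for c x
    unfolding N_def by (intro subspace_diff[OF U(1)] subspace_scale[OF U(1)] inv that)
  have Ncomm: "\<phi> d (N c x) = N c (\<phi> d x)" "N d (N c x) = N c (N d x)" if "x \<in> U" for c d x
    using that comm[of x c d]
    by (simp_all add: N_def linear_diff[OF lin] linear_cmul[OF lin] algebra_simps)
  have NN: "N c (N c x) = - ((\<beta> c)\<^sup>2) *\<^sub>R x" if "x \<in> U" for c x
  proof -
    have "N c (N c x) = quad_op (a c) (\<beta> c) (\<phi> c) x - ((\<beta> c)\<^sup>2) *\<^sub>R x"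
      by (simp add: N_def quad_op_def linear_diff[OF lin] linear_cmul[OF lin] algebra_simps power2_eq_square)
        (simp flip: scaleR_2)
    then show ?thesis using q[OF that] by simp
  qed
  show ?thesis
  proof (cases "\<forall>c. \<forall>x\<in>U. N c x = 0")
    case True
    then have sc: "\<phi> c x = a c *\<^sub>R x" if "x \<in> U" for c x using that by (auto simp: N_def)
    obtain x where x: "x \<in> U" "x \<noteq> 0" using U subspace_0 by blast
    have "span {x} = U"
    proof (rule irr)
      show "span {x} \<subseteq> U" using x U(1) by (simp add: span_minimal)
      then show "\<phi> c y \<in> span {x}" if "y \<in> span {x}" for c y
        using that sc[of y c] span_scale[of y "{x}" "a c"] by (metis subsetD)
      have "x \<in> span {x}" by (rule span_base) simp
      then show "span {x} \<noteq> {0}" using x(2) by blast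
    qed simp
    then have "flag_basis \<phi> U {x} (\<lambda>_. 0) (\<lambda>c _ _. a c)"
      using x sc rate by unfold_locales auto
    then show ?thesis by blast
  next
    case False
    then obtain c0 x0 where c0: "x0 \<in> U" "N c0 x0 \<noteq> 0" by blast
    have b0: "\<beta> c0 \<noteq> 0"
    proof
      assume "\<beta> c0 = 0"
      then have "N c0 (N c0 x0) = 0" using NN[OF c0(1)] by simp
      then have "{x \<in> U. N c0 x = 0} = U"
        by (intro kernel[of "N c0" "N c0 x0"]) (use c0 linN Ncomm NU in auto)
      then show False using c0 by auto
    qed
    define J where "J x = (1 / \<beta> c0) *\<^sub>R N c0 x" for x
    have linJ: "linear J"
      by (intro linearI) (simp_all add: J_def linear_add[OF linN] linear_cmul[OF linN] algebra_simps)
    have JU: "J x \<in> U" if "x \<in> U" for x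
      unfolding J_def by (intro subspace_scale[OF U(1)] NU that)
    have JJ: "J (J x) = - x" if "x \<in> U" for x
      using NN[OF that, of c0] b0 by (simp add: J_def linear_cmul[OF linN] power2_eq_square)
    have NJ: "N c (J x) = J (N c x)" "\<phi> c (J x) = J (\<phi> c x)" if "x \<in> U" for c x
      using Ncomm[OF that] by (simp_all add: J_def linear_cmul[OF linN] linear_cmul[OF lin])
    have "\<exists>s. \<forall>x\<in>U. N c x = s *\<^sub>R J x" for c
    proof -
      let ?f = "\<lambda>x. N c x + \<beta> c *\<^sub>R J x"
      have linf: "linear ?f"
        by (intro linearI) (simp_all add: linear_add[OF linN] linear_cmul[OF linN]
            linear_add[OF linJ] linear_cmul[OF linJ] algebra_simps)
      show ?thesis
      proof (cases "\<exists>x\<in>U. x \<noteq> 0 \<and> ?f x = 0")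
        case True
        then obtain y where "y \<in> U" "y \<noteq> 0" "?f y = 0" by blast
        then have "{x \<in> U. ?f x = 0} = U"
          by (intro kernel[of ?f y] linf) (auto simp: linear_add[OF lin] linear_cmul[OF lin] Ncomm NJ)
        then have "\<forall>x\<in>U. N c x = (- \<beta> c) *\<^sub>R J x" by (auto simp: eq_neg_iff_add_eq_0)
        then show ?thesis by blast
      next
        case False
        have "N c x = \<beta> c *\<^sub>R J x" if "x \<in> U" for x
        proof -
          have "?f (N c x - \<beta> c *\<^sub>R J x) = 0"
            using that by (simp add: linear_diff[OF linN] linear_diff[OF linJ] linear_cmul[OF linN]
                linear_cmul[OF linJ] NJ NN JJ power2_eq_square algebra_simps)
          moreover have "N c x - \<beta> c *\<^sub>R J x \<in> U"
            by (intro subspace_diff[OF U(1)] subspace_scale[OF U(1)] NU JU that)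
          ultimately show ?thesis using False by auto
        qed
        then show ?thesis by blast
      qed
    qed
    then obtain s where s: "\<And>c x. x \<in> U \<Longrightarrow> N c x = s c *\<^sub>R J x" by metis
    have \<phi>: "\<phi> c x = a c *\<^sub>R x + s c *\<^sub>R J x" if "x \<in> U" for c x
      using s[OF that, of c] by (simp add: N_def algebra_simps)
    have x0: "x0 \<noteq> 0" using c0 linear_0[OF linN] by auto
    have Jx0: "J x0 \<notin> span {x0}"
    proof
      assume "J x0 \<in> span {x0}"
      then obtain m where m: "J x0 = m *\<^sub>R x0" by (auto simp: span_singleton)
      then have "- x0 = (m * m) *\<^sub>R x0" using JJ[OF c0(1)] by (simp add: linear_cmul[OF linJ])
      have "(m * m + 1) *\<^sub>R x0 = (m * m) *\<^sub>R x0 + x0" by (simp only: scaleR_add_left scaleR_one)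
      also have "\<dots> = 0" unfolding \<open>- x0 = (m * m) *\<^sub>R x0\<close>[symmetric] by simp
      finally have "(m * m + 1) *\<^sub>R x0 = 0" .
      then have "m * m + 1 = 0" using x0 by simp
      then show False using zero_le_square[of m] by linarith
    qed
    have ind: "independent {x0, J x0}"
      using x0 Jx0 independent_insertI[of "J x0" "{x0}"] by (auto simp: insert_commute)
    have ne: "x0 \<noteq> J x0" using Jx0 by (metis span_base singletonI)
    have sp: "span {x0, J x0} = U"
    proof (rule irr)
      show sub: "span {x0, J x0} \<subseteq> U" using c0 JU U(1) by (simp add: span_minimal)
      show "\<phi> c y \<in> span {x0, J x0}" if y: "y \<in> span {x0, J x0}" for c y
      proof -
        have "J y \<in> span {x0, J x0}"
        proof -
          have "J ` span {x0, J x0} = span (J ` {x0, J x0})" by (rule linear_span_image[OF linJ, symmetric])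
          also have "\<dots> \<subseteq> span {x0, J x0}"
            using JJ[OF c0(1)] by (intro span_minimal) (auto intro: span_base span_neg)
          finally show ?thesis using y by auto
        qed
        moreover have "y \<in> U" using y sub by auto
        ultimately show ?thesis using \<phi> y by (auto intro!: span_add span_scale)
      qed
      have "x0 \<in> span {x0, J x0}" by (rule span_base) simp
      then show "span {x0, J x0} \<noteq> {0}" using x0 by blast
    qed simp
    define d where "d c b b' = (if b = b' then a c else if b = x0 then s c else - s c)" for c b b'
    have "\<phi> c b = (\<Sum>b'\<in>{x0, J x0}. d c b b' *\<^sub>R b')" if "b \<in> {x0, J x0}" for c b
      using that ne \<phi>[OF c0(1), of c] \<phi>[OF JU[OF c0(1)], of c] JJ[OF c0(1)] by (auto simp: d_def)
    then have "flag_basis \<phi> U {x0, J x0} (\<lambda>_. 0) d"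
      using ind sp rate ne by unfold_locales (auto simp: d_def)
    then show ?thesis by blast
  qed
qed

lemma independent_Un_disjoint_spans:
  fixes B C :: "'a::euclidean_space set"
  assumes "independent B" "independent C" "span B \<inter> span C = {0}"
  shows "independent (B \<union> C)" "B \<inter> C = {}"
proof -
  have fin: "finite B" "finite C" using assms by (auto intro: independent_imp_finite)
  show dis: "B \<inter> C = {}"
  proof (rule ccontr)
    assume "B \<inter> C \<noteq> {}"
    then obtain x where x: "x \<in> B" "x \<in> C" by blast
    then have "x \<in> span B \<inter> span C" by (simp add: span_base)
    then have "x = 0" using assms(3) by blast
    then show False using x assms(1) dependent_zero by blast
  qed
  have "span (B \<union> C) = {x + y |x y. x \<in> span B \<and> y \<in> span C}" by (rule span_Un)
  then have "dim (span (B \<union> C)) = dim (span B) + dim (span C)"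
    using dim_sums_Int[of "span B" "span C"] assms(3) by simp
  also have "\<dots> = card B + card C" using assms(1,2) by (simp add: dim_eq_card_independent)
  also have "\<dots> = card (B \<union> C)" using dis fin by (simp add: card_Un_disjoint)
  finally show "independent (B \<union> C)"
    using fin by (intro card_le_dim_spanning[of _ "span (B \<union> C)"]) (auto intro: span_base)
qed

lemma linear_projection_exists:
  fixes U :: "'a::euclidean_space set"
  assumes "subspace U"
  shows "\<exists>P. linear P \<and> (\<forall>x. P x \<in> U) \<and> (\<forall>x\<in>U. P x = x)"
proof -
  obtain B where B: "pairwise orthogonal B" "\<And>x. x \<in> B \<Longrightarrow> norm x = 1" "independent B" "span B = U"
    using orthonormal_basis_subspace[OF assms] by metis
  have fin: "finite B" using B by (auto intro: independent_imp_finite)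
  define P where "P x = (\<Sum>b\<in>B. (x \<bullet> b) *\<^sub>R b)" for x
  have lin: "linear P"
    by (intro linearI) (simp_all add: P_def inner_add_left scaleR_add_left sum.distrib scaleR_sum_right)
  have PU: "P x \<in> U" for x
    unfolding P_def B(4)[symmetric] by (intro span_sum span_scale span_base)
  have "P x = id x" if "x \<in> span B" for x
  proof (rule linear_eq_on[OF lin linear_id that])
    fix c assume c: "c \<in> B"
    have "P c = (\<Sum>b\<in>B. if b = c then c else 0)"
      unfolding P_def
    proof (rule sum.cong)
      fix b assume b: "b \<in> B"
      show "(c \<bullet> b) *\<^sub>R b = (if b = c then c else 0)"
      proof (cases "b = c")
        case True
        then show ?thesis using B(2)[OF c] by (simp add: dot_square_norm)
      next
        case False
        then have "c \<bullet> b = 0" using B(1) b c by (auto simp: pairwise_def orthogonal_def)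
        then show ?thesis using False by simp
      qed
    qed simp
    also have "\<dots> = c" using c fin by simp
    finally show "P c = id c" by simp
  qed
  then show ?thesis using lin PU B(4) by (intro exI[of _ P]) auto
qed

text \<open>
  Induction on the dimension: put a minimal invariant subspace at the lowest level and pass to the quotient, realised as
  the kernel of a projection, on which the compressed operators still commute.
\<close>

lemma commuting_family_flag:
  fixes \<phi> :: "'c \<Rightarrow> 'a::euclidean_space \<Rightarrow> 'a"
  shows "(\<And>c. linear (\<phi> c)) \<Longrightarrow> subspace V \<Longrightarrow> (\<And>c x. x \<in> V \<Longrightarrow> \<phi> c x \<in> V) \<Longrightarrow>
    (\<And>c d x. x \<in> V \<Longrightarrow> \<phi> c (\<phi> d x) = \<phi> d (\<phi> c x)) \<Longrightarrow>
    \<exists>B lev d. flag_basis \<phi> V B lev d"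
proof (induction "dim V" arbitrary: V \<phi> rule: less_induct)
  case less
  note lin = less.prems(1) and V = less.prems(2) and inv = less.prems(3) and comm = less.prems(4)
  show ?case
  proof (cases "V = {0}")
    case True
    have "flag_basis \<phi> V {} (\<lambda>_. 0) (\<lambda>_ _ _. 0)"
      using True by unfold_locales (auto simp: independent_empty)
    then show ?thesis by blast
  next
    case False
    define ok where "ok W \<longleftrightarrow> subspace W \<and> W \<subseteq> V \<and> W \<noteq> {0} \<and> (\<forall>c. \<forall>x\<in>W. \<phi> c x \<in> W)" for W
    have "ok V" using V inv False by (auto simp: ok_def)
    then obtain U where U: "ok U" and least: "\<And>W. ok W \<Longrightarrow> dim U \<le> dim W"
      using ex_has_least_nat[of ok V dim] by blast
    have U': "subspace U" "U \<subseteq> V" "U \<noteq> {0}" "\<And>c x. x \<in> U \<Longrightarrow> \<phi> c x \<in> U"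
      using U by (auto simp: ok_def)
    have irr: "W = U" if W: "subspace W" "W \<subseteq> U" "W \<noteq> {0}" "\<And>c x. x \<in> W \<Longrightarrow> \<phi> c x \<in> W" for W
    proof (rule subspace_dim_equal[OF W(1) U'(1) W(2)])
      have "ok W" using W U' by (auto simp: ok_def)
      then show "dim U \<le> dim W" by (rule least)
    qed
    have "\<exists>B d. flag_basis \<phi> U B (\<lambda>_. 0) d"
      by (rule irreducible_commuting_family[OF lin U'(1,3,4) _ irr]) (use comm U' in auto)
    then obtain BU dU where "flag_basis \<phi> U BU (\<lambda>_. 0) dU" by blast
    then interpret BU: flag_basis \<phi> U BU "\<lambda>_. 0" dU .
    note BU = BU.fin BU.ind BU.sp BU.exp BU.tri BU.skew BU.diag BU.rate
    obtain P where P: "linear P" "\<And>x. P x \<in> U" "\<And>x. x \<in> U \<Longrightarrow> P x = x"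
      using linear_projection_exists[OF U'(1)] by blast
    define V' where "V' = {x \<in> V. P x = 0}"
    define pr where "pr x = x - P x" for x
    define \<psi> where "\<psi> c x = pr (\<phi> c x)" for c x
    have linpr: "linear pr"
      by (intro linearI) (simp_all add: pr_def linear_add[OF P(1)] linear_cmul[OF P(1)] algebra_simps)
    have lin\<psi>: "linear (\<psi> c)" for c
      by (intro linearI) (simp_all add: \<psi>_def linear_add[OF linpr] linear_cmul[OF linpr] linear_add[OF lin] linear_cmul[OF lin])
    have V': "subspace V'"
      using V unfolding V'_def
      by (auto simp: subspace_def linear_0[OF P(1)] linear_add[OF P(1)] linear_cmul[OF P(1)])
    have prV: "pr x \<in> V'" if "x \<in> V" for x
      using that P U'(2) subspace_diff[OF V, of x "P x"] by (auto simp: V'_def pr_def linear_diff[OF P(1)])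
    have prU: "pr x = 0" if "x \<in> U" for x using P(3)[OF that] by (simp add: pr_def)
    have pr\<phi>: "pr (\<phi> c (pr x)) = pr (\<phi> c x)" for c x
    proof -
      have "pr (\<phi> c (P x)) = 0" by (intro prU U'(4) P)
      then show ?thesis by (simp add: pr_def[of x] linear_diff[OF lin] linear_diff[OF linpr])
    qed
    have inv': "\<psi> c x \<in> V'" if "x \<in> V'" for c x
      using that inv prV by (auto simp: \<psi>_def V'_def)
    have comm': "\<psi> c (\<psi> d x) = \<psi> d (\<psi> c x)" if "x \<in> V'" for c d x
      using that comm[of x c d] by (simp add: \<psi>_def pr\<phi> V'_def)
    have prV': "pr x = x" if "x \<in> V'" for x using that by (simp add: pr_def V'_def)
    have qp: "quad_prod L (\<psi> c) (pr x) = pr (quad_prod L (\<phi> c) x)" for L c x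
    proof (induction L)
      case (Cons ab L)
      show ?case unfolding quad_prod.simps Cons.IH
        by (simp add: quad_op_def \<psi>_def pr\<phi> linear_add[OF linpr] linear_diff[OF linpr] linear_cmul[OF linpr])
    qed simp
    have int: "U \<inter> V' = {0}"
      using P(3) subspace_0[OF U'(1)] subspace_0[OF V'] by (auto simp: V'_def)
    have "V' \<subseteq> V" by (auto simp: V'_def)
    have "dim V' < dim V"
    proof (rule ccontr)
      assume "\<not> dim V' < dim V"
      then have "V' = V" by (intro subspace_dim_equal[OF V' V \<open>V' \<subseteq> V\<close>]) simp
      then show False using int U'(2,3) by auto
    qed
    then have "\<exists>B lev d. flag_basis \<psi> V' B lev d"
      using lin\<psi> V' inv' comm' by (rule less.hyps)
    then obtain B lev d where "flag_basis \<psi> V' B lev d" by blast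
    then interpret B: flag_basis \<psi> V' B lev d .
    note B = B.fin B.ind B.sp B.exp B.tri B.skew B.diag B.rate
    have un: "independent (BU \<union> B)" "BU \<inter> B = {}"
      using independent_Un_disjoint_spans[OF BU(2) B(2)] int BU(3) B(3) by auto
    have spU: "span (BU \<union> B) = V"
    proof
      show "span (BU \<union> B) \<subseteq> V"
        using BU(3) B(3) U'(2) \<open>V' \<subseteq> V\<close> span_superset[of BU] span_superset[of B] V
        by (intro span_minimal) auto
      show "V \<subseteq> span (BU \<union> B)"
      proof
        fix x assume x: "x \<in> V"
        have "P x \<in> span (BU \<union> B)" using P(2)[of x] span_mono[of BU "BU \<union> B"] BU(3) by auto
        moreover have "pr x \<in> span (BU \<union> B)" using prV[OF x] span_mono[of B "BU \<union> B"] B(3) by auto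
        ultimately have "P x + pr x \<in> span (BU \<union> B)" by (rule span_add)
        then show "x \<in> span (BU \<union> B)" by (simp add: pr_def)
      qed
    qed
    have "\<exists>u. P (\<phi> c b) = (\<Sum>b'\<in>BU. u b' *\<^sub>R b')" for c b
    proof -
      have "P (\<phi> c b) \<in> span BU" using P(2) BU(3) by simp
      then show ?thesis using span_finite[OF BU(1)] by auto
    qed
    then obtain u where u: "\<And>c b. P (\<phi> c b) = (\<Sum>b'\<in>BU. u c b b' *\<^sub>R b')" by metis
    define D where "D c b b' = (if b \<in> BU then (if b' \<in> BU then dU c b b' else 0)
        else (if b' \<in> BU then u c b b' else d c b b'))" for c b b'
    define l where "l b = (if b \<in> BU then 0 else Suc (lev b))" for b
    have 1: "\<phi> c b = (\<Sum>b'\<in>BU \<union> B. D c b b' *\<^sub>R b')" if b: "b \<in> BU \<union> B" for c b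
    proof -
      have split: "(\<Sum>b'\<in>BU \<union> B. D c b b' *\<^sub>R b')
          = (\<Sum>b'\<in>BU. D c b b' *\<^sub>R b') + (\<Sum>b'\<in>B. D c b b' *\<^sub>R b')"
        using un BU(1) B(1) by (intro sum.union_disjoint) auto
      show ?thesis
      proof (cases "b \<in> BU")
        case True
        have "(\<Sum>b'\<in>BU. D c b b' *\<^sub>R b') = \<phi> c b"
          unfolding BU(4)[OF True] using True by (intro sum.cong) (auto simp: D_def)
        moreover have "(\<Sum>b'\<in>B. D c b b' *\<^sub>R b') = 0"
          using True un(2) by (intro sum.neutral) (auto simp: D_def)
        ultimately show ?thesis using split by simp
      next
        case False
        then have bB: "b \<in> B" using b by blast
        have "(\<Sum>b'\<in>BU. D c b b' *\<^sub>R b') = P (\<phi> c b)"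
          unfolding u using False by (intro sum.cong) (auto simp: D_def)
        moreover have "(\<Sum>b'\<in>B. D c b b' *\<^sub>R b') = \<psi> c b"
          unfolding B(4)[OF bB] using False un(2) by (intro sum.cong) (auto simp: D_def)
        ultimately show ?thesis using split by (simp add: \<psi>_def pr_def)
      qed
    qed
    have 2: "l b' \<le> l b" if "b \<in> BU \<union> B" "b' \<in> BU \<union> B" "D c b b' \<noteq> 0" for c b b'
    proof (cases "b \<in> BU \<or> b' \<in> BU")
      case True then show ?thesis using that by (auto simp: l_def D_def split: if_splits)
    next
      case False then show ?thesis using that B(5)[of b b' c] by (auto simp: l_def D_def)
    qed
    have 3: "D c b b' = - D c b' b" "D c b b = D c b' b'"
      if "b \<in> BU \<union> B" "b' \<in> BU \<union> B" "l b = l b'" "b \<noteq> b'" for c b b'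
    proof (atomize(full), cases "b \<in> BU")
      case True
      then have "b' \<in> BU" using that by (auto simp: l_def split: if_splits)
      then show "D c b b' = - D c b' b \<and> D c b b = D c b' b'"
        using True BU(6,7)[of b b' c] that by (simp add: D_def)
    next
      case False
      then have "b \<in> B" "b' \<in> B" "b' \<notin> BU" "lev b = lev b'" using that by (auto simp: l_def split: if_splits)
      then show "D c b b' = - D c b' b \<and> D c b b = D c b' b'"
        using False B(6,7)[of b b' c] that by (simp add: D_def)
    qed
    have 4: "D c b b \<in> fst ` set L" if "\<forall>x\<in>V. quad_prod L (\<phi> c) x = 0" "b \<in> BU \<union> B" for c L b
    proof (cases "b \<in> BU")
      case True
      then show ?thesis using BU(8)[of L c b] that U'(2) by (auto simp: D_def)
    next
      case False
      have "\<forall>x\<in>V'. quad_prod L (\<psi> c) x = 0"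
      proof
        fix x assume x: "x \<in> V'"
        have "quad_prod L (\<psi> c) (pr x) = pr 0" using qp that(1) x \<open>V' \<subseteq> V\<close> by auto
        then show "quad_prod L (\<psi> c) x = 0" using prV'[OF x] linear_0[OF linpr] by simp
      qed
      then show ?thesis using B(8)[of L c b] that False by (auto simp: D_def)
    qed
    have "flag_basis \<phi> V (BU \<union> B) l D"
    proof
      show "finite (BU \<union> B)" using BU(1) B(1) by simp
      show "D c b b = D c b' b'" if "b \<in> BU \<union> B" "b' \<in> BU \<union> B" "l b = l b'" for c b b'
        using 3(2)[OF that] by (cases "b = b'") auto
    qed (fact un(1) spU 1 2 3 4)+
    then show ?thesis by blast
  qed
qed

section \<open>Traces of operators on invariant subspaces\<close>

lemma lin_trace_commute:
  fixes f g :: "'a::euclidean_space \<Rightarrow> 'a"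
  assumes "linear f" "linear g"
  shows "lin_trace (\<lambda>x. f (g x)) = lin_trace (\<lambda>x. g (f x))"
proof -
  have expand: "h x \<bullet> b = (\<Sum>c\<in>Basis. (x \<bullet> c) * (h c \<bullet> b))" if "linear h" for h :: "'a \<Rightarrow> 'a" and x b
  proof -
    have "h x = h (\<Sum>c\<in>Basis. (x \<bullet> c) *\<^sub>R c)" by (simp add: euclidean_representation)
    also have "\<dots> = (\<Sum>c\<in>Basis. (x \<bullet> c) *\<^sub>R h c)"
      by (simp add: linear_sum[OF that] linear_cmul[OF that])
    finally show ?thesis by (simp add: inner_sum_left)
  qed
  have "lin_trace (\<lambda>x. f (g x)) = (\<Sum>b\<in>Basis. \<Sum>c\<in>Basis. (g b \<bullet> c) * (f c \<bullet> b))"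
    unfolding lin_trace_def by (intro sum.cong refl expand[OF assms(1)])
  also have "\<dots> = (\<Sum>c\<in>Basis. \<Sum>b\<in>Basis. (f c \<bullet> b) * (g b \<bullet> c))"
    by (subst sum.swap) (simp add: mult.commute)
  also have "\<dots> = lin_trace (\<lambda>x. g (f x))"
    unfolding lin_trace_def by (intro sum.cong refl expand[OF assms(2), symmetric])
  finally show ?thesis .
qed

text \<open>
  On \<open>V\<close> a commutator has trace zero but the identity has trace \<open>dim V\<close>. Composing with a projection
  onto \<open>V\<close> turns these into traces on the ambient space.
\<close>

lemma commutator_not_identity:
  fixes A C :: "'a::euclidean_space \<Rightarrow> 'a"
  assumes V: "subspace V" "V \<noteq> {0}" and lin: "linear A" "linear C"
    and inv: "\<And>x. x \<in> V \<Longrightarrow> A x \<in> V" "\<And>x. x \<in> V \<Longrightarrow> C x \<in> V"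
    and comm: "\<And>x. x \<in> V \<Longrightarrow> A (C x) - C (A x) = x"
  shows False
proof -
  obtain P where P: "linear P" "\<And>x. P x \<in> V" "\<And>x. x \<in> V \<Longrightarrow> P x = x"
    using linear_projection_exists[OF V(1)] by blast
  obtain B where B: "pairwise orthogonal B" "\<And>x. x \<in> B \<Longrightarrow> norm x = 1" "independent B" "span B = V" "card B = dim V"
    using orthonormal_basis_subspace[OF V(1)] by metis
  have lAP: "linear (\<lambda>x. A (P x))" and lCP: "linear (\<lambda>x. C (P x))"
    using linear_compose[OF P(1) lin(1)] linear_compose[OF P(1) lin(2)] by (simp_all add: o_def)
  have "P x = A (P (C (P x))) - C (P (A (P x)))" for x
    using comm[OF P(2)[of x]] P(3) inv P(2) by simp
  then have "lin_trace P = lin_trace (\<lambda>x. A (P (C (P x)))) - lin_trace (\<lambda>x. C (P (A (P x))))"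
    unfolding lin_trace_def by (subst sum_subtractf[symmetric]) (simp add: inner_diff_left[symmetric])
  then have tr0: "lin_trace P = 0" using lin_trace_commute[OF lAP lCP] by simp
  text \<open>The trace of a projection vanishes only if its range is trivial.\<close>
  define Q where "Q x = (\<Sum>b\<in>B. (x \<bullet> b) *\<^sub>R b)" for x
  have fin: "finite B" using B(3) by (rule independent_imp_finite)
  have linQ: "linear Q"
    by (intro linearI) (simp_all add: Q_def inner_add_left scaleR_add_left sum.distrib scaleR_sum_right)
  have QV: "Q x \<in> V" for x unfolding Q_def B(4)[symmetric] by (intro span_sum span_scale span_base)
  have Qid: "Q x = x" if "x \<in> V" for x
  proof -
    have "Q x = id x"
    proof (rule linear_eq_on[OF linQ linear_id])
      show "x \<in> span B" using that B(4) by simp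
      fix c assume c: "c \<in> B"
      have "(c \<bullet> b) *\<^sub>R b = (if b = c then c else 0)" if "b \<in> B" for b
        using B(1) B(2)[OF c] c that by (auto simp: pairwise_def orthogonal_def dot_square_norm)
      then have "Q c = (\<Sum>b\<in>B. if b = c then c else 0)" unfolding Q_def by (intro sum.cong) auto
      then show "Q c = id c" using c fin by simp
    qed
    then show ?thesis by simp
  qed
  have "lin_trace P = lin_trace (\<lambda>x. Q (P x))" using Qid P(2) by simp
  also have "\<dots> = lin_trace (\<lambda>x. P (Q x))" by (rule lin_trace_commute[OF linQ P(1)])
  also have "\<dots> = lin_trace Q" using P(3) QV by simp
  also have "\<dots> = (\<Sum>b\<in>Basis. \<Sum>c\<in>B. (b \<bullet> c) * (c \<bullet> b))"
    by (simp add: lin_trace_def Q_def inner_sum_left)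
  also have "\<dots> = (\<Sum>c\<in>B. c \<bullet> c)"
    by (subst sum.swap, intro sum.cong refl, subst (3) euclidean_inner) (simp add: inner_commute)
  also have "\<dots> = real (card B)" using B(2) by (simp add: dot_square_norm)
  finally have "dim V = 0" using tr0 B(5) by simp
  then show False using V subspace_0[OF V(1)] by (auto simp: dim_eq_0)
qed

section \<open>The derived algebra of a solvable Lie algebra\<close>

definition lie_rep :: "('a::euclidean_space \<Rightarrow> 'a \<Rightarrow> 'a) \<Rightarrow> ('a \<Rightarrow> 'b::euclidean_space \<Rightarrow> 'b) \<Rightarrow> 'b set \<Rightarrow> bool" where
  "lie_rep br \<rho> V \<longleftrightarrow> subspace V \<and> bilinear \<rho> \<and> (\<forall>x. \<forall>v\<in>V. \<rho> x v \<in> V) \<and>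
     (\<forall>x y. \<forall>v\<in>V. \<rho> (br x y) v = \<rho> x (\<rho> y v) - \<rho> y (\<rho> x v))"

lemma lie_bracket_anti:
  assumes "lie_bracket br"
  shows "br x y = - br y x"
proof -
  have bil: "bilinear br" and alt: "\<And>x. br x x = 0" using assms by (auto simp: lie_bracket_def)
  have "br (x + y) (x + y) = br x x + br x y + (br y x + br y y)"
    by (simp add: bilinear_ladd[OF bil] bilinear_radd[OF bil])
  then have "br x y + br y x = 0" by (simp add: alt)
  then show ?thesis by (simp add: eq_neg_iff_add_eq_0)
qed

lemma lie_bracket_jacobi:
  assumes "lie_bracket br"
  shows "br x (br y z) = br (br x y) z + br y (br x z)"
proof -
  have bil: "bilinear br" and jac: "br x (br y z) + br y (br z x) + br z (br x y) = 0"
    using assms by (auto simp: lie_bracket_def)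
  have "br z (br x y) = - br (br x y) z" "br y (br z x) = - br y (br x z)"
    using lie_bracket_anti[OF assms, of z "br x y"] lie_bracket_anti[OF assms, of z x]
    by (simp_all add: bilinear_rneg[OF bil])
  then show ?thesis using jac by (simp add: algebra_simps)
qed

lemma span_bracket_induct:
  assumes "x \<in> bracket_span br A B" "subspace W" "\<And>a b. a \<in> A \<Longrightarrow> b \<in> B \<Longrightarrow> br a b \<in> W"
  shows "x \<in> W"
proof -
  have "bracket_span br A B \<subseteq> W" unfolding bracket_span_def by (intro span_minimal) (use assms in auto)
  then show ?thesis using assms(1) by blast
qed

lemma bracket_in_span: "a \<in> A \<Longrightarrow> b \<in> B \<Longrightarrow> br a b \<in> bracket_span br A B"
  unfolding bracket_span_def by (intro span_base) blast

lemma derived_series_ideal: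
  assumes "lie_bracket br"
  shows "lie_ideal br (derived_series br k)"
proof (induction k)
  case 0 show ?case by (simp add: lie_ideal_def)
next
  case (Suc k)
  let ?D = "derived_series br k" let ?E = "derived_series br (Suc k)"
  have bil: "bilinear br" using assms by (simp add: lie_bracket_def)
  have sub: "subspace ?E" by (simp add: bracket_span_def)
  have "br x y \<in> ?E" if "y \<in> ?E" for x y
  proof -
    have W: "subspace {y. br x y \<in> ?E}"
      using sub by (auto simp: subspace_def bilinear_rzero[OF bil] bilinear_radd[OF bil] bilinear_rmul[OF bil])
    have "y \<in> {y. br x y \<in> ?E}"
    proof (rule span_bracket_induct[OF _ W])
      show "y \<in> bracket_span br ?D ?D" using that by simp
      fix a b assume ab: "a \<in> ?D" "b \<in> ?D"
      then have "br x a \<in> ?D" "br x b \<in> ?D" using Suc by (auto simp: lie_ideal_def)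
      then have "br (br x a) b \<in> ?E" "br a (br x b) \<in> ?E" using ab by (auto intro: bracket_in_span)
      then show "br a b \<in> {y. br x y \<in> ?E}"
        using lie_bracket_jacobi[OF assms, of x a b] subspace_add[OF sub] by simp
    qed
    then show ?thesis by simp
  qed
  then show ?case using sub by (simp add: lie_ideal_def)
qed

lemma derived_series_mono:
  assumes "lie_bracket br"
  shows "derived_series br (Suc k) \<subseteq> derived_series br k"
proof -
  have "lie_ideal br (derived_series br k)" by (rule derived_series_ideal[OF assms])
  then show ?thesis by (auto simp: lie_ideal_def elim!: span_bracket_induct)
qed

text \<open>
  If the next derived algebra acts trivially on an irreducible module, the elements of the present one commute with each
  other. Each of them is nilpotent or injective; an injective one arises as a commutator and contradicts
  \<open>commutator_not_identity\<close>, and commuting nilpotent operators have a common kernel, which is a submodule.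
\<close>

lemma irreducible_rep_step:
  assumes lie: "lie_bracket br" and rep: "lie_rep br \<rho> V" and ne: "V \<noteq> {0}"
    and irr: "\<And>W. subspace W \<Longrightarrow> W \<subseteq> V \<Longrightarrow> W \<noteq> {0} \<Longrightarrow> (\<And>x v. v \<in> W \<Longrightarrow> \<rho> x v \<in> W) \<Longrightarrow> W = V"
    and triv: "\<And>x v. x \<in> derived_series br (Suc (Suc k)) \<Longrightarrow> v \<in> V \<Longrightarrow> \<rho> x v = 0"
    and x: "x \<in> derived_series br (Suc k)" and v: "v \<in> V"
  shows "\<rho> x v = 0"
proof -
  let ?I = "derived_series br (Suc k)"
  have V: "subspace V" and bil: "bilinear \<rho>" and inv: "\<And>x v. v \<in> V \<Longrightarrow> \<rho> x v \<in> V"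
    and hom: "\<And>x y v. v \<in> V \<Longrightarrow> \<rho> (br x y) v = \<rho> x (\<rho> y v) - \<rho> y (\<rho> x v)"
    using rep by (auto simp: lie_rep_def)
  have lin: "linear (\<rho> x)" for x using bil by (simp add: bilinear_def)
  have I: "br a c \<in> ?I" if "c \<in> ?I" for a c
    using derived_series_ideal[OF lie, of "Suc k"] that by (simp add: lie_ideal_def)
  have commI: "\<rho> a (\<rho> b v) = \<rho> b (\<rho> a v)" if "a \<in> ?I" "b \<in> ?I" "v \<in> V" for a b v
  proof -
    have "br a b \<in> derived_series br (Suc (Suc k))" using that by (auto intro: bracket_in_span)
    then show ?thesis using triv that(3) hom[OF that(3), of a b] by simp
  qed
  have powV: "(\<rho> x ^^ n) v \<in> V" if "v \<in> V" for x v n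
    using that by (induction n) (auto intro: inv)
  text \<open>The generalised kernel of an element of \<open>I\<close> is a submodule, so every element of \<open>I\<close>
    is nilpotent or injective.\<close>
  have gker: "\<exists>n. \<forall>v\<in>V. (\<rho> d ^^ n) v = 0" if d: "d \<in> ?I" and x: "x \<in> V" "x \<noteq> 0" "\<rho> d x = 0" for d x
  proof -
    define K where "K = {v \<in> V. \<exists>n. (\<rho> d ^^ n) v = 0}"
    have linp: "linear (\<rho> d ^^ n)" for n
    proof (induction n)
      case 0 show ?case by (simp add: id_def[symmetric] linear_id)
    next
      case (Suc n) then show ?case using linear_compose[OF Suc lin[of d]] by (simp add: o_def)
    qed
    have up: "(\<rho> d ^^ m) v = 0" if "(\<rho> d ^^ n) v = 0" "n \<le> m" for n m v
    proof -
      have "(\<rho> d ^^ m) v = (\<rho> d ^^ (m - n)) ((\<rho> d ^^ n) v)"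
        using that(2) by (metis comp_apply funpow_add le_add_diff_inverse2)
      then show ?thesis using that(1) linear_0[OF linp] by simp
    qed
    have "subspace K"
    proof (unfold subspace_def, intro conjI ballI allI)
      show "0 \<in> K" using subspace_0[OF V] by (auto simp: K_def intro: exI[of _ 0])
    next
      fix u w assume "u \<in> K" "w \<in> K"
      then obtain n m where nm: "u \<in> V" "w \<in> V" "(\<rho> d ^^ n) u = 0" "(\<rho> d ^^ m) w = 0" by (auto simp: K_def)
      then have "(\<rho> d ^^ (max n m)) (u + w) = 0"
        using up[OF nm(3), of "max n m"] up[OF nm(4), of "max n m"] by (simp add: linear_add[OF linp])
      then show "u + w \<in> K" using nm subspace_add[OF V] by (auto simp: K_def)
    next
      fix c u assume "u \<in> K"
      then show "c *\<^sub>R u \<in> K" using subspace_scale[OF V] by (auto simp: K_def linear_cmul[OF linp])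
    qed
    moreover have "\<rho> a u \<in> K" if u: "u \<in> K" for a u
    proof -
      obtain n where n: "u \<in> V" "(\<rho> d ^^ n) u = 0" using u by (auto simp: K_def)
      have dI: "br d a \<in> ?I" using I[OF d, of a] lie_bracket_anti[OF lie, of d a] 
          derived_series_ideal[OF lie, of "Suc k"] by (auto simp: lie_ideal_def intro: subspace_neg)
      have c: "(\<rho> d ^^ m) (\<rho> (br d a) w) = \<rho> (br d a) ((\<rho> d ^^ m) w)" if "w \<in> V" for m w
        using that by (induction m) (auto simp: commI[OF d dI] powV)
      have "\<exists>r. (\<rho> d ^^ m) (\<rho> a u) = \<rho> a ((\<rho> d ^^ m) u) + (real m) *\<^sub>R \<rho> (br d a) ((\<rho> d ^^ (m - 1)) u)" for m
      proof (induction m)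
        case 0 show ?case by simp
      next
        case (Suc m)
        have "(\<rho> d ^^ Suc m) (\<rho> a u) = \<rho> d (\<rho> a ((\<rho> d ^^ m) u)) + (real m) *\<^sub>R \<rho> d (\<rho> (br d a) ((\<rho> d ^^ (m - 1)) u))"
          using Suc by (simp add: linear_add[OF lin] linear_cmul[OF lin])
        moreover have "\<rho> d (\<rho> a ((\<rho> d ^^ m) u)) = \<rho> a ((\<rho> d ^^ Suc m) u) + \<rho> (br d a) ((\<rho> d ^^ m) u)"
          using hom[OF powV[OF n(1), where x = d and n = m], of d a] by simp
        moreover have "(real m) *\<^sub>R \<rho> d (\<rho> (br d a) ((\<rho> d ^^ (m - 1)) u)) = (real m) *\<^sub>R \<rho> (br d a) ((\<rho> d ^^ m) u)"
          using commI[OF d dI powV[OF n(1), where x = d and n = "m - 1"]] by (cases m) auto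
        ultimately show ?case by (simp add: algebra_simps)
      qed
      then have "(\<rho> d ^^ Suc n) (\<rho> a u) = 0"
        using up[OF n(2), of "Suc n"] n(2) linear_0[OF lin] by (metis add.right_neutral diff_Suc_1 le_SucI order_refl scaleR_zero_right)
      then show ?thesis using inv[OF n(1)] unfolding K_def by blast
    qed
    moreover have "x \<in> K" using x unfolding K_def by (auto intro: exI[of _ 1])
    ultimately have "K = V" using irr[of K] x(2) by (auto simp: K_def)
    obtain BV where BV: "finite BV" "span BV = V" "BV \<subseteq> V"
      using basis_exists[of V] V by (metis independent_imp_finite span_eq_iff span_minimal subset_antisym)
    have "\<forall>v\<in>BV. \<exists>n. (\<rho> d ^^ n) v = 0" using BV(3) \<open>K = V\<close> by (auto simp: K_def)
    then obtain n where n: "\<And>v. v \<in> BV \<Longrightarrow> (\<rho> d ^^ n v) v = 0" by metis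
    have "(\<rho> d ^^ (Max (insert 0 (n ` BV)))) v = 0" if "v \<in> BV" for v
      using up[OF n[OF that]] BV(1) that by simp
    then have "(\<rho> d ^^ (Max (insert 0 (n ` BV)))) v = 0" if "v \<in> V" for v
      using linear_eq_0_on_span[OF linp, of BV] that BV(2) by blast
    then show ?thesis by blast
  qed
  text \<open>An injective element would be a commutator \<open>[a, c]\<close> commuting with \<open>c\<close>; then
    \<open>[[a, c]\<^sup>-\<^sup>1 a, c]\<close> would be the identity.\<close>
  have inj_imp_False: False
    if d: "br a c \<in> ?I" and c: "\<And>v. v \<in> V \<Longrightarrow> \<rho> (br a c) (\<rho> c v) = \<rho> c (\<rho> (br a c) v)"
      and inj: "\<And>x. x \<in> V \<Longrightarrow> \<rho> (br a c) x = 0 \<Longrightarrow> x = 0" for a c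
  proof -
    let ?d = "\<rho> (br a c)"
    have injV: "inj_on ?d (span V)"
    proof (rule inj_onI)
      fix x y assume "x \<in> span V" "y \<in> span V" "?d x = ?d y"
      then have "x - y \<in> V" "?d (x - y) = 0"
        using V by (auto simp: span_eq_iff[THEN iffD2] linear_diff[OF lin] subspace_diff)
      then show "x = y" using inj by fastforce
    qed
    obtain g where g: "linear g" "\<And>x. x \<in> V \<Longrightarrow> g (?d x) = x"
      using linear_exists_left_inverse_on[OF lin V, of "br a c"] injV V by (auto simp: span_eq_iff[THEN iffD2])
    have "?d ` V = V"
    proof (rule subspace_dim_equal)
      show "subspace (?d ` V)" by (rule linear_subspace_image[OF lin V])
      show "?d ` V \<subseteq> V" using inv by auto
      show "dim V \<le> dim (?d ` V)" using dim_image_eq[OF lin injV] by simp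
    qed (rule V)
    then have gV: "g x \<in> V" "?d (g x) = x" if "x \<in> V" for x
      using that g(2) by (metis imageE)+
    show False
    proof (rule commutator_not_identity[OF V ne, of "\<lambda>x. g (\<rho> a x)" "\<rho> c"])
      show "linear (\<lambda>x. g (\<rho> a x))" using linear_compose[OF lin g(1)] by (simp add: o_def)
      fix x assume x: "x \<in> V"
      have gc: "g (\<rho> c y) = \<rho> c (g y)" if y: "y \<in> V" for y
      proof -
        have "\<rho> c y = ?d (\<rho> c (g y))" using c[OF gV(1)[OF y]] gV(2)[OF y] by simp
        then show ?thesis using g(2)[OF inv[OF gV(1)[OF y]]] by simp
      qed
      have "g (\<rho> a (\<rho> c x)) - \<rho> c (g (\<rho> a x)) = g (\<rho> a (\<rho> c x) - \<rho> c (\<rho> a x))"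
        using gc[OF inv[OF x]] by (simp add: linear_diff[OF g(1)])
      also have "\<dots> = x" using hom[OF x, of a c] g(2)[OF x] by simp
      finally show "g (\<rho> a (\<rho> c x)) - \<rho> c (g (\<rho> a x)) = x" .
    qed (use lin inv gV in auto)
  qed
  have nil: "\<exists>n. \<forall>v\<in>V. (\<rho> (br a c) ^^ n) v = 0" if c: "c \<in> ?I" for a c
    using inj_imp_False[OF I[OF c, of a], of ] commI[OF I[OF c, of a] c] gker[OF I[OF c, of a]] by blast
  text \<open>Commuting nilpotent operators have a common kernel vector.\<close>
  define K where "K = {v \<in> V. \<forall>a. \<forall>c\<in>?I. \<rho> (br a c) v = 0}"
  have "K = V"
  proof (rule irr)
    show "subspace K" using V unfolding K_def
      by (auto simp: subspace_def linear_0[OF lin] linear_add[OF lin] linear_cmul[OF lin])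
    show "K \<subseteq> V" by (auto simp: K_def)
    show "\<rho> x v \<in> K" if v: "v \<in> K" for x v
    proof -
      have "\<rho> (br a c) (\<rho> x v) = 0" if c: "c \<in> ?I" for a c
      proof -
        have "\<rho> (br x (br a c)) v = 0" using v I[OF c] by (auto simp: K_def)
        then show ?thesis using v c hom[of v x "br a c"] linear_0[OF lin] by (auto simp: K_def)
      qed
      then show ?thesis using v inv by (auto simp: K_def)
    qed
    show "K \<noteq> {0}"
    proof -
      define ok where "ok W \<longleftrightarrow> subspace W \<and> W \<subseteq> V \<and> W \<noteq> {0} \<and> (\<forall>a\<in>?I. \<forall>v\<in>W. \<rho> a v \<in> W)" for W
      have "ok V" using V inv ne by (auto simp: ok_def)
      then obtain M where M: "ok M" and least: "\<And>W. ok W \<Longrightarrow> dim M \<le> dim W"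
        using ex_has_least_nat[of ok V dim] by blast
      have M': "subspace M" "M \<subseteq> V" "M \<noteq> {0}" "\<And>a v. a \<in> ?I \<Longrightarrow> v \<in> M \<Longrightarrow> \<rho> a v \<in> M"
        using M by (auto simp: ok_def)
      have "\<rho> (br a c) v = 0" if c: "c \<in> ?I" and v: "v \<in> M" for a c v
      proof -
        let ?d = "\<rho> (br a c)"
        have d: "br a c \<in> ?I" by (rule I[OF c])
        obtain n where n: "\<And>v. v \<in> V \<Longrightarrow> (?d ^^ n) v = 0" using nil[OF c] by blast
        let ?N = "{v \<in> M. ?d v = 0}"
        have "\<exists>w\<in>M. w \<noteq> 0 \<and> ?d w = 0"
        proof (rule ccontr)
          assume no: "\<not> (\<exists>w\<in>M. w \<noteq> 0 \<and> ?d w = 0)"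
          obtain w where w: "w \<in> M" "w \<noteq> 0" using M'(1,3) subspace_0 by blast
          have "(?d ^^ m) w \<in> M \<and> (?d ^^ m) w \<noteq> 0" for m
            using w no M'(4)[OF d] by (induction m) auto
          then show False using n[of w] w M'(2) by blast
        qed
        then have "?N \<noteq> {0}" by blast
        moreover have "subspace ?N" using M'(1)
          by (auto simp: subspace_def linear_0[OF lin] linear_add[OF lin] linear_cmul[OF lin])
        moreover have "\<rho> b w \<in> ?N" if "b \<in> ?I" "w \<in> ?N" for b w
          using that M'(2,4) commI[OF d that(1), of w] linear_0[OF lin] by auto
        ultimately have "ok ?N" using M'(2) by (auto simp: ok_def)
        then have "?N = M" using least \<open>subspace ?N\<close> M'(1) by (intro subspace_dim_equal) auto
        then show ?thesis using v by auto
      qed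
      then have "M \<subseteq> K" using M'(2) by (auto simp: K_def)
      then show ?thesis using M'(3) subspace_0[OF M'(1)] by auto
    qed
  qed
  then have central: "\<rho> a (\<rho> c v) = \<rho> c (\<rho> a v)" if "c \<in> ?I" "v \<in> V" for a c v
  proof -
    have "v \<in> K" using that \<open>K = V\<close> by blast
    then have "\<rho> (br a c) v = 0" using that(1) unfolding K_def by blast
    then show ?thesis using hom[OF that(2), of a c] by simp
  qed
  have gen: "\<rho> (br a b) v = 0" if ab: "a \<in> derived_series br k" "b \<in> derived_series br k" and v: "v \<in> V" for a b v
  proof -
    have d: "br a b \<in> ?I" using ab by (auto intro: bracket_in_span)
    let ?N = "{v \<in> V. \<rho> (br a b) v = 0}"
    have "\<exists>x\<in>V. x \<noteq> 0 \<and> \<rho> (br a b) x = 0"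
      using inj_imp_False[OF d] central[OF d] by metis
    then have "?N = V"
    proof (intro irr)
      show "subspace ?N" using V
        by (auto simp: subspace_def linear_0[OF lin] linear_add[OF lin] linear_cmul[OF lin])
      show "\<rho> x w \<in> ?N" if "w \<in> ?N" for x w
        using that inv central[OF d, of w x] linear_0[OF lin] by auto
    qed auto
    then show ?thesis using v by blast
  qed
  have "x \<in> {x. \<forall>v\<in>V. \<rho> x v = 0}"
  proof (rule span_bracket_induct)
    show "x \<in> bracket_span br (derived_series br k) (derived_series br k)" using x by simp
    show "subspace {x. \<forall>v\<in>V. \<rho> x v = 0}"
      by (auto simp: subspace_def bilinear_lzero[OF bil] bilinear_ladd[OF bil] bilinear_lmul[OF bil])
  qed (use gen in blast)
  then show ?thesis using v by blast
qed

text \<open>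
  Descend along the derived series on an irreducible submodule, where the last term acts by zero.
\<close>

lemma solvable_rep_common_kernel:
  assumes lie: "lie_bracket br" and solv: "solvable_lie br" and rep: "lie_rep br \<rho> V" and ne: "V \<noteq> {0}"
  shows "\<exists>v\<in>V. v \<noteq> 0 \<and> (\<forall>x\<in>bracket_span br UNIV UNIV. \<rho> x v = 0)"
proof -
  define ok where "ok W \<longleftrightarrow> subspace W \<and> W \<subseteq> V \<and> W \<noteq> {0} \<and> (\<forall>a. \<forall>v\<in>W. \<rho> a v \<in> W)" for W
  have V: "subspace V" and bil: "bilinear \<rho>" and inv: "\<And>x v. v \<in> V \<Longrightarrow> \<rho> x v \<in> V"
    using rep by (auto simp: lie_rep_def)
  have "ok V" using V inv ne by (auto simp: ok_def)
  then obtain M where M: "ok M" and least: "\<And>W. ok W \<Longrightarrow> dim M \<le> dim W"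
    using ex_has_least_nat[of ok V dim] by blast
  have M': "subspace M" "M \<subseteq> V" "M \<noteq> {0}" "\<And>a v. v \<in> M \<Longrightarrow> \<rho> a v \<in> M"
    using M by (auto simp: ok_def)
  have repM: "lie_rep br \<rho> M" using rep M' by (auto simp: lie_rep_def)
  have irr: "W = M" if W: "subspace W" "W \<subseteq> M" "W \<noteq> {0}" "\<And>x v. v \<in> W \<Longrightarrow> \<rho> x v \<in> W" for W
  proof (rule subspace_dim_equal[OF W(1) M'(1) W(2)])
    have "ok W" using W M' by (auto simp: ok_def)
    then show "dim M \<le> dim W" by (rule least)
  qed
  obtain m where m: "derived_series br m = {0}" using solv by (auto simp: solvable_lie_def)
  have step: "(\<forall>x\<in>derived_series br (Suc k). \<forall>v\<in>M. \<rho> x v = 0)"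
    if "\<forall>x\<in>derived_series br (Suc (Suc k)). \<forall>v\<in>M. \<rho> x v = 0" for k
    using irreducible_rep_step[OF lie repM M'(3) irr] that by blast
  have "derived_series br (Suc m) \<subseteq> {0}" using derived_series_mono[OF lie, of m] m by simp
  then have top: "\<forall>x\<in>derived_series br (Suc m). \<forall>v\<in>M. \<rho> x v = 0"
    by (auto simp: bilinear_lzero[OF bil])
  have "\<forall>x\<in>derived_series br (Suc (m - j)). \<forall>v\<in>M. \<rho> x v = 0" for j
  proof (induction j)
    case 0 show ?case using top by simp
  next
    case (Suc j)
    show ?case
    proof (cases "j < m")
      case True
      then have "m - j = Suc (m - Suc j)" by simp
      then show ?thesis using Suc step[of "m - Suc j"] by simp
    qed (use Suc in simp)
  qed
  from this[of m] have "\<forall>x\<in>bracket_span br UNIV UNIV. \<forall>v\<in>M. \<rho> x v = 0" by simp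
  moreover obtain v where "v \<in> M" "v \<noteq> 0" using M'(1,3) subspace_0 by blast
  ultimately show ?thesis using M'(2) by blast
qed

text \<open>
  Lie's theorem over the reals in the form needed here: by \<open>solvable_rep_common_kernel\<close>, applied to
  successive quotients of the adjoint module, there is a flag of ideals along which the derived algebra strictly descends.
\<close>

lemma derived_algebra_nilpotent:
  assumes lie: "lie_bracket br" and solv: "solvable_lie br"
  shows "nilpotent_ideal br (bracket_span br UNIV UNIV)"
proof -
  let ?D = "bracket_span br UNIV UNIV"
  have bil: "bilinear br" using lie by (simp add: lie_bracket_def)
  have ideal: "lie_ideal br ?D" using derived_series_ideal[OF lie, of 1] by simp
  have D: "subspace ?D" using ideal by (simp add: lie_ideal_def)
  define U where "U = rec_nat {0} (\<lambda>_ W. {v. \<forall>d\<in>?D. br d v \<in> W})"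
  have U0: "U 0 = {0}" and US: "U (Suc k) = {v. \<forall>d\<in>?D. br d v \<in> U k}" for k
    by (simp_all add: U_def)
  have Uid: "lie_ideal br (U k)" for k
  proof (induction k)
    case 0 show ?case by (simp add: U0 lie_ideal_def bilinear_rzero[OF bil])
  next
    case (Suc k)
    then have sub: "subspace (U k)" and inv: "\<And>x y. y \<in> U k \<Longrightarrow> br x y \<in> U k" by (auto simp: lie_ideal_def)
    have "subspace (U (Suc k))"
      using sub unfolding US
      by (auto simp: subspace_def bilinear_rzero[OF bil] bilinear_radd[OF bil] bilinear_rmul[OF bil])
    moreover have "br x y \<in> U (Suc k)" if "y \<in> U (Suc k)" for x y
    proof -
      have "br d (br x y) \<in> U k" if d: "d \<in> ?D" for d
      proof -
        have "br d x \<in> ?D" by (rule bracket_in_span) auto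
        then have "br (br d x) y \<in> U k" "br x (br d y) \<in> U k" using \<open>y \<in> U (Suc k)\<close> d inv by (auto simp: US)
        then show ?thesis unfolding lie_bracket_jacobi[OF lie, of d x y] by (rule subspace_add[OF sub])
      qed
      then show ?thesis by (simp add: US)
    qed
    ultimately show ?case by (simp add: lie_ideal_def)
  qed
  have mono: "U k \<subseteq> U (Suc k)" for k using Uid[of k] by (auto simp: US lie_ideal_def)
  have strict: "dim (U k) < dim (U (Suc k))" if proper: "U k \<noteq> UNIV" for k
  proof -
    have sub: "subspace (U k)" and inv: "\<And>x y. y \<in> U k \<Longrightarrow> br x y \<in> U k"
      using Uid[of k] by (auto simp: lie_ideal_def)
    obtain P where P: "linear P" "\<And>x. P x \<in> U k" "\<And>x. x \<in> U k \<Longrightarrow> P x = x"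
      using linear_projection_exists[OF sub] by blast
    define pr where "pr x = x - P x" for x
    define V where "V = {x. P x = 0}"
    have linpr: "linear pr"
      by (intro linearI) (simp_all add: pr_def linear_add[OF P(1)] linear_cmul[OF P(1)] algebra_simps)
    have prU: "pr x = 0" if "x \<in> U k" for x using P(3)[OF that] by (simp add: pr_def)
    have prbr: "pr (br x (pr y)) = pr (br x y)" for x y
      using prU[OF inv[OF P(2)[of y]], of x]
      by (simp add: pr_def[of y] bilinear_rsub[OF bil] linear_diff[OF linpr])
    have "lie_rep br (\<lambda>x v. pr (br x v)) V"
      unfolding lie_rep_def
    proof (intro conjI allI ballI)
      show "subspace V" by (auto simp: V_def subspace_def linear_0[OF P(1)] linear_add[OF P(1)] linear_cmul[OF P(1)])
      show "bilinear (\<lambda>x v. pr (br x v))"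
        unfolding bilinear_def by (intro conjI allI linearI)
          (simp_all add: linear_add[OF linpr] linear_cmul[OF linpr] bilinear_ladd[OF bil] bilinear_radd[OF bil]
            bilinear_lmul[OF bil] bilinear_rmul[OF bil])
      fix x v show "pr (br x v) \<in> V" using P by (simp add: V_def pr_def linear_diff[OF P(1)])
      fix y show "pr (br (br x y) v) = pr (br x (pr (br y v))) - pr (br y (pr (br x v)))"
        unfolding prbr lie_bracket_jacobi[OF lie, of x y v] by (simp add: linear_add[OF linpr])
    qed
    moreover have "V \<noteq> {0}"
    proof
      assume "V = {0}"
      have "x \<in> U k" for x
      proof -
        have "pr x \<in> V" using P by (simp add: V_def pr_def linear_diff[OF P(1)])
        then have "pr x = 0" using \<open>V = {0}\<close> by blast
        then have "x = P x" by (simp add: pr_def)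
        then show ?thesis using P(2)[of x] by simp
      qed
      then show False using proper by blast
    qed
    ultimately obtain v where v: "v \<in> V" "v \<noteq> 0" "\<forall>x\<in>?D. pr (br x v) = 0"
      using solvable_rep_common_kernel[OF lie solv] by blast
    have "br d v \<in> U k" if "d \<in> ?D" for d
    proof -
      have "br d v = P (br d v)" using v(3) that by (simp add: pr_def)
      then show ?thesis using P(2)[of "br d v"] by simp
    qed
    then have "v \<in> U (Suc k)" by (simp add: US)
    moreover have "v \<notin> U k" using v P(3) by (auto simp: V_def)
    ultimately have "U k \<noteq> U (Suc k)" by blast
    then have "\<not> dim (U (Suc k)) \<le> dim (U k)"
      using subspace_dim_equal[OF sub _ mono] Uid[of "Suc k"] by (auto simp: lie_ideal_def)
    then show ?thesis by simp
  qed
  have "\<exists>m. U m = UNIV"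
  proof (rule ccontr)
    assume "\<nexists>m. U m = UNIV"
    then have "dim (U k) < dim (U (Suc k))" for k using strict by blast
    then have "k \<le> dim (U k)" for k by (induction k) (auto simp: Suc_le_eq intro: le_less_trans)
    from this[of "Suc (DIM('a))"] show False using dim_subset_UNIV[of "U (Suc (DIM('a)))"] by simp
  qed
  then obtain m where m: "U m = UNIV" by blast
  have "j \<le> m \<Longrightarrow> lower_central_series br ?D j \<subseteq> U (m - j)" for j
  proof (induction j)
    case 0 show ?case using m by simp
  next
    case (Suc j)
    then have "m - j = Suc (m - Suc j)" by simp
    then have IH: "lower_central_series br ?D j \<subseteq> U (Suc (m - Suc j))" using Suc by simp
    show ?case
    proof
      fix x assume "x \<in> lower_central_series br ?D (Suc j)"
      then have "x \<in> bracket_span br ?D (lower_central_series br ?D j)" by simp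
      then show "x \<in> U (m - Suc j)"
      proof (rule span_bracket_induct)
        show "subspace (U (m - Suc j))" using Uid by (simp add: lie_ideal_def)
        fix a b assume "a \<in> ?D" "b \<in> lower_central_series br ?D j"
        then show "br a b \<in> U (m - Suc j)" using IH by (auto simp: US)
      qed
    qed
  qed
  from this[of m] have "lower_central_series br ?D m \<subseteq> {0}" by (simp add: U0)
  moreover have "0 \<in> lower_central_series br ?D m"
    by (cases m) (auto simp: bracket_span_def span_zero subspace_0[OF D, unfolded bracket_span_def])
  ultimately have "lower_central_series br ?D m = {0}" by blast
  then show ?thesis using ideal unfolding nilpotent_ideal_def by blast
qed

section \<open>Eigenvalues\<close>

lemma index_mult_mat_sum:
  assumes "A \<in> carrier_mat n n" "C \<in> carrier_mat n n" "i < n" "j < n"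
  shows "(A * C) $$ (i, j) = (\<Sum>k<n. A $$ (i, k) * C $$ (k, j))"
  using assms by (simp add: scalar_prod_def atLeast0LessThan)

text \<open>
  The trace as the sum of the eigenvalues, read off from an upper triangular conjugate.
\<close>

lemma sum_proots_char_poly:
  fixes M :: "complex mat"
  assumes M: "M \<in> carrier_mat m m"
  shows "(\<Sum>z\<in>#proots (char_poly M). z) = (\<Sum>i<m. M $$ (i, i))"
proof -
  obtain as where as: "char_poly M = (\<Prod>a\<leftarrow>as. [:- a, 1:])" "length as = m"
    using char_poly_factorized[OF M] by blast
  have roots: "mset as = proots (char_poly M)"
  proof -
    have "proots (\<Prod>a\<leftarrow>as. [:- a, 1:]) = mset as"
    proof (induction as)
      case (Cons a as)
      have "(\<Prod>a\<leftarrow>as. [:- a, 1:]) \<noteq> (0 :: complex poly)" by (auto simp: prod_list_zero_iff)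
      then have "proots ([:- a, 1:] * (\<Prod>a\<leftarrow>as. [:- a, 1:])) = proots [:- a, 1:] + proots (\<Prod>a\<leftarrow>as. [:- a, 1:])"
        by (intro proots_mult) simp_all
      then show ?case
        by (simp only: list.map prod_list.Cons mset.simps Cons.IH proots_linear_factor minus_minus) simp
    qed simp
    then show ?thesis unfolding as(1) by (rule sym)
  qed
  obtain B P Q where BPQ: "schur_decomposition M as = (B, P, Q)" by (cases "schur_decomposition M as") auto
  have sim: "similar_mat_wit M B P Q" and diag: "diag_mat B = as"
    using schur_decomposition[OF M as(1) BPQ] by auto
  note wit = similar_mat_witD2[OF M sim]
  have QP: "Q * P = 1\<^sub>m m" and MPBQ: "M = P * B * Q" and B: "B \<in> carrier_mat m m"
    and P: "P \<in> carrier_mat m m" and Q: "Q \<in> carrier_mat m m" by (fact wit)+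
  have BQ: "B * Q \<in> carrier_mat m m" by (rule mult_carrier_mat[OF B Q])
  have "M = P * (B * Q)" by (rule trans[OF MPBQ assoc_mult_mat[OF P B Q]])
  then have "(\<Sum>i<m. M $$ (i, i)) = (\<Sum>i<m. (P * (B * Q)) $$ (i, i))" by (rule arg_cong)
  also have "\<dots> = (\<Sum>i<m. \<Sum>k<m. P $$ (i, k) * (B * Q) $$ (k, i))"
    by (intro sum.cong refl index_mult_mat_sum[OF P BQ]) auto
  also have "\<dots> = (\<Sum>k<m. \<Sum>i<m. (B * Q) $$ (k, i) * P $$ (i, k))"
    by (subst sum.swap) (simp only: mult.commute)
  also have "\<dots> = (\<Sum>k<m. ((B * Q) * P) $$ (k, k))"
    by (intro sum.cong refl index_mult_mat_sum[OF BQ P, symmetric]) auto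
  also have "\<dots> = (\<Sum>k<m. B $$ (k, k))"
    unfolding assoc_mult_mat[OF B Q P] QP right_mult_one_mat[OF B] ..
  also have "\<dots> = sum_list (diag_mat B)"
    using B by (simp add: diag_mat_def interv_sum_list_conv_sum_set_nat atLeast0LessThan)
  also have "\<dots> = (\<Sum>z\<in>#mset as. z)" unfolding diag by (simp only: sum_mset_sum_list image_mset.identity id_apply map_ident multiset.map_ident)
  also have "\<dots> = (\<Sum>z\<in>#proots (char_poly M). z)" unfolding roots ..
  finally show ?thesis by (rule sym)
qed

text \<open>
  An ordered basis indexed by \<open>{..<n}\<close>, the form in which matrices see a basis.
\<close>

locale vector_frame =
  fixes x :: "nat \<Rightarrow> 'a::euclidean_space" and n :: nat and V :: "'a set"
  assumes indep: "(\<Sum>i<n. c i *\<^sub>R x i) = 0 \<Longrightarrow> j < n \<Longrightarrow> c j = 0"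
    and spans: "v \<in> V \<Longrightarrow> \<exists>c. v = (\<Sum>i<n. c i *\<^sub>R x i)"
    and mem: "i < n \<Longrightarrow> x i \<in> V"
begin

lemma coeff_unique:
  assumes "(\<Sum>i<n. c i *\<^sub>R x i) = (\<Sum>i<n. d i *\<^sub>R x i)" "j < n"
  shows "c j = d j"
proof -
  have "(\<Sum>i<n. (c i - d i) *\<^sub>R x i) = 0" using assms(1) by (simp add: scaleR_diff_left sum_subtractf)
  then show ?thesis using indep[of "\<lambda>i. c i - d i" j] assms(2) by simp
qed

end

lemma vector_frame_of_bij:
  assumes e: "bij_betw e {..<n} B" and B: "independent B" "span B = V"
  shows "vector_frame e n V"
proof
  have inj: "inj_on e {..<n}" and im: "e ` {..<n} = B" using e by (auto simp: bij_betw_def)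
  have reindex: "(\<Sum>i<n. c i *\<^sub>R e i) = (\<Sum>b\<in>B. c (the_inv_into {..<n} e b) *\<^sub>R b)" for c
    unfolding im[symmetric] sum.reindex[OF inj] by (simp add: the_inv_into_f_f[OF inj])
  have fin: "finite B" using im by auto
  show "c j = 0" if "(\<Sum>i<n. c i *\<^sub>R e i) = 0" "j < n" for c j
  proof -
    have "(\<Sum>b\<in>B. c (the_inv_into {..<n} e b) *\<^sub>R b) = 0" using that(1) reindex by simp
    then have "c (the_inv_into {..<n} e (e j)) = 0"
      using B(1) im that(2) fin
        real_vector.independentD[OF B(1) fin subset_refl, of "\<lambda>b. c (the_inv_into {..<n} e b)" "e j"] by auto
    then show ?thesis using that(2) by (simp add: the_inv_into_f_f[OF inj])
  qed
  show "\<exists>c. v = (\<Sum>i<n. c i *\<^sub>R e i)" if "v \<in> V" for v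
  proof -
    have "v \<in> span B" using that B(2) by simp
    then obtain u where "v = (\<Sum>b\<in>B. u b *\<^sub>R b)" using span_finite[OF fin] by auto
    then have "v = (\<Sum>i<n. u (e i) *\<^sub>R e i)" unfolding im[symmetric] sum.reindex[OF inj] by simp
    then show ?thesis by (intro exI[of _ "\<lambda>i. u (e i)"])
  qed
  show "e i \<in> V" if "i < n" for i
    unfolding B(2)[symmetric] im[symmetric] by (rule span_base) (use that in auto)
qed

definition represents :: "('a::euclidean_space \<Rightarrow> 'a) \<Rightarrow> (nat \<Rightarrow> 'a) \<Rightarrow> nat \<Rightarrow> real mat \<Rightarrow> bool" where
  "represents T x n A \<longleftrightarrow> A \<in> carrier_mat n n \<and> (\<forall>j<n. T (x j) = (\<Sum>i<n. A $$ (i, j) *\<^sub>R x i))"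

lemma sum_scaleR_mult_mat:
  assumes "A \<in> carrier_mat n n" "C \<in> carrier_mat n n" "j < n"
  shows "(\<Sum>i<n. C $$ (i, j) *\<^sub>R (\<Sum>k<n. A $$ (k, i) *\<^sub>R x k)) = (\<Sum>k<n. (A * C) $$ (k, j) *\<^sub>R (x k :: 'a::real_vector))"
proof -
  have "(\<Sum>i<n. C $$ (i, j) *\<^sub>R (\<Sum>k<n. A $$ (k, i) *\<^sub>R x k)) = (\<Sum>i<n. \<Sum>k<n. (A $$ (k, i) * C $$ (i, j)) *\<^sub>R x k)"
    by (simp only: scaleR_sum_right scaleR_scaleR mult.commute)
  also have "\<dots> = (\<Sum>k<n. \<Sum>i<n. (A $$ (k, i) * C $$ (i, j)) *\<^sub>R x k)" by (rule sum.swap)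
  also have "\<dots> = (\<Sum>k<n. (A * C) $$ (k, j) *\<^sub>R x k)"
    by (intro sum.cong refl, subst index_mult_mat_sum[OF assms(1,2) _ assms(3)])
      (simp_all only: lessThan_iff scaleR_sum_left)
  finally show ?thesis .
qed

lemma represents_similar:
  assumes lin: "linear T" and x: "vector_frame x n V" and y: "vector_frame y n V"
    and A: "represents T x n A" and B: "represents T y n B"
  shows "similar_mat A B"
proof -
  interpret x: vector_frame x n V by fact
  interpret y: vector_frame y n V by fact
  have "\<forall>j. \<exists>c. j < n \<longrightarrow> y j = (\<Sum>i<n. c i *\<^sub>R x i)" using x.spans y.mem by blast
  then obtain s where s: "\<And>j. j < n \<Longrightarrow> y j = (\<Sum>i<n. s j i *\<^sub>R x i)" by metis
  have "\<forall>j. \<exists>c. j < n \<longrightarrow> x j = (\<Sum>i<n. c i *\<^sub>R y i)" using y.spans x.mem by blast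
  then obtain r where r: "\<And>j. j < n \<Longrightarrow> x j = (\<Sum>i<n. r j i *\<^sub>R y i)" by metis
  define S where "S = mat n n (\<lambda>(i, j). s j i)"
  define R where "R = mat n n (\<lambda>(i, j). r j i)"
  have SR: "S \<in> carrier_mat n n" "R \<in> carrier_mat n n" by (simp_all add: S_def R_def)
  have AB: "A \<in> carrier_mat n n" "B \<in> carrier_mat n n" using A B by (auto simp: represents_def)
  have yS: "y j = (\<Sum>i<n. S $$ (i, j) *\<^sub>R x i)" and xR: "x j = (\<Sum>i<n. R $$ (i, j) *\<^sub>R y i)" if "j < n" for j
    using s[OF that] r[OF that] that by (simp_all add: S_def R_def)
  have unit: "z j = (\<Sum>k<n. (1\<^sub>m n) $$ (k, j) *\<^sub>R z k)" if "j < n" for j and z :: "nat \<Rightarrow> 'a"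
  proof -
    have "(\<Sum>k<n. (1\<^sub>m n) $$ (k, j) *\<^sub>R z k) = (\<Sum>k<n. if k = j then z k else 0)"
      using that by (intro sum.cong) auto
    then show ?thesis using that by simp
  qed
  have "S * R = 1\<^sub>m n"
  proof (rule eq_matI)
    fix i j assume ij: "i < dim_row (1\<^sub>m n)" "j < dim_col (1\<^sub>m n)"
    then have ij: "i < n" "j < n" by simp_all
    have "x j = (\<Sum>i<n. R $$ (i, j) *\<^sub>R (\<Sum>k<n. S $$ (k, i) *\<^sub>R x k))"
      by (rule trans[OF xR[OF ij(2)]]) (intro sum.cong refl, simp add: yS)
    also have "\<dots> = (\<Sum>k<n. (S * R) $$ (k, j) *\<^sub>R x k)" by (rule sum_scaleR_mult_mat[OF SR ij(2)])
    finally have "(\<Sum>k<n. (S * R) $$ (k, j) *\<^sub>R x k) = (\<Sum>k<n. (1\<^sub>m n) $$ (k, j) *\<^sub>R x k)"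
      using unit[OF ij(2), of x] by simp
    then show "(S * R) $$ (i, j) = (1\<^sub>m n) $$ (i, j)" by (rule x.coeff_unique[OF _ ij(1)])
  qed (use SR in auto)
  moreover have "R * S = 1\<^sub>m n"
  proof (rule eq_matI)
    fix i j assume ij: "i < dim_row (1\<^sub>m n)" "j < dim_col (1\<^sub>m n)"
    then have ij: "i < n" "j < n" by simp_all
    have "y j = (\<Sum>i<n. S $$ (i, j) *\<^sub>R (\<Sum>k<n. R $$ (k, i) *\<^sub>R y k))"
      by (rule trans[OF yS[OF ij(2)]]) (intro sum.cong refl, simp add: xR)
    also have "\<dots> = (\<Sum>k<n. (R * S) $$ (k, j) *\<^sub>R y k)" by (rule sum_scaleR_mult_mat[OF SR(2,1) ij(2)])
    finally have "(\<Sum>k<n. (R * S) $$ (k, j) *\<^sub>R y k) = (\<Sum>k<n. (1\<^sub>m n) $$ (k, j) *\<^sub>R y k)"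
      using unit[OF ij(2), of y] by simp
    then show "(R * S) $$ (i, j) = (1\<^sub>m n) $$ (i, j)" by (rule y.coeff_unique[OF _ ij(1)])
  qed (use SR in auto)
  moreover have "A * S = S * B"
  proof (rule eq_matI)
    fix i j assume ij: "i < dim_row (S * B)" "j < dim_col (S * B)"
    then have ij: "i < n" "j < n" using SR AB by auto
    have "T (y j) = (\<Sum>i<n. S $$ (i, j) *\<^sub>R T (x i))"
      by (simp add: yS[OF ij(2)] linear_sum[OF lin] linear_cmul[OF lin])
    also have "\<dots> = (\<Sum>i<n. S $$ (i, j) *\<^sub>R (\<Sum>k<n. A $$ (k, i) *\<^sub>R x k))"
      using A by (intro sum.cong refl) (simp add: represents_def)
    also have "\<dots> = (\<Sum>k<n. (A * S) $$ (k, j) *\<^sub>R x k)" by (rule sum_scaleR_mult_mat[OF AB(1) SR(1) ij(2)])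
    finally have 1: "T (y j) = (\<Sum>k<n. (A * S) $$ (k, j) *\<^sub>R x k)" .
    have "T (y j) = (\<Sum>i<n. B $$ (i, j) *\<^sub>R y i)" using B ij by (simp add: represents_def)
    also have "\<dots> = (\<Sum>i<n. B $$ (i, j) *\<^sub>R (\<Sum>k<n. S $$ (k, i) *\<^sub>R x k))"
      by (intro sum.cong refl) (simp add: yS)
    also have "\<dots> = (\<Sum>k<n. (S * B) $$ (k, j) *\<^sub>R x k)" by (rule sum_scaleR_mult_mat[OF SR(1) AB(2) ij(2)])
    finally show "(A * S) $$ (i, j) = (S * B) $$ (i, j)"
      using 1 x.coeff_unique[OF _ ij(1), of "\<lambda>k. (A * S) $$ (k, j)" "\<lambda>k. (S * B) $$ (k, j)"] by simp
  qed (use SR AB in auto)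
  moreover have "A = A * (S * R)" using \<open>S * R = 1\<^sub>m n\<close> AB by simp
  ultimately have "A = S * B * R" using assoc_mult_mat[OF AB(1) SR] by simp
  with \<open>S * R = 1\<^sub>m n\<close> \<open>R * S = 1\<^sub>m n\<close> have "similar_mat_wit A B S R"
    by (intro similar_mat_witI[OF _ _ _ AB SR])
  then show ?thesis unfolding similar_mat_def by blast
qed

lemma represents_eigenvalue_real_part:
  assumes lin: "linear T" and e: "vector_frame e m P" and M: "represents T e m M"
    and L: "\<And>v. v \<in> P \<Longrightarrow> quad_prod L T v = 0" and P: "subspace P"
    and z: "z \<in># complex_eigenvalues M"
  shows "Re z \<in> fst ` set L"
proof -
  interpret e: vector_frame e m P by fact
  have Mc: "M \<in> carrier_mat m m" using M by (simp add: represents_def)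
  let ?C = "map_mat complex_of_real M"
  have C: "?C \<in> carrier_mat m m" using Mc by simp
  have "char_poly ?C \<noteq> 0" using degree_monic_char_poly[OF C] by auto
  then have "poly (char_poly ?C) z = 0" using z by (simp add: complex_eigenvalues_def)
  then have "eigenvalue ?C z" using eigenvalue_root_char_poly[OF C] by blast
  then obtain v where v: "v \<in> carrier_vec m" "v \<noteq> 0\<^sub>v m" "?C *\<^sub>v v = z \<cdot>\<^sub>v v"
    unfolding eigenvalue_def eigenvector_def using C by auto
  have row: "(\<Sum>j<m. complex_of_real (M $$ (i, j)) * v $ j) = z * v $ i" if "i < m" for i
  proof -
    have "(?C *\<^sub>v v) $ i = (\<Sum>j<m. complex_of_real (M $$ (i, j)) * v $ j)"
      using that v(1) Mc by (simp add: scalar_prod_def atLeast0LessThan)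
    then show ?thesis using v that by simp
  qed
  define a b where "a = Re z" and "b = Im z"
  define u where "u = (\<Sum>j<m. Re (v $ j) *\<^sub>R e j)"
  define w where "w = (\<Sum>j<m. Im (v $ j) *\<^sub>R e j)"
  have Tsum: "T (\<Sum>j<m. c j *\<^sub>R e j) = (\<Sum>i<m. (\<Sum>j<m. M $$ (i, j) * c j) *\<^sub>R e i)" for c
  proof -
    have "T (\<Sum>j<m. c j *\<^sub>R e j) = (\<Sum>j<m. c j *\<^sub>R (\<Sum>i<m. M $$ (i, j) *\<^sub>R e i))"
      using M by (simp add: linear_sum[OF lin] linear_cmul[OF lin] represents_def)
    also have "\<dots> = (\<Sum>i<m. (\<Sum>j<m. M $$ (i, j) * c j) *\<^sub>R e i)"
      unfolding scaleR_sum_right scaleR_sum_left by (subst sum.swap) (simp add: mult.commute)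
    finally show ?thesis .
  qed
  have Tu: "T u = a *\<^sub>R u - b *\<^sub>R w"
  proof -
    have "(\<Sum>j<m. M $$ (i, j) * Re (v $ j)) = a * Re (v $ i) - b * Im (v $ i)" if "i < m" for i
      using arg_cong[OF row[OF that], of Re] by (simp add: a_def b_def)
    then have "T u = (\<Sum>i<m. (a * Re (v $ i) - b * Im (v $ i)) *\<^sub>R e i)"
      unfolding u_def Tsum by (intro sum.cong) auto
    then show ?thesis by (simp add: u_def w_def scaleR_diff_left sum_subtractf scaleR_sum_right)
  qed
  have Tw: "T w = a *\<^sub>R w + b *\<^sub>R u"
  proof -
    have "(\<Sum>j<m. M $$ (i, j) * Im (v $ j)) = a * Im (v $ i) + b * Re (v $ i)" if "i < m" for i
      using arg_cong[OF row[OF that], of Im] by (simp add: a_def b_def)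
    then have "T w = (\<Sum>i<m. (a * Im (v $ i) + b * Re (v $ i)) *\<^sub>R e i)"
      unfolding w_def Tsum by (intro sum.cong) auto
    then show ?thesis by (simp add: u_def w_def scaleR_add_left sum.distrib scaleR_sum_right)
  qed
  have qu: "quad_op a b T u = 0" and qw: "quad_op a b T w = 0"
    unfolding quad_op_def Tu Tw
    by (simp_all add: linear_add[OF lin] linear_diff[OF lin] linear_cmul[OF lin] Tu Tw
        scaleR_double power2_eq_square algebra_simps)
  have uw: "u \<in> P" "w \<in> P" unfolding u_def w_def
    by (auto intro!: subspace_sum[OF P] subspace_scale[OF P] e.mem)
  have "u \<noteq> 0 \<or> w \<noteq> 0"
  proof (rule ccontr)
    assume "\<not> (u \<noteq> 0 \<or> w \<noteq> 0)"
    then have "Re (v $ j) = 0 \<and> Im (v $ j) = 0" if "j < m" for j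
      using e.indep[of "\<lambda>j. Re (v $ j)" j] e.indep[of "\<lambda>j. Im (v $ j)" j] that by (simp add: u_def w_def)
    then have "v = 0\<^sub>v m" using v(1) by (intro eq_vecI) (auto simp: complex_eq_iff)
    then show False using v(2) by blast
  qed
  then show ?thesis
    using quad_prod_kernel_quad_op[OF lin] qu qw L uw unfolding a_def by blast
qed

lemma complex_eigenvalues_similar:
  assumes "A \<in> carrier_mat n n" "B \<in> carrier_mat n n" "similar_mat A B"
  shows "complex_eigenvalues A = complex_eigenvalues B"
  using char_poly_similar[OF assms(3)] of_real_hom.char_poly_hom[OF assms(1), where ?'a = complex]
    of_real_hom.char_poly_hom[OF assms(2), where ?'a = complex]
  by (simp add: complex_eigenvalues_def)

lemma complex_eigenvalues_block:
  assumes "M \<in> carrier_mat m m" "N \<in> carrier_mat k k"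
  shows "complex_eigenvalues (four_block_mat M (0\<^sub>m m k) (0\<^sub>m k m) N) = complex_eigenvalues M + complex_eigenvalues N"
proof -
  let ?M = "map_mat complex_of_real M" and ?N = "map_mat complex_of_real N"
  have c: "?M \<in> carrier_mat m m" "?N \<in> carrier_mat k k" using assms by auto
  have eq: "map_mat complex_of_real (four_block_mat M (0\<^sub>m m k) (0\<^sub>m k m) N)
      = four_block_mat ?M (0\<^sub>m m k) (0\<^sub>m k m) ?N"
    using assms by (intro eq_matI) auto
  have "char_poly (four_block_mat ?M (0\<^sub>m m k) (0\<^sub>m k m) ?N) = char_poly ?M * char_poly ?N"
    by (rule char_poly_0_block[OF refl _ _ c(1) _ c(2)]) (use char_poly_factorized[OF c(1)] char_poly_factorized[OF c(2)] in auto)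
  moreover have "char_poly ?M \<noteq> 0" "char_poly ?N \<noteq> 0"
    using degree_monic_char_poly[OF c(1)] degree_monic_char_poly[OF c(2)] by auto
  ultimately show ?thesis by (simp add: complex_eigenvalues_def eq proots_mult)
qed

text \<open>
  In a basis adapted to the splitting of \<open>V\<close> into the part with nonpositive real parts and the part with positive
  ones the matrix is block diagonal. Only the first block has eigenvalues with real part at most zero, and its trace is
  real, so the real parts sum to it; purely imaginary eigenvalues add nothing.
\<close>

lemma negative_real_parts_sum:
  assumes lin: "linear T" and V: "subspace V" "\<And>v. v \<in> V \<Longrightarrow> T v \<in> V"
    and x: "vector_frame x n V" "represents T x n A"
    and B: "finite B" "independent B" "span B = re_space {..0} T V"
    and c: "\<And>b. b \<in> B \<Longrightarrow> T b = (\<Sum>b'\<in>B. c b b' *\<^sub>R b')"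
  shows "(\<Sum>d\<in>#filter_mset (\<lambda>d. Re d < 0) (complex_eigenvalues A). Re d) = (\<Sum>b\<in>B. c b b)"
proof -
  let ?P = "re_space {..0} T V" and ?R = "re_space (- {..0}) T V"
  have sP: "subspace ?P" and sR: "subspace ?R" by (auto intro: subspace_re_space lin V)
  have TR: "T v \<in> ?R" if "v \<in> ?R" for v
    by (rule re_space_invariant[OF lin V(1) _ _ _ that]) (use V in auto)
  obtain LP where LP0: "fst ` set LP \<subseteq> {..0} \<and> (\<forall>v\<in>?P. quad_prod LP T v = 0)"
    using re_space_annihilator[OF lin V, where S = "{..0}"] by (rule exE)
  have LP1: "fst ` set LP \<subseteq> {..0}" by (rule LP0[THEN conjunct1])
  have LP2: "quad_prod LP T v = 0" if "v \<in> ?P" for v by (rule bspec[OF LP0[THEN conjunct2] that])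
  obtain LR where LR0: "fst ` set LR \<subseteq> - {..0} \<and> (\<forall>v\<in>?R. quad_prod LR T v = 0)"
    using re_space_annihilator[OF lin V, where S = "- {..0}"] by (rule exE)
  have LR1: "fst ` set LR \<subseteq> - {..0}" by (rule LR0[THEN conjunct1])
  have LR2: "quad_prod LR T v = 0" if "v \<in> ?R" for v by (rule bspec[OF LR0[THEN conjunct2] that])
  obtain C where C: "independent C" "span C = ?R"
    using orthonormal_basis_subspace[OF sR] by metis
  have finC: "finite C" using C(1) by (rule independent_imp_finite)
  have int: "?P \<inter> ?R = {0}"
  proof -
    have "x = 0" if "x \<in> ?P" "x \<in> ?R" for x
      by (rule re_space_disjoint[OF lin _ that]) (rule Compl_disjoint)
    then show ?thesis using subspace_0[OF sP] subspace_0[OF sR] by blast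
  qed
  have un: "independent (B \<union> C)" "B \<inter> C = {}"
    using independent_Un_disjoint_spans[OF B(2) C(1)] B(3) C(2) int by auto
  have spV: "span (B \<union> C) = V"
  proof -
    have "span (B \<union> C) = {y + z |y z. y \<in> ?P \<and> z \<in> ?R}" unfolding span_Un B(3) C(2) by blast
    also have "\<dots> = V"
      using re_space_decomposition[OF lin V, of _ "{..0}"] subspace_add[OF V(1)] re_space_subset by blast
    finally show ?thesis .
  qed
  define m k where "m = card B" and "k = card C"
  obtain f where f: "bij_betw f {..<m} B" using ex_bij_betw_nat_finite[OF B(1)] by (auto simp: m_def atLeast0LessThan)
  obtain g where g: "bij_betw g {..<k} C" using ex_bij_betw_nat_finite[OF finC] by (auto simp: k_def atLeast0LessThan)
  define y where "y i = (if i < m then f i else g (i - m))" for i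
  have y: "bij_betw y {..<m + k} (B \<union> C)"
  proof -
    have 1: "bij_betw y {..<m} B" using f by (rule bij_betw_cong[THEN iffD1, rotated]) (simp add: y_def)
    have "bij_betw (\<lambda>i. i - m) {m..<m + k} {..<k}"
      by (rule bij_betw_byWitness[of _ "\<lambda>i. i + m"]) auto
    then have "bij_betw (g \<circ> (\<lambda>i. i - m)) {m..<m + k} C" using g by (rule bij_betw_trans)
    then have 2: "bij_betw y {m..<m + k} C"
      by (rule bij_betw_cong[THEN iffD1, rotated]) (simp add: y_def)
    have "{..<m} \<union> {m..<m + k} = {..<m + k}" by auto
    then show ?thesis using bij_betw_combine[OF 1 2 un(2)] by simp
  qed
  have yV: "vector_frame y (m + k) V" by (rule vector_frame_of_bij[OF y un(1) spV])
  have fP: "vector_frame f m ?P" by (rule vector_frame_of_bij[OF f B(2,3)])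
  have gR: "vector_frame g k ?R" by (rule vector_frame_of_bij[OF g C])
  have nmk: "n = m + k"
  proof -
    interpret x: vector_frame x n V by (rule x(1))
    have inj: "inj_on x {..<n}"
    proof (rule inj_onI, rule ccontr)
      fix i j assume ij: "i \<in> {..<n}" "j \<in> {..<n}" "x i = x j" "i \<noteq> j"
      have "(\<Sum>l<n. (if l = i then 1 else if l = j then -1 else 0) *\<^sub>R x l)
          = (\<Sum>l\<in>{i, j}. (if l = i then 1 else if l = j then -1 else (0::real)) *\<^sub>R x l)"
        using ij by (intro sum.mono_neutral_right) auto
      also have "\<dots> = 0" using ij by simp
      finally show False using x.indep[of "\<lambda>l. if l = i then 1 else if l = j then -1 else 0" i] ij by auto
    qed
    have "independent (x ` {..<n})"
    proof (rule real_vector.independent_if_scalars_zero)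
      fix u v assume "(\<Sum>v\<in>x ` {..<n}. u v *\<^sub>R v) = 0" and v: "v \<in> x ` {..<n}"
      then have "(\<Sum>i<n. u (x i) *\<^sub>R x i) = 0" by (simp add: sum.reindex[OF inj])
      then show "u v = 0" using x.indep[of "\<lambda>i. u (x i)"] v by auto
    qed simp
    moreover have "span (x ` {..<n}) = V"
    proof
      show "span (x ` {..<n}) \<subseteq> V" using x.mem V(1) by (intro span_minimal) auto
      show "V \<subseteq> span (x ` {..<n})"
      proof
        fix v assume "v \<in> V"
        then obtain u where u: "v = (\<Sum>i<n. u i *\<^sub>R x i)" using x.spans by blast
        show "v \<in> span (x ` {..<n})" unfolding u by (intro span_sum span_scale span_base) auto
      qed
    qed
    ultimately have "dim V = n" using dim_eq_card_independent[of "x ` {..<n}"] dim_span[of "x ` {..<n}"] inj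
      by (simp add: card_image)
    moreover have "dim V = m + k"
      using dim_eq_card_independent[OF un(1)] dim_span[of "B \<union> C"] spV un(2) B(1) finC
      by (simp add: card_Un_disjoint m_def k_def)
    ultimately show ?thesis by simp
  qed
  define M where "M = mat m m (\<lambda>(i, j). c (f j) (f i))"
  have Mc: "M \<in> carrier_mat m m" by (simp add: M_def)
  have finj: "inj_on f {..<m}" and fim: "f ` {..<m} = B" using f by (auto simp: bij_betw_def)
  have M: "represents T f m M"
    unfolding represents_def
  proof (intro conjI allI impI Mc)
    fix j assume j: "j < m"
    then have "f j \<in> B" using fim by auto
    then have "T (f j) = (\<Sum>b'\<in>B. c (f j) b' *\<^sub>R b')" by (rule c)
    also have "\<dots> = (\<Sum>i<m. c (f j) (f i) *\<^sub>R f i)" unfolding fim[symmetric] sum.reindex[OF finj] by simp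
    finally show "T (f j) = (\<Sum>i<m. M $$ (i, j) *\<^sub>R f i)" using j by (simp add: M_def)
  qed
  interpret g: vector_frame g k ?R by (rule gR)
  have "\<forall>j. \<exists>u. j < k \<longrightarrow> T (g j) = (\<Sum>i<k. u i *\<^sub>R g i)" using g.spans g.mem TR by blast
  then obtain u where u: "\<And>j. j < k \<Longrightarrow> T (g j) = (\<Sum>i<k. u j i *\<^sub>R g i)" by metis
  define N where "N = mat k k (\<lambda>(i, j). u j i)"
  have Nc: "N \<in> carrier_mat k k" by (simp add: N_def)
  have N: "represents T g k N" using u Nc by (simp add: represents_def N_def)
  let ?F = "four_block_mat M (0\<^sub>m m k) (0\<^sub>m k m) N"
  have Fc: "?F \<in> carrier_mat (m + k) (m + k)" using Mc Nc by simp
  have F: "represents T y (m + k) ?F"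
    unfolding represents_def
  proof (intro conjI allI impI Fc)
    fix j assume j: "j < m + k"
    have split: "(\<Sum>i<m + k. h i) = (\<Sum>i<m. h i) + (\<Sum>i<k. h (m + i))" for h :: "nat \<Rightarrow> 'a"
      using sum.atLeastLessThan_concat[of 0 m "m + k" h] sum.shift_bounds_nat_ivl[of h 0 m k]
      by (simp add: atLeast0LessThan add.commute)
    show "T (y j) = (\<Sum>i<m + k. ?F $$ (i, j) *\<^sub>R y i)"
      using j Mc Nc M N unfolding split by (cases "j < m") (simp_all add: y_def represents_def)
  qed
  have Ac: "A \<in> carrier_mat n n" using x(2) by (simp add: represents_def)
  have "similar_mat A ?F"
    using represents_similar[OF lin x(1) _ x(2)] yV F unfolding nmk by blast
  then have eig: "complex_eigenvalues A = complex_eigenvalues M + complex_eigenvalues N"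
    using complex_eigenvalues_similar[of A n ?F] Ac Fc complex_eigenvalues_block[OF Mc Nc] nmk by simp
  have ReM: "Re z \<le> 0" if "z \<in># complex_eigenvalues M" for z
    using represents_eigenvalue_real_part[OF lin fP M LP2 sP that] LP1 by auto
  have ReN: "Re z > 0" if "z \<in># complex_eigenvalues N" for z
    using represents_eigenvalue_real_part[OF lin gR N LR2 sR that] LR1 by auto
  have 1: "filter_mset (\<lambda>d. Re d < 0) (complex_eigenvalues N) = {#}"
  proof (rule multiset_eqI)
    fix z show "count (filter_mset (\<lambda>d. Re d < 0) (complex_eigenvalues N)) z = count {#} z"
      using ReN[of z] by (cases "z \<in># complex_eigenvalues N") (auto simp: not_in_iff)
  qed
  have 2: "(\<Sum>d\<in>#filter_mset (\<lambda>d. Re d < 0) E. Re d) = (\<Sum>d\<in>#E. Re d)"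
    if "\<And>z. z \<in># E \<Longrightarrow> Re z \<le> 0" for E
    using that
  proof (induction E)
    case (add z E)
    have "Re z \<le> 0" using add.prems[of z] by simp
    moreover have "(\<Sum>d\<in>#filter_mset (\<lambda>d. Re d < 0) E. Re d) = (\<Sum>d\<in>#E. Re d)"
      by (rule add.IH) (use add.prems in auto)
    ultimately show ?case by (cases "Re z < 0") auto
  qed simp
  have 3: "(\<Sum>d\<in>#E. Re d) = Re (\<Sum>d\<in>#E. d)" for E by (induction E) auto
  have "(\<Sum>d\<in>#filter_mset (\<lambda>d. Re d < 0) (complex_eigenvalues A). Re d) = (\<Sum>d\<in>#complex_eigenvalues M. Re d)"
    using 2[of "complex_eigenvalues M"] ReM by (simp add: eig 1)
  also have "\<dots> = Re (\<Sum>d\<in>#complex_eigenvalues M. d)"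
    by (rule 3)
  also have "(\<Sum>d\<in>#complex_eigenvalues M. d) = (\<Sum>i<m. map_mat complex_of_real M $$ (i, i))"
    unfolding complex_eigenvalues_def by (rule sum_proots_char_poly) (use Mc in simp)
  also have "Re \<dots> = (\<Sum>i<m. c (f i) (f i))" using Mc by (simp add: M_def)
  also have "\<dots> = (\<Sum>b\<in>B. c b b)" unfolding fim[symmetric] sum.reindex[OF finj] by simp
  finally show ?thesis .
qed

section \<open>Orthonormal bases adapted to a subspace\<close>

definition orthonormal_set :: "('a::euclidean_space \<Rightarrow> 'a \<Rightarrow> real) \<Rightarrow> 'a set \<Rightarrow> bool" where
  "orthonormal_set ip E \<longleftrightarrow> finite E \<and> (\<forall>x\<in>E. \<forall>y\<in>E. ip x y = (if x = y then 1 else 0))"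

lemma orthonormal_set_coeff:
  assumes "bilinear ip" "orthonormal_set ip E" "a \<in> E"
  shows "ip (\<Sum>b\<in>E. c b *\<^sub>R b) a = c a"
proof -
  have "ip (\<Sum>b\<in>E. c b *\<^sub>R b) a = (\<Sum>b\<in>E. c b * ip b a)" by (simp add: bilinear_lsum[OF assms(1)])
  also have "\<dots> = (\<Sum>b\<in>E. if b = a then c b else 0)"
    using assms(2,3) by (intro sum.cong) (auto simp: orthonormal_set_def)
  finally show ?thesis using assms(2,3) by (simp add: orthonormal_set_def)
qed

lemma orthonormal_set_independent:
  assumes "bilinear ip" "orthonormal_set ip E"
  shows "independent E"
proof (subst independent_explicit, intro conjI allI impI ballI)
  show "finite E" using assms(2) by (simp add: orthonormal_set_def)
  fix c a assume "(\<Sum>b\<in>E. c b *\<^sub>R b) = 0" "a \<in> E"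
  then show "c a = 0"
    using orthonormal_set_coeff[OF assms, of a c] by (simp add: bilinear_lzero[OF assms(1)])
qed

text \<open>
  A maximal orthonormal set in \<open>W\<close> that contains \<open>S\<close>; a vector of \<open>W\<close> outside its span would allow one
  more Gram-Schmidt step.
\<close>

lemma orthonormal_extension:
  assumes ip: "inner_product ip" and W: "subspace W" and S: "orthonormal_set ip S" "S \<subseteq> W"
  shows "\<exists>E. S \<subseteq> E \<and> E \<subseteq> W \<and> orthonormal_set ip E \<and> span E = W"
proof -
  have bil: "bilinear ip" and sym: "\<And>x y. ip x y = ip y x"
    and pos: "\<And>x. x \<noteq> 0 \<Longrightarrow> ip x x > 0"
    using ip by (auto simp: inner_product_def)
  define ok where "ok E \<longleftrightarrow> S \<subseteq> E \<and> E \<subseteq> W \<and> orthonormal_set ip E" for E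
  have "\<exists>E. ok E \<and> (\<forall>F. ok F \<longrightarrow> card F \<le> card E)"
  proof (rule ex_has_greatest_nat)
    show "ok S" using S by (simp add: ok_def)
    show "\<forall>F. ok F \<longrightarrow> card F < Suc DIM('a)"
    proof (intro allI impI)
      fix F assume "ok F"
      then have "independent F" using orthonormal_set_independent[OF bil] by (simp add: ok_def)
      then show "card F < Suc DIM('a)" using independent_bound[of F] by linarith
    qed
  qed
  then obtain E where E: "ok E" and max: "\<And>F. ok F \<Longrightarrow> card F \<le> card E" by blast
  have E': "S \<subseteq> E" "E \<subseteq> W" "orthonormal_set ip E" using E by (auto simp: ok_def)
  have "x \<in> span E" if xW: "x \<in> W" for x
  proof (rule ccontr)
    assume x: "x \<notin> span E"
    define s where "s = (\<Sum>b\<in>E. ip x b *\<^sub>R b)"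
    define y where "y = x - s"
    have s: "s \<in> span E" unfolding s_def by (intro span_sum span_scale span_base)
    have "y \<noteq> 0" using x s by (auto simp: y_def)
    then have yy: "ip y y > 0" by (rule pos)
    define u where "u = (1 / sqrt (ip y y)) *\<^sub>R y"
    have "s \<in> W" unfolding s_def using E'(2) by (auto intro!: subspace_sum[OF W] subspace_scale[OF W])
    then have uW: "u \<in> W" unfolding u_def y_def by (intro subspace_scale[OF W] subspace_diff[OF W] xW)
    have ya: "ip y a = 0" if "a \<in> E" for a
      using orthonormal_set_coeff[OF bil E'(3) that, of "ip x"] by (simp add: y_def s_def bilinear_lsub[OF bil])
    have ua: "ip u a = 0" if "a \<in> E" for a
      using ya[OF that] by (simp add: u_def bilinear_lmul[OF bil])
    have uu: "ip u u = 1"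
      using yy by (simp add: u_def bilinear_lmul[OF bil] bilinear_rmul[OF bil])
    have "u \<notin> E" using ua uu by force
    have "orthonormal_set ip (insert u E)"
      using E'(3) ua uu sym \<open>u \<notin> E\<close> by (auto simp: orthonormal_set_def)
    then have "ok (insert u E)" using E' uW by (auto simp: ok_def)
    then show False using max[of "insert u E"] E'(3) \<open>u \<notin> E\<close> by (simp add: orthonormal_set_def)
  qed
  then have "span E = W" using E'(2) W by (intro equalityI span_minimal subsetI) auto
  then show ?thesis using E' by blast
qed

lemma orthonormal_basis_iff: "orthonormal_basis ip E \<longleftrightarrow> orthonormal_set ip E \<and> span E = UNIV"
  by (auto simp: orthonormal_basis_def orthonormal_set_def)

lemma lin_trace_orthonormal:
  assumes ip: "inner_product ip" and E: "orthonormal_basis ip E" and f: "linear f"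
  shows "lin_trace f = (\<Sum>e\<in>E. ip (f e) e)"
proof -
  have bil: "bilinear ip" using ip by (simp add: inner_product_def)
  have "lin_trace f = (\<Sum>b\<in>Basis. \<Sum>e\<in>E. ip (f b) e * (e \<bullet> b))"
    unfolding lin_trace_def
  proof (intro sum.cong refl)
    fix b
    have "f b \<bullet> b = (\<Sum>e\<in>E. ip (f b) e *\<^sub>R e) \<bullet> b"
      by (rule arg_cong[OF orthonormal_expansion[OF ip E]])
    then show "f b \<bullet> b = (\<Sum>e\<in>E. ip (f b) e * (e \<bullet> b))" by (simp add: inner_sum_left)
  qed
  also have "\<dots> = (\<Sum>e\<in>E. \<Sum>b\<in>Basis. ip (f b) e * (e \<bullet> b))" by (rule sum.swap)
  also have "\<dots> = (\<Sum>e\<in>E. ip (f e) e)"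
  proof (intro sum.cong refl)
    fix e
    have "f e = f (\<Sum>b\<in>Basis. (e \<bullet> b) *\<^sub>R b)" by (simp only: euclidean_representation)
    also have "\<dots> = (\<Sum>b\<in>Basis. (e \<bullet> b) *\<^sub>R f b)" by (simp only: linear_sum[OF f] linear_cmul[OF f])
    finally have fe: "f e = (\<Sum>b\<in>Basis. (e \<bullet> b) *\<^sub>R f b)" .
    have "linear (\<lambda>y. ip y e)" using bil by (simp add: bilinear_def)
    then have "ip (f e) e = (\<Sum>b\<in>Basis. ip ((e \<bullet> b) *\<^sub>R f b) e)" by (subst fe) (rule linear_sum)
    also have "\<dots> = (\<Sum>b\<in>Basis. ip (f b) e * (e \<bullet> b))"
      by (simp only: bilinear_lmul[OF bil]) (simp only: real_scaleR_def mult.commute)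
    finally show "(\<Sum>b\<in>Basis. ip (f b) e * (e \<bullet> b)) = ip (f e) e" by (rule sym)
  qed
  finally show ?thesis .
qed

lemma parseval:
  assumes ip: "inner_product ip" and E: "orthonormal_basis ip E"
  shows "ip x y = (\<Sum>e\<in>E. ip x e * ip y e)"
proof -
  have bil: "bilinear ip" and sym: "\<And>x y. ip x y = ip y x" using ip by (auto simp: inner_product_def)
  have "ip x y = ip (\<Sum>e\<in>E. ip x e *\<^sub>R e) y"
    by (rule arg_cong[OF orthonormal_expansion[OF ip E]])
  also have "\<dots> = (\<Sum>e\<in>E. ip x e * ip y e)"
    unfolding bilinear_lsum[OF bil] by (simp only: real_scaleR_def sym[of _ y])
  finally show ?thesis .
qed

section \<open>Abelian ideals in metric Lie algebras of negative Ricci curvature\<close>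

text \<open>
  For \<open>w\<close> in an abelian ideal \<open>(ad w)\<^sup>2 = 0\<close>, so the Killing form vanishes. Summed over an orthonormal basis of
  the ideal, the negative terms \<open>|[w, u]|\<^sup>2\<close> are compensated by those components of \<open>[u, w]\<close> in the ideal
  which occur twice in the last term of the Ricci formula. What is left is minus the trace of \<open>ad H\<close> plus a
  nonnegative number.
\<close>

lemma abelian_ideal_trace_pos:
  assumes lie: "lie_bracket br" and ip: "inner_product ip" and neg: "negative_ricci br ip"
    and W: "lie_ideal br W" "\<And>v w. v \<in> W \<Longrightarrow> w \<in> W \<Longrightarrow> br v w = 0" "W \<noteq> {0}"
    and F: "orthonormal_set ip F" "span F = W"
  shows "(\<Sum>w\<in>F. ip (br (mean_curvature_vector br ip) w) w) > 0"
proof -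
  let ?H = "mean_curvature_vector br ip"
  have bil: "bilinear br" using lie by (simp add: lie_bracket_def)
  have bip: "bilinear ip" and sym: "\<And>x y. ip x y = ip y x" using ip by (auto simp: inner_product_def)
  have FW: "F \<subseteq> W" using F(2) span_superset by blast
  have fin: "finite F" using F(1) by (simp add: orthonormal_set_def)
  obtain E where E: "F \<subseteq> E" "orthonormal_set ip E" "span E = UNIV"
    using orthonormal_extension[OF ip subspace_UNIV F(1)] by auto
  have onE: "orthonormal_basis ip E" using E by (simp add: orthonormal_basis_iff)
  have finE: "finite E" using E(2) by (simp add: orthonormal_set_def)
  define U where "U = E - F"
  have EU: "E = U \<union> F" "U \<inter> F = {}" "finite U" using E(1) finE by (auto simp: U_def)
  have inW: "br w x \<in> W" if "w \<in> W" for w x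
    using lie_bracket_anti[OF lie, of w x] W(1) that by (auto simp: lie_ideal_def subspace_neg)
  have orth: "ip y u = 0" if "y \<in> W" "u \<in> U" for y u
  proof -
    have lin: "linear (\<lambda>y. ip y u)" using bip by (simp add: bilinear_def)
    have "ip f u = 0" if "f \<in> F" for f using that \<open>u \<in> U\<close> E by (auto simp: U_def orthonormal_set_def)
    then show ?thesis using linear_eq_0_on_span[OF lin, of F y] \<open>y \<in> W\<close> F(2) by blast
  qed
  have pars: "ip y y = (\<Sum>f\<in>F. (ip y f)\<^sup>2)" if "y \<in> W" for y
  proof -
    have "ip y y = (\<Sum>e\<in>U \<union> F. ip y e * ip y e)" using parseval[OF ip onE, of y y] by (simp only: EU(1))
    also have "\<dots> = (\<Sum>e\<in>U. ip y e * ip y e) + (\<Sum>e\<in>F. ip y e * ip y e)"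
      by (rule sum.union_disjoint[OF EU(3) fin EU(2)])
    also have "(\<Sum>e\<in>U. ip y e * ip y e) = 0" using orth[OF that] by simp
    finally show ?thesis by (simp add: power2_eq_square)
  qed
  define q where "q w u f = (ip (br w u) f)\<^sup>2" for w u f
  have q0: "q w u f \<ge> 0" for w u f by (simp add: q_def)
  define A where "A w = (\<Sum>u\<in>U. \<Sum>f\<in>F. q w u f)" for w
  define C where "C w = (\<Sum>u\<in>U. \<Sum>f\<in>F. q f u w)" for w
  have ric: "ricci br ip w \<ge> - ip (br ?H w) w - 1/2 * A w + 1/2 * C w" if w: "w \<in> F" for w
  proof -
    have wW: "w \<in> W" using w FW by blast
    have "br w (br w v) = 0" for v using W(2)[OF wW inW[OF wW]] .
    then have kil: "killing_form br w w = 0" by (simp add: killing_form_def lin_trace_def)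
    have "(\<Sum>e\<in>E. ip (br w e) (br w e)) = (\<Sum>e\<in>U. ip (br w e) (br w e)) + (\<Sum>e\<in>F. ip (br w e) (br w e))"
      unfolding EU(1) by (rule sum.union_disjoint[OF EU(3) fin EU(2)])
    also have "(\<Sum>e\<in>F. ip (br w e) (br w e)) = 0"
      using W(2)[OF wW] FW by (intro sum.neutral) (auto simp: bilinear_lzero[OF bip])
    also have "(\<Sum>e\<in>U. ip (br w e) (br w e)) = A w"
      unfolding A_def q_def by (intro sum.cong refl pars inW wW)
    finally have 1: "(\<Sum>e\<in>E. ip (br w e) (br w e)) = A w" by simp
    have swap: "q u f w = q f u w" for u f
    proof -
      have "br u f = - br f u" by (rule lie_bracket_anti[OF lie])
      then show ?thesis by (simp add: q_def bilinear_lneg[OF bip])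
    qed
    have sp: "(\<Sum>e\<in>E. h e) = (\<Sum>e\<in>U. h e) + (\<Sum>e\<in>F. h e)" for h :: "'a \<Rightarrow> real"
      unfolding EU(1) by (rule sum.union_disjoint[OF EU(3) fin EU(2)])
    have "(\<Sum>e\<in>E. \<Sum>f\<in>E. (ip (br e f) w)\<^sup>2)
        = (\<Sum>e\<in>U. \<Sum>f\<in>U. q e f w) + (\<Sum>e\<in>U. \<Sum>f\<in>F. q e f w)
          + ((\<Sum>e\<in>F. \<Sum>f\<in>U. q e f w) + (\<Sum>e\<in>F. \<Sum>f\<in>F. q e f w))"
      by (simp only: sp sum.distrib q_def[symmetric])
    also have "(\<Sum>e\<in>U. \<Sum>f\<in>F. q e f w) = C w" unfolding C_def by (simp only: swap)
    also have "(\<Sum>e\<in>F. \<Sum>f\<in>U. q e f w) = C w" unfolding C_def by (rule sum.swap)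
    finally have 2: "(\<Sum>e\<in>E. \<Sum>f\<in>E. (ip (br e f) w)\<^sup>2) \<ge> 2 * C w"
      using sum_nonneg[of U "\<lambda>e. \<Sum>f\<in>U. q e f w"] sum_nonneg[of F "\<lambda>e. \<Sum>f\<in>F. q e f w"] q0
      by (simp add: sum_nonneg)
    show ?thesis unfolding ricci_eq[OF bil ip onE] ricci_wrt_def kil 1 using 2 by simp
  qed
  have AC: "(\<Sum>w\<in>F. A w) = (\<Sum>w\<in>F. C w)"
  proof -
    have "(\<Sum>w\<in>F. A w) = (\<Sum>w\<in>F. \<Sum>f\<in>F. \<Sum>u\<in>U. q w u f)" unfolding A_def by (intro sum.cong refl sum.swap)
    also have "\<dots> = (\<Sum>f\<in>F. \<Sum>w\<in>F. \<Sum>u\<in>U. q w u f)" by (rule sum.swap)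
    also have "\<dots> = (\<Sum>f\<in>F. C f)" unfolding C_def by (intro sum.cong refl sum.swap)
    finally show ?thesis .
  qed
  have ne: "F \<noteq> {}" using F(2) W(3) by auto
  have "ricci br ip w < 0" if "w \<in> F" for w
  proof -
    have "w \<noteq> 0" using that F(1) bilinear_lzero[OF bip, of 0] by (auto simp: orthonormal_set_def)
    then show ?thesis using neg by (simp add: negative_ricci_def)
  qed
  then have "(\<Sum>w\<in>F. ricci br ip w) < (\<Sum>w\<in>F. 0)" by (intro sum_strict_mono fin ne)
  moreover have "(\<Sum>w\<in>F. - ip (br ?H w) w - 1/2 * A w + 1/2 * C w) \<le> (\<Sum>w\<in>F. ricci br ip w)"
    by (intro sum_mono ric)
  moreover have "(\<Sum>w\<in>F. - ip (br ?H w) w - 1/2 * A w + 1/2 * C w)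
      = - (\<Sum>w\<in>F. ip (br ?H w) w) - 1/2 * (\<Sum>w\<in>F. A w) + 1/2 * (\<Sum>w\<in>F. C w)"
    by (simp only: sum.distrib sum_subtractf sum_negf sum_distrib_left)
  ultimately show ?thesis using AC by simp
qed

section \<open>The Ricci form in terms of structure constants\<close>

text \<open>
  The Ricci quadratic form written with structure constants \<open>C i j k\<close>, meaning the \<open>k\<close>-component of \<open>[i, j]\<close>,
  in an orthonormal basis indexed by \<open>I\<close>. It makes sense for arbitrary constants, in particular for limits of
  structure constants, for which no bracket has to be constructed.
\<close>

definition ricci_form :: "'i set \<Rightarrow> ('i \<Rightarrow> 'i \<Rightarrow> 'i \<Rightarrow> real) \<Rightarrow> ('i \<Rightarrow> real) \<Rightarrow> real" where
  "ricci_form I C \<xi> =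
     - (\<Sum>l\<in>I. (\<Sum>m\<in>I. C l m m) * (\<Sum>i\<in>I. \<Sum>j\<in>I. \<xi> i * (\<xi> j * C l i j)))
     - 1/2 * (\<Sum>m\<in>I. \<Sum>q\<in>I. (\<Sum>i\<in>I. \<xi> i * C i m q) * (\<Sum>i\<in>I. \<xi> i * C i q m))
     - 1/2 * (\<Sum>m\<in>I. \<Sum>q\<in>I. (\<Sum>i\<in>I. \<xi> i * C i m q)\<^sup>2)
     + 1/4 * (\<Sum>m\<in>I. \<Sum>q\<in>I. (\<Sum>i\<in>I. \<xi> i * C m q i)\<^sup>2)"

text \<open>
  Parseval's identity for each bracket, together with \<open>\<langle>H, u l\<rangle> = Tr (ad (u l))\<close>.
\<close>

lemma ricci_eq_ricci_form:
  assumes br: "bilinear br" and ip: "inner_product ip"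
    and u: "inj_on u I" "orthonormal_basis ip (u ` I)"
    and C: "\<And>i j k. i \<in> I \<Longrightarrow> j \<in> I \<Longrightarrow> k \<in> I \<Longrightarrow> C i j k = ip (br (u i) (u j)) (u k)"
  shows "ricci br ip x = ricci_form I C (\<lambda>i. ip x (u i))"
proof -
  have bip: "bilinear ip" and sym: "\<And>x y. ip x y = ip y x" using ip by (auto simp: inner_product_def)
  let ?\<xi> = "\<lambda>i. ip x (u i)"
  let ?H = "mean_curvature_vector br ip"
  have expand: "y = (\<Sum>i\<in>I. ip y (u i) *\<^sub>R u i)" for y
    using orthonormal_expansion[OF ip u(2), of y] unfolding sum.reindex[OF u(1)] o_def .
  have lin: "f y = (\<Sum>i\<in>I. ip y (u i) * f (u i))" if "linear f" for f :: "'a \<Rightarrow> real" and y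
  proof -
    have "f y = f (\<Sum>i\<in>I. ip y (u i) *\<^sub>R u i)" by (rule arg_cong[OF expand])
    also have "\<dots> = (\<Sum>i\<in>I. f (ip y (u i) *\<^sub>R u i))" by (rule linear_sum[OF that])
    also have "\<dots> = (\<Sum>i\<in>I. ip y (u i) * f (u i))" by (simp only: linear_cmul[OF that] real_scaleR_def)
    finally show ?thesis .
  qed
  have l1: "linear (\<lambda>v. ip (br v y) z)" and l2: "linear (\<lambda>v. ip (br y v) z)" and l3: "linear (\<lambda>v. ip y v)" for y z
    by (intro linearI; simp add: bilinear_ladd[OF br] bilinear_radd[OF br] bilinear_lmul[OF br] bilinear_rmul[OF br]
        bilinear_ladd[OF bip] bilinear_lmul[OF bip] bilinear_radd[OF bip] bilinear_rmul[OF bip])+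
  have ad: "ip (br x (u m)) (u q) = (\<Sum>i\<in>I. ?\<xi> i * C i m q)" if "m \<in> I" "q \<in> I" for m q
    by (rule trans[OF lin[OF l1]], intro sum.cong refl) (simp add: C that)
  have tr: "lin_trace f = (\<Sum>i\<in>I. ip (f (u i)) (u i))" if "linear f" for f :: "'a \<Rightarrow> 'a"
    unfolding lin_trace_orthonormal[OF ip u(2) that] sum.reindex[OF u(1)] by (simp only: o_def)
  have lbr: "linear (br y)" for y using br by (simp add: bilinear_def)
  have Hl: "ip ?H (u l) = (\<Sum>m\<in>I. C l m m)" if "l \<in> I" for l
    unfolding mean_curvature_vector[OF br ip] tr[OF lbr] using that by (intro sum.cong refl) (simp add: C)
  have 1: "ip (br ?H x) x = (\<Sum>l\<in>I. (\<Sum>m\<in>I. C l m m) * (\<Sum>i\<in>I. \<Sum>j\<in>I. ?\<xi> i * (?\<xi> j * C l i j)))"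
  proof -
    have "ip (br ?H x) x = (\<Sum>l\<in>I. ip ?H (u l) * ip (br (u l) x) x)" by (rule lin[OF l1])
    also have "\<dots> = (\<Sum>l\<in>I. (\<Sum>m\<in>I. C l m m) * (\<Sum>i\<in>I. \<Sum>j\<in>I. ?\<xi> i * (?\<xi> j * C l i j)))"
    proof (intro sum.cong refl)
      fix l assume l: "l \<in> I"
      have "ip (br (u l) x) x = (\<Sum>i\<in>I. ?\<xi> i * ip (br (u l) (u i)) x)" by (rule lin[OF l2])
      also have "\<dots> = (\<Sum>i\<in>I. ?\<xi> i * (\<Sum>j\<in>I. ?\<xi> j * C l i j))"
      proof (intro sum.cong refl arg_cong2[of _ _ _ _ "(*)"])
        fix i assume i: "i \<in> I"
        have "ip (br (u l) (u i)) x = (\<Sum>j\<in>I. ?\<xi> j * ip (br (u l) (u i)) (u j))" by (rule lin[OF l3])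
        then show "ip (br (u l) (u i)) x = (\<Sum>j\<in>I. ?\<xi> j * C l i j)"
          using l i by (simp add: C cong: sum.cong)
      qed
      finally have "ip (br (u l) x) x = (\<Sum>i\<in>I. \<Sum>j\<in>I. ?\<xi> i * (?\<xi> j * C l i j))"
        by (simp only: sum_distrib_left)
      then show "ip ?H (u l) * ip (br (u l) x) x
          = (\<Sum>m\<in>I. C l m m) * (\<Sum>i\<in>I. \<Sum>j\<in>I. ?\<xi> i * (?\<xi> j * C l i j))"
        using Hl[OF l] by simp
    qed
    finally show ?thesis .
  qed
  have 2: "killing_form br x x = (\<Sum>m\<in>I. \<Sum>q\<in>I. (\<Sum>i\<in>I. ?\<xi> i * C i m q) * (\<Sum>i\<in>I. ?\<xi> i * C i q m))"
  proof -
    have "linear (\<lambda>v. br x (br x v))" using linear_compose[OF lbr lbr, of x x] by (simp add: o_def)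
    then have "killing_form br x x = (\<Sum>m\<in>I. ip (br x (br x (u m))) (u m))"
      unfolding killing_form_def by (rule tr)
    also have "\<dots> = (\<Sum>m\<in>I. \<Sum>q\<in>I. ip (br x (u m)) (u q) * ip (br x (u q)) (u m))"
      by (intro sum.cong refl lin[OF l2])
    also have "\<dots> = (\<Sum>m\<in>I. \<Sum>q\<in>I. (\<Sum>i\<in>I. ?\<xi> i * C i m q) * (\<Sum>i\<in>I. ?\<xi> i * C i q m))"
      by (intro sum.cong refl) (simp only: ad)
    finally show ?thesis .
  qed
  have pars: "ip y y = (\<Sum>q\<in>I. (ip y (u q))\<^sup>2)" for y
    using lin[OF l3, of y y] by (simp add: power2_eq_square)
  have 3: "(\<Sum>e\<in>u ` I. ip (br x e) (br x e)) = (\<Sum>m\<in>I. \<Sum>q\<in>I. (\<Sum>i\<in>I. ?\<xi> i * C i m q)\<^sup>2)"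
    unfolding sum.reindex[OF u(1)] o_def pars[of "br x _"]
    by (intro sum.cong refl) (simp only: ad)
  have 4: "(\<Sum>e\<in>u ` I. \<Sum>f\<in>u ` I. (ip (br e f) x)\<^sup>2) = (\<Sum>m\<in>I. \<Sum>q\<in>I. (\<Sum>i\<in>I. ?\<xi> i * C m q i)\<^sup>2)"
    unfolding sum.reindex[OF u(1)] o_def
  proof (intro sum.cong refl arg_cong[of _ _ "\<lambda>t. t\<^sup>2"])
    fix m q assume mq: "m \<in> I" "q \<in> I"
    have "ip (br (u m) (u q)) x = (\<Sum>i\<in>I. ?\<xi> i * ip (br (u m) (u q)) (u i))" by (rule lin[OF l3])
    then show "ip (br (u m) (u q)) x = (\<Sum>i\<in>I. ?\<xi> i * C m q i)"
      using mq by (simp add: C cong: sum.cong)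
  qed
  show ?thesis unfolding ricci_eq[OF br ip u(2)] ricci_wrt_def ricci_form_def 1 2 3 4 by simp
qed

lemma representation_UNIV:
  fixes B :: "'a::euclidean_space set"
  assumes "independent B" "span B = UNIV"
  shows "representation B (x + y) b = representation B x b + representation B y b"
    and "representation B (c *\<^sub>R x) b = c * representation B x b"
    and "(\<Sum>b\<in>B. representation B x b *\<^sub>R b) = x"
  using assms independent_imp_finite[OF assms(1)]
  by (simp_all add: real_vector.representation_add real_vector.representation_scale
      real_vector.sum_representation_eq)

text \<open>
  Every basis is orthonormal for some inner product, and so is every rescaling of it.
\<close>

lemma diagonal_inner_product:
  fixes B :: "'a::euclidean_space set" and w :: "'a \<Rightarrow> real"
  assumes B: "independent B" "span B = UNIV" and w: "\<And>b. b \<in> B \<Longrightarrow> w b > 0"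
  shows "\<exists>ip. inner_product ip \<and> inj_on (\<lambda>b. (1 / w b) *\<^sub>R b) B
     \<and> orthonormal_basis ip ((\<lambda>b. (1 / w b) *\<^sub>R b) ` B)
     \<and> (\<forall>x. \<forall>b\<in>B. ip x ((1 / w b) *\<^sub>R b) = w b * representation B x b)"
proof -
  note R = representation_UNIV[OF B]
  have fin: "finite B" by (rule independent_imp_finite[OF B(1)])
  let ?r = "representation B"
  define ip where "ip x y = (\<Sum>b\<in>B. (w b)\<^sup>2 * (?r x b * ?r y b))" for x y
  have basis: "?r b c = (if c = b then 1 else 0)" if "b \<in> B" for b c
    using real_vector.representation_basis[OF B(1) that] by auto
  have ipb: "ip x b = (w b)\<^sup>2 * ?r x b" if "b \<in> B" for x b
  proof -
    have "ip x b = (\<Sum>c\<in>B. if c = b then (w b)\<^sup>2 * ?r x b else 0)"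
      unfolding ip_def by (intro sum.cong refl) (simp add: basis[OF that])
    then show ?thesis using fin that by simp
  qed
  have sym: "ip x y = ip y x" for x y
    unfolding ip_def by (intro sum.cong refl arg_cong2[of _ _ _ _ "(*)"] mult.commute)
  have add: "ip (x + y) z = ip x z + ip y z" for x y z
    unfolding ip_def R(1) by (simp only: distrib_right distrib_left sum.distrib)
  have scale: "ip (c *\<^sub>R x) z = c * ip x z" for c x z
    unfolding ip_def R(2) sum_distrib_left by (intro sum.cong refl) (simp only: ac_simps)
  have bil: "bilinear ip"
    unfolding bilinear_def
    by (intro conjI allI linearI) (simp_all only: add scale sym[of _ "_ + _"] sym[of _ "_ *\<^sub>R _"] real_scaleR_def, simp_all only: sym)
  have "ip x x > 0" if "x \<noteq> 0" for x
  proof -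
    have "\<exists>b\<in>B. ?r x b \<noteq> 0"
    proof (rule ccontr)
      assume "\<not> (\<exists>b\<in>B. ?r x b \<noteq> 0)"
      then have "(\<Sum>b\<in>B. ?r x b *\<^sub>R b) = 0" by simp
      then show False using R(3) that by simp
    qed
    then obtain b where b: "b \<in> B" "?r x b \<noteq> 0" by blast
    have "0 < (w b)\<^sup>2 * (?r x b * ?r x b)" 
    proof (rule mult_pos_pos)
      show "0 < (w b)\<^sup>2" using w[OF b(1)] by (rule zero_less_power)
      show "0 < ?r x b * ?r x b" using b(2) not_real_square_gt_zero by blast
    qed
    also have "\<dots> \<le> ip x x"
      unfolding ip_def using b(1) fin by (intro member_le_sum) simp_all
    finally show ?thesis .
  qed
  then have ip: "inner_product ip"
    unfolding inner_product_def using bil sym by blast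
  have ipu: "ip x ((1 / w b) *\<^sub>R b) = w b * ?r x b" if "b \<in> B" for x b
    using w[OF that] by (simp add: bilinear_rmul[OF bil] ipb[OF that] power2_eq_square)
  have inj: "inj_on (\<lambda>b. (1 / w b) *\<^sub>R b) B"
  proof (rule inj_onI)
    fix b c assume bc: "b \<in> B" "c \<in> B" "(1 / w b) *\<^sub>R b = (1 / w c) *\<^sub>R c"
    have "?r ((1 / w b) *\<^sub>R b) b = ?r ((1 / w c) *\<^sub>R c) b" by (simp only: bc(3))
    then have "(1 / w b) * ?r b b = (1 / w c) * ?r c b" by (simp only: R(2))
    then show "b = c" using w[OF bc(1)] basis[OF bc(1), of b] basis[OF bc(2), of b] by (auto split: if_splits)
  qed
  have "orthonormal_basis ip ((\<lambda>b. (1 / w b) *\<^sub>R b) ` B)"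
    unfolding orthonormal_basis_def
  proof (intro conjI ballI)
    show "finite ((\<lambda>b. (1 / w b) *\<^sub>R b) ` B)" using fin by simp
    show "span ((\<lambda>b. (1 / w b) *\<^sub>R b) ` B) = UNIV"
    proof -
      have "b \<in> span ((\<lambda>b. (1 / w b) *\<^sub>R b) ` B)" if "b \<in> B" for b
      proof -
        have "w b *\<^sub>R ((1 / w b) *\<^sub>R b) \<in> span ((\<lambda>b. (1 / w b) *\<^sub>R b) ` B)"
          using that by (intro span_scale span_base imageI)
        then show ?thesis using w[OF that] by simp
      qed
      then have "span B \<subseteq> span ((\<lambda>b. (1 / w b) *\<^sub>R b) ` B)" by (intro span_minimal) auto
      then show ?thesis using B(2) by blast
    qed
    fix x y assume "x \<in> (\<lambda>b. (1 / w b) *\<^sub>R b) ` B" "y \<in> (\<lambda>b. (1 / w b) *\<^sub>R b) ` B"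
    then obtain b c where bc: "b \<in> B" "c \<in> B" "x = (1 / w b) *\<^sub>R b" "y = (1 / w c) *\<^sub>R c" by blast
    have "(x = y) = (b = c)" using inj bc by (auto simp: inj_on_def)
    moreover have "ip x y = w c * ((1 / w b) * (if c = b then 1 else 0))"
      unfolding bc(4) ipu[OF bc(2)] bc(3) R(2) basis[OF bc(1)] ..
    ultimately show "ip x y = (if x = y then 1 else 0)" using w[OF bc(1)] by auto
  qed
  then show ?thesis using ip inj ipu by (intro exI[of _ ip]) simp
qed

section \<open>Contractions\<close>

lemma ricci_form_homogeneous: "ricci_form I C (\<lambda>i. t * \<xi> i) = t\<^sup>2 * ricci_form I C \<xi>"
proof -
  have "(\<Sum>i\<in>I. t * \<xi> i * f i) = t * (\<Sum>i\<in>I. \<xi> i * f i)" for f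
    by (simp only: sum_distrib_left mult.assoc)
  note 1 = this
  have 2: "(\<Sum>i\<in>I. \<Sum>j\<in>I. t * \<xi> i * (t * \<xi> j * c i j)) = t\<^sup>2 * (\<Sum>i\<in>I. \<Sum>j\<in>I. \<xi> i * (\<xi> j * c i j))" for c
    unfolding sum_distrib_left by (intro sum.cong refl) (simp only: power2_eq_square ac_simps)
  have 3: "(\<Sum>m\<in>I. \<Sum>q\<in>I. t * f m q * (t * g m q)) = t\<^sup>2 * (\<Sum>m\<in>I. \<Sum>q\<in>I. f m q * g m q)" for f g
    unfolding sum_distrib_left by (intro sum.cong refl) (simp only: power2_eq_square ac_simps)
  have 4: "(\<Sum>m\<in>I. \<Sum>q\<in>I. (t * f m q)\<^sup>2) = t\<^sup>2 * (\<Sum>m\<in>I. \<Sum>q\<in>I. (f m q)\<^sup>2)" for f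
    unfolding sum_distrib_left by (intro sum.cong refl) (simp only: power_mult_distrib)
  have 5: "(\<Sum>l\<in>I. f l * (t\<^sup>2 * g l)) = t\<^sup>2 * (\<Sum>l\<in>I. f l * g l)" for f g
    unfolding sum_distrib_left by (intro sum.cong refl) (simp only: ac_simps)
  show ?thesis
    unfolding ricci_form_def 1 2 3 4 5 by (simp add: algebra_simps)
qed

lemma tendsto_ricci_form:
  fixes C :: "nat \<Rightarrow> 'i \<Rightarrow> 'i \<Rightarrow> 'i \<Rightarrow> real"
  assumes C: "\<And>i j k. i \<in> I \<Longrightarrow> j \<in> I \<Longrightarrow> k \<in> I \<Longrightarrow> (\<lambda>n. C n i j k) \<longlonglongrightarrow> C0 i j k"
    and \<xi>: "\<And>i. i \<in> I \<Longrightarrow> (\<lambda>n. \<xi> n i) \<longlonglongrightarrow> \<xi>0 i"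
  shows "(\<lambda>n. ricci_form I (C n) (\<xi> n)) \<longlonglongrightarrow> ricci_form I C0 \<xi>0"
  unfolding ricci_form_def
  by (intro tendsto_add tendsto_diff tendsto_minus tendsto_mult tendsto_const tendsto_sum tendsto_power C \<xi>)

text \<open>
  Compactness of the unit sphere: nonnegative unit vectors for infinitely many \<open>n\<close> would accumulate at a vector
  on which the limit form is not negative.
\<close>

lemma quadratic_form_negative_stable:
  fixes B :: "'a::euclidean_space set" and Q :: "nat \<Rightarrow> ('a \<Rightarrow> real) \<Rightarrow> real"
  assumes B: "independent B" "span B = UNIV"
    and hom: "\<And>n t \<xi>. Q n (\<lambda>b. t * \<xi> b) = t\<^sup>2 * Q n \<xi>"
    and lim: "\<And>\<xi> \<xi>0 r. strict_mono r \<Longrightarrow> (\<And>b. b \<in> B \<Longrightarrow> (\<lambda>n. \<xi> n b) \<longlonglongrightarrow> \<xi>0 b) \<Longrightarrow>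
        (\<lambda>n. Q (r n) (\<xi> n)) \<longlonglongrightarrow> Q0 \<xi>0"
    and neg: "\<And>\<xi>. \<exists>b\<in>B. \<xi> b \<noteq> 0 \<Longrightarrow> Q0 \<xi> < 0"
  shows "\<exists>n. \<forall>x. x \<noteq> 0 \<longrightarrow> Q n (representation B x) < 0"
proof (rule ccontr)
  note R = representation_UNIV[OF B]
  let ?r = "representation B"
  assume "\<not> ?thesis"
  then have "\<forall>n. \<exists>x. x \<noteq> 0 \<and> Q n (?r x) \<ge> 0" by (simp add: not_less)
  then obtain x where x: "\<And>n. x n \<noteq> 0" "\<And>n. Q n (?r (x n)) \<ge> 0" by metis
  define y where "y n = (1 / norm (x n)) *\<^sub>R x n" for n
  have y1: "norm (y n) = 1" for n using x(1)[of n] by (simp add: y_def)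
  have y2: "Q n (?r (y n)) \<ge> 0" for n
  proof -
    have "Q n (?r (y n)) = Q n (\<lambda>b. (1 / norm (x n)) * ?r (x n) b)"
      unfolding y_def by (rule arg_cong[of _ _ "Q n"]) (rule ext, rule R(2))
    also have "\<dots> = (1 / norm (x n))\<^sup>2 * Q n (?r (x n))" by (rule hom)
    finally show ?thesis using x(2)[of n] by simp
  qed
  have "\<forall>n. y n \<in> sphere 0 1" using y1 by simp
  then obtain l r where l: "l \<in> sphere 0 1" "strict_mono r" "(y \<circ> r) \<longlonglongrightarrow> l"
    using compact_sphere[of 0 1] unfolding compact_def by metis
  have lin: "linear (\<lambda>x. ?r x b)" for b by (intro linearI) (simp_all add: R)
  have "(\<lambda>n. ?r (y (r n)) b) \<longlonglongrightarrow> ?r l b" for b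
    using bounded_linear.tendsto[OF linear_conv_bounded_linear[THEN iffD1, OF lin[of b]] l(3)]
    by (simp only: o_def)
  then have "(\<lambda>n. Q (r n) (?r (y (r n)))) \<longlonglongrightarrow> Q0 (?r l)"
    by (intro lim l(2))
  then have "Q0 (?r l) \<ge> 0" by (rule LIMSEQ_le_const) (use y2 in auto)
  moreover have "\<exists>b\<in>B. ?r l b \<noteq> 0"
  proof (rule ccontr)
    assume "\<not> (\<exists>b\<in>B. ?r l b \<noteq> 0)"
    then have "(\<Sum>b\<in>B. ?r l b *\<^sub>R b) = 0" by simp
    then show False using R(3) l(1) by simp
  qed
  ultimately show False using neg[of "?r l"] by simp
qed

text \<open>
  Take the basis orthogonal and give \<open>b\<close> the length \<open>\<gamma> b * \<epsilon> ^ deg b\<close>. Normalising the basis multiplies the structure constant of \<open>i\<close>,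
  \<open>j\<close>, \<open>k\<close> by \<open>\<epsilon> ^ (deg k - deg i - deg j)\<close> up to the factors \<open>\<gamma>\<close>. As \<open>\<epsilon>\<close> tends to zero, only
  the constants that preserve the degree survive, so a metric for small \<open>\<epsilon>\<close> inherits negativity from the graded limit.
\<close>

lemma negative_ricci_by_contraction:
  fixes B :: "'a::euclidean_space set" and deg :: "'a \<Rightarrow> nat" and \<gamma> :: "'a \<Rightarrow> real"
  assumes br: "bilinear br" and B: "independent B" "span B = UNIV"
    and \<gamma>: "\<And>b. b \<in> B \<Longrightarrow> \<gamma> b > 0"
    and deg: "\<And>i j k. i \<in> B \<Longrightarrow> j \<in> B \<Longrightarrow> k \<in> B \<Longrightarrow> representation B (br i j) k \<noteq> 0 \<Longrightarrow> deg i + deg j \<le> deg k"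
    and neg: "\<And>\<xi>. \<exists>b\<in>B. \<xi> b \<noteq> 0 \<Longrightarrow> ricci_form B
        (\<lambda>i j k. if deg k = deg i + deg j then representation B (br i j) k * \<gamma> k / (\<gamma> i * \<gamma> j) else 0) \<xi> < 0"
  shows "\<exists>ip. inner_product ip \<and> negative_ricci br ip"
proof -
  note R = representation_UNIV[OF B]
  let ?r = "representation B"
  define \<epsilon> where "\<epsilon> n = inverse (real (Suc n))" for n
  have \<epsilon>: "\<epsilon> n > 0" for n by (simp add: \<epsilon>_def)
  have \<epsilon>0: "\<epsilon> \<longlonglongrightarrow> 0" unfolding \<epsilon>_def by (rule LIMSEQ_inverse_real_of_nat)
  define w where "w n b = \<gamma> b * \<epsilon> n ^ deg b" for n b
  have w: "w n b > 0" if "b \<in> B" for n b using \<gamma>[OF that] \<epsilon> by (simp add: w_def)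
  define C where "C n i j k = ?r (br i j) k * w n k / (w n i * w n j)" for n i j k
  let ?C0 = "\<lambda>i j k. if deg k = deg i + deg j then ?r (br i j) k * \<gamma> k / (\<gamma> i * \<gamma> j) else 0"
  have lim: "(\<lambda>n. C n i j k) \<longlonglongrightarrow> ?C0 i j k" if ijk: "i \<in> B" "j \<in> B" "k \<in> B" for i j k
  proof (cases "?r (br i j) k = 0")
    case True
    then show ?thesis by (simp add: C_def)
  next
    case False
    define e where "e = deg k - (deg i + deg j)"
    have e: "deg k = deg i + deg j + e" using deg[OF ijk False] by (simp add: e_def)
    define c where "c = ?r (br i j) k * \<gamma> k / (\<gamma> i * \<gamma> j)"
    have "C n i j k = c * \<epsilon> n ^ e" for n
      using \<epsilon>[of n] \<gamma>[OF ijk(1)] \<gamma>[OF ijk(2)] unfolding C_def w_def c_def e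
      by (simp add: power_add field_simps)
    moreover have "(\<lambda>n. c * \<epsilon> n ^ e) \<longlonglongrightarrow> c * 0 ^ e" by (intro tendsto_intros \<epsilon>0)
    moreover have "?C0 i j k = c * 0 ^ e" by (cases e) (simp_all add: e c_def)
    ultimately show ?thesis by simp
  qed
  obtain n where n: "\<And>x. x \<noteq> 0 \<Longrightarrow> ricci_form B (C n) (?r x) < 0"
  proof -
    have "\<exists>n. \<forall>x. x \<noteq> 0 \<longrightarrow> ricci_form B (C n) (?r x) < 0"
    proof (rule quadratic_form_negative_stable[OF B])
      show "ricci_form B (C n) (\<lambda>b. t * \<xi> b) = t\<^sup>2 * ricci_form B (C n) \<xi>" for n t \<xi>
        by (rule ricci_form_homogeneous)
      show "(\<lambda>n. ricci_form B (C (r n)) (\<xi> n)) \<longlonglongrightarrow> ricci_form B ?C0 \<xi>0"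
        if "strict_mono r" "\<And>b. b \<in> B \<Longrightarrow> (\<lambda>n. \<xi> n b) \<longlonglongrightarrow> \<xi>0 b" for \<xi> \<xi>0 r
        by (intro tendsto_ricci_form that(2) LIMSEQ_subseq_LIMSEQ[unfolded o_def, OF lim that(1)])
    qed (rule neg)
    then show ?thesis using that by blast
  qed
  obtain ip where ip: "inner_product ip" "inj_on (\<lambda>b. (1 / w n b) *\<^sub>R b) B"
     "orthonormal_basis ip ((\<lambda>b. (1 / w n b) *\<^sub>R b) ` B)"
     "\<And>x b. b \<in> B \<Longrightarrow> ip x ((1 / w n b) *\<^sub>R b) = w n b * ?r x b"
    using diagonal_inner_product[OF B, of "w n"] w by blast
  have fin: "finite B" by (rule independent_imp_finite[OF B(1)])
  have "ricci br ip x < 0" if x: "x \<noteq> 0" for x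
  proof -
    have "C n i j k = ip (br ((1 / w n i) *\<^sub>R i) ((1 / w n j) *\<^sub>R j)) ((1 / w n k) *\<^sub>R k)"
      if "i \<in> B" "j \<in> B" "k \<in> B" for i j k
      by (simp add: C_def ip(4)[OF that(3)] bilinear_lmul[OF br] bilinear_rmul[OF br] R mult.commute)
    then have "ricci br ip x = ricci_form B (C n) (\<lambda>b. ip x ((1 / w n b) *\<^sub>R b))"
      by (rule ricci_eq_ricci_form[OF br ip(1,2,3)])
    also have "\<dots> = ricci_form B (C n) (\<lambda>b. w n b * ?r x b)"
      unfolding ricci_form_def by (simp add: ip(4) cong: sum.cong)
    also have "\<dots> = ricci_form B (C n) (?r (\<Sum>b\<in>B. (w n b * ?r x b) *\<^sub>R b))"
    proof -
      have "?r (\<Sum>b\<in>B. (w n b * ?r x b) *\<^sub>R b) c = w n c * ?r x c" if c: "c \<in> B" for c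
      proof -
        have l: "linear (\<lambda>x. ?r x c)" by (intro linearI) (simp_all add: R)
        have "?r (\<Sum>b\<in>B. (w n b * ?r x b) *\<^sub>R b) c = (\<Sum>b\<in>B. ?r ((w n b * ?r x b) *\<^sub>R b) c)"
          by (rule linear_sum[OF l])
        also have "\<dots> = (\<Sum>b\<in>B. if b = c then w n c * ?r x c else 0)"
          using real_vector.representation_basis[OF B(1)] by (intro sum.cong refl) (simp add: R(2))
        finally show ?thesis using fin c by simp
      qed
      then show ?thesis unfolding ricci_form_def by (simp cong: sum.cong)
    qed
    also have "\<dots> < 0"
    proof (rule n)
      show "(\<Sum>b\<in>B. (w n b * ?r x b) *\<^sub>R b) \<noteq> 0"
      proof
        assume 0: "(\<Sum>b\<in>B. (w n b * ?r x b) *\<^sub>R b) = 0"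
        have "w n b * ?r x b = 0" if "b \<in> B" for b
          by (rule real_vector.independentD[OF B(1) fin subset_refl 0 that])
        then have "?r x b = 0" if "b \<in> B" for b using w[OF that, of n] that by fastforce
        then have "(\<Sum>b\<in>B. ?r x b *\<^sub>R b) = 0" by simp
        then show False using R(3) x by simp
      qed
    qed
    finally show ?thesis .
  qed
  then show ?thesis using ip(1) by (auto simp: negative_ricci_def)
qed

section \<open>Extensions of a Heisenberg algebra by commuting derivations\<close>

text \<open>
  Structure constants of an extension of a Heisenberg type algebra with basis \<open>V \<union> {z}\<close> and form \<open>\<omega>\<close> by an abelian
  complement with basis \<open>K\<close>, whose elements act by the matrix \<open>D k\<close> on \<open>V\<close> and by the scalar \<open>l k\<close> on
  \<open>z\<close>. The Jacobi identity is not imposed.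
\<close>

definition semidirect :: "'i set \<Rightarrow> 'i set \<Rightarrow> 'i \<Rightarrow> ('i \<Rightarrow> 'i \<Rightarrow> 'i \<Rightarrow> real) \<Rightarrow> ('i \<Rightarrow> real) \<Rightarrow>
    ('i \<Rightarrow> 'i \<Rightarrow> real) \<Rightarrow> 'i \<Rightarrow> 'i \<Rightarrow> 'i \<Rightarrow> real" where
  "semidirect K V z D l \<omega> i j k =
     (if i \<in> K then (if j \<in> V \<and> k \<in> V then D i j k else if j = z \<and> k = z then l i else 0)
      else if j \<in> K then (if i \<in> V \<and> k \<in> V then - D j i k else if i = z \<and> k = z then - l j else 0)
      else if i \<in> V \<and> j \<in> V \<and> k = z then \<omega> i j else 0)"

text \<open>
  The restriction to the span of \<open>V\<close> of the Ricci form of \<open>semidirect\<close>, where \<open>\<tau> k\<close> is the trace of the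
  adjoint map of \<open>k\<close>.
\<close>

definition horizontal_form :: "'i set \<Rightarrow> 'i set \<Rightarrow> ('i \<Rightarrow> 'i \<Rightarrow> 'i \<Rightarrow> real) \<Rightarrow> ('i \<Rightarrow> real) \<Rightarrow>
    ('i \<Rightarrow> 'i \<Rightarrow> real) \<Rightarrow> ('i \<Rightarrow> real) \<Rightarrow> real" where
  "horizontal_form K V D \<tau> \<omega> y =
     - (\<Sum>l\<in>K. \<tau> l * (\<Sum>i\<in>V. \<Sum>j\<in>V. y i * (y j * D l i j)))
     - 1/2 * (\<Sum>m\<in>K. \<Sum>q\<in>V. (\<Sum>i\<in>V. y i * D m i q)\<^sup>2)
     + 1/2 * (\<Sum>m\<in>K. \<Sum>q\<in>V. (\<Sum>i\<in>V. y i * D m q i)\<^sup>2)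
     - 1/2 * (\<Sum>m\<in>V. (\<Sum>i\<in>V. y i * \<omega> i m)\<^sup>2)"

text \<open>
  The form is block diagonal with respect to \<open>K\<close>, \<open>V\<close> and \<open>z\<close>, because the structure constants respect
  this decomposition. The \<open>K\<close>-block is minus the squared length of the symmetric part of the action.
\<close>

lemma ricci_form_semidirect:
  fixes D :: "'i \<Rightarrow> 'i \<Rightarrow> 'i \<Rightarrow> real" and l :: "'i \<Rightarrow> real"
  assumes fin: "finite K" "finite V" and dis: "K \<inter> V = {}" "z \<notin> K" "z \<notin> V"
  defines "\<tau> \<equiv> \<lambda>k. (\<Sum>m\<in>V. D k m m) + l k"
  defines "Dx \<equiv> \<lambda>\<xi> m q. \<Sum>k\<in>K. \<xi> k * D k m q"
  shows "ricci_form (K \<union> V \<union> {z}) (semidirect K V z D l \<omega>) \<xi> =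
     - (1/4 * (\<Sum>m\<in>V. \<Sum>q\<in>V. (Dx \<xi> m q + Dx \<xi> q m)\<^sup>2) + (\<Sum>k\<in>K. \<xi> k * l k)\<^sup>2)
     + horizontal_form K V D \<tau> \<omega> \<xi>
     + (\<xi> z)\<^sup>2 * (1/4 * (\<Sum>i\<in>V. \<Sum>j\<in>V. (\<omega> i j)\<^sup>2) - (\<Sum>k\<in>K. \<tau> k * l k))"
proof -
  define I where "I = K \<union> V \<union> {z}"
  let ?C = "semidirect K V z D l \<omega>"
  let ?Dx = "Dx \<xi>" and ?lx = "\<Sum>k\<in>K. \<xi> k * l k"
  have sI: "(\<Sum>i\<in>I. f i) = (\<Sum>i\<in>K. f i) + (\<Sum>i\<in>V. f i) + f z" for f :: "'i \<Rightarrow> real"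
  proof -
    have "(\<Sum>i\<in>I. f i) = (\<Sum>i\<in>K \<union> V. f i) + (\<Sum>i\<in>{z}. f i)"
      unfolding I_def by (rule sum.union_disjoint) (use fin dis in auto)
    also have "(\<Sum>i\<in>K \<union> V. f i) = (\<Sum>i\<in>K. f i) + (\<Sum>i\<in>V. f i)"
      by (rule sum.union_disjoint) (use fin dis in auto)
    finally show ?thesis by simp
  qed
  have KV: "k \<notin> V" "k \<noteq> z" if "k \<in> K" for k using that dis by auto
  have VK: "v \<notin> K" "v \<noteq> z" if "v \<in> V" for v using that dis by auto
  have C1: "?C k i j = D k i j" if "k \<in> K" "i \<in> V" "j \<in> V" for k i j using that by (simp add: semidirect_def)
  have C2: "?C i k j = - D k i j" if "k \<in> K" "i \<in> V" "j \<in> V" for k i j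
    using that VK by (simp add: semidirect_def)
  have C3: "?C k z z = l k" "?C z k z = - l k" if "k \<in> K" for k
    using that dis by (simp_all add: semidirect_def)
  have C4: "?C i j z = \<omega> i j" if "i \<in> V" "j \<in> V" for i j using that VK by (simp add: semidirect_def)
  have C5: "?C i j k = 0" if "k \<in> K" for i j k using KV[OF that] by (simp add: semidirect_def)
  have C6: "?C i j k = 0" if "i \<in> K" "j \<in> K" for i j k using that KV[OF that(2)] by (simp add: semidirect_def)
  have C7: "?C i j k = 0" if "i \<in> V" "j \<in> V" "k \<in> V" for i j k using VK[OF that(1)] VK[OF that(2)] VK[OF that(3)] by (simp add: semidirect_def)
  have C8: "?C k i z = 0" "?C i k z = 0" "?C k z i = 0" "?C z k i = 0" if "k \<in> K" "i \<in> V" for k i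
    using that VK[OF that(2)] dis by (simp_all add: semidirect_def)
  have C9: "?C z i k = 0" "?C i z k = 0" if "i \<in> V" for i k
    using VK[OF that] dis by (simp_all add: semidirect_def)
  have C10: "?C z z k = 0" for k using dis by (simp add: semidirect_def)
  note C = C1 C2 C3 C4 C5 C6 C7 C8 C9 C10
  define A where "A m q = (\<Sum>i\<in>I. \<xi> i * ?C i m q)" for m q
  define E where "E m q = (\<Sum>i\<in>I. \<xi> i * ?C m q i)" for m q
  have AVV: "A m q = ?Dx m q" if "m \<in> V" "q \<in> V" for m q
    using that by (simp add: A_def sI C Dx_def cong: sum.cong)
  have AKV: "A m q = - (\<Sum>i\<in>V. \<xi> i * D m i q)" if "m \<in> K" "q \<in> V" for m q
    using that by (simp add: A_def sI C sum_negf cong: sum.cong)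
  have AKz: "A m z = - (\<xi> z * l m)" if "m \<in> K" for m
    using that by (simp add: A_def sI C cong: sum.cong)
  have AxK: "A m q = 0" if "q \<in> K" for m q
    using that by (simp add: A_def C)
  have AVz: "A m z = (\<Sum>i\<in>V. \<xi> i * \<omega> i m)" if "m \<in> V" for m
    using that by (simp add: A_def sI C cong: sum.cong)
  have AzV: "A z q = 0" if "q \<in> V" for q
    using that by (simp add: A_def sI C cong: sum.cong)
  have Azz: "A z z = ?lx" by (simp add: A_def sI C cong: sum.cong)
  have EKK: "E m q = 0" if "m \<in> K" "q \<in> K" for m q using that by (simp add: E_def C)
  have EKV: "E m q = (\<Sum>i\<in>V. \<xi> i * D m q i)" if "m \<in> K" "q \<in> V" for m q
    using that by (simp add: E_def sI C cong: sum.cong)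
  have EVK: "E q m = - (\<Sum>i\<in>V. \<xi> i * D m q i)" if "m \<in> K" "q \<in> V" for m q
    using that by (simp add: E_def sI C sum_negf cong: sum.cong)
  have EKz: "E m z = \<xi> z * l m" if "m \<in> K" for m using that by (simp add: E_def sI C cong: sum.cong)
  have EzK: "E z m = - (\<xi> z * l m)" if "m \<in> K" for m using that by (simp add: E_def sI C cong: sum.cong)
  have EVV: "E m q = \<xi> z * \<omega> m q" if "m \<in> V" "q \<in> V" for m q
    using that by (simp add: E_def sI C cong: sum.cong)
  have EVz: "E m z = 0" "E z m = 0" if "m \<in> V" for m using that by (simp_all add: E_def sI C cong: sum.cong)
  have Ezz: "E z z = 0" by (simp add: E_def C)
  have t2: "(\<Sum>m\<in>I. \<Sum>q\<in>I. A m q * A q m) = (\<Sum>m\<in>V. \<Sum>q\<in>V. ?Dx m q * ?Dx q m) + ?lx\<^sup>2"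
    by (simp add: sI sum.distrib AxK AzV AVV Azz power2_eq_square cong: sum.cong)
  have t3: "(\<Sum>m\<in>I. \<Sum>q\<in>I. (A m q)\<^sup>2) = (\<Sum>m\<in>K. \<Sum>q\<in>V. (\<Sum>i\<in>V. \<xi> i * D m i q)\<^sup>2)
      + (\<xi> z)\<^sup>2 * (\<Sum>m\<in>K. (l m)\<^sup>2) + (\<Sum>m\<in>V. \<Sum>q\<in>V. (?Dx m q)\<^sup>2)
      + (\<Sum>m\<in>V. (\<Sum>i\<in>V. \<xi> i * \<omega> i m)\<^sup>2) + ?lx\<^sup>2"
    by (simp add: sI sum.distrib AxK AzV AVV Azz AKV AKz AVz power_mult_distrib sum_distrib_left cong: sum.cong)
  have t4: "(\<Sum>m\<in>I. \<Sum>q\<in>I. (E m q)\<^sup>2) = 2 * (\<Sum>m\<in>K. \<Sum>q\<in>V. (\<Sum>i\<in>V. \<xi> i * D m q i)\<^sup>2)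
      + 2 * ((\<xi> z)\<^sup>2 * (\<Sum>m\<in>K. (l m)\<^sup>2)) + (\<xi> z)\<^sup>2 * (\<Sum>m\<in>V. \<Sum>q\<in>V. (\<omega> m q)\<^sup>2)"
  proof -
    have "(\<Sum>m\<in>V. \<Sum>q\<in>K. (\<Sum>i\<in>V. \<xi> i * D q m i)\<^sup>2) = (\<Sum>q\<in>K. \<Sum>m\<in>V. (\<Sum>i\<in>V. \<xi> i * D q m i)\<^sup>2)"
      by (rule sum.swap)
    then show ?thesis
      by (simp add: sI sum.distrib EKK EKV EVK EKz EzK EVV EVz Ezz power_mult_distrib sum_distrib_left cong: sum.cong)
  qed
  have tau: "(\<Sum>m\<in>I. ?C k m m) = (if k \<in> K then \<tau> k else 0)" if "k \<in> I" for k
  proof -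
    have "k \<in> K \<or> k \<in> V \<or> k = z" using that by (auto simp: I_def)
    then show ?thesis
    proof (elim disjE)
      assume "k \<in> K" then show ?thesis by (simp add: sI C \<tau>_def cong: sum.cong)
    next
      assume k: "k \<in> V" then show ?thesis using VK(1)[OF k] by (simp add: sI C cong: sum.cong)
    next
      assume "k = z" then show ?thesis using dis by (simp add: sI C cong: sum.cong)
    qed
  qed
  have quad: "(\<Sum>i\<in>I. \<Sum>j\<in>I. \<xi> i * (\<xi> j * ?C k i j)) = (\<Sum>i\<in>V. \<Sum>j\<in>V. \<xi> i * (\<xi> j * D k i j)) + (\<xi> z)\<^sup>2 * l k"
    if "k \<in> K" for k
    using that by (simp add: sI sum.distrib C power2_eq_square cong: sum.cong)
  have t1: "(\<Sum>k\<in>I. (\<Sum>m\<in>I. ?C k m m) * (\<Sum>i\<in>I. \<Sum>j\<in>I. \<xi> i * (\<xi> j * ?C k i j)))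
     = (\<Sum>k\<in>K. \<tau> k * (\<Sum>i\<in>V. \<Sum>j\<in>V. \<xi> i * (\<xi> j * D k i j))) + (\<xi> z)\<^sup>2 * (\<Sum>k\<in>K. \<tau> k * l k)"
  proof -
    have "(\<Sum>k\<in>I. (\<Sum>m\<in>I. ?C k m m) * (\<Sum>i\<in>I. \<Sum>j\<in>I. \<xi> i * (\<xi> j * ?C k i j)))
      = (\<Sum>k\<in>I. if k \<in> K then \<tau> k * ((\<Sum>i\<in>V. \<Sum>j\<in>V. \<xi> i * (\<xi> j * D k i j)) + (\<xi> z)\<^sup>2 * l k) else 0)"
      by (rule sum.cong[OF refl], subst tau, assumption) (simp add: quad)
    also have "\<dots> = (\<Sum>k\<in>K. \<tau> k * ((\<Sum>i\<in>V. \<Sum>j\<in>V. \<xi> i * (\<xi> j * D k i j)) + (\<xi> z)\<^sup>2 * l k))"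
      unfolding sI using VK dis by (simp cong: sum.cong)
    finally show ?thesis by (simp add: distrib_left sum.distrib sum_distrib_left mult.left_commute)
  qed
  have sq: "(\<Sum>m\<in>V. \<Sum>q\<in>V. (?Dx m q + ?Dx q m)\<^sup>2)
      = 2 * (\<Sum>m\<in>V. \<Sum>q\<in>V. (?Dx m q)\<^sup>2) + 2 * (\<Sum>m\<in>V. \<Sum>q\<in>V. ?Dx m q * ?Dx q m)"
  proof -
    have "(\<Sum>m\<in>V. \<Sum>q\<in>V. (?Dx q m)\<^sup>2) = (\<Sum>m\<in>V. \<Sum>q\<in>V. (?Dx m q)\<^sup>2)" by (rule sum.swap)
    then show ?thesis by (simp add: power2_sum sum.distrib sum_distrib_left mult.assoc)
  qed
  have "ricci_form I ?C \<xi> = - (\<Sum>k\<in>I. (\<Sum>m\<in>I. ?C k m m) * (\<Sum>i\<in>I. \<Sum>j\<in>I. \<xi> i * (\<xi> j * ?C k i j)))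
     - 1/2 * (\<Sum>m\<in>I. \<Sum>q\<in>I. A m q * A q m) - 1/2 * (\<Sum>m\<in>I. \<Sum>q\<in>I. (A m q)\<^sup>2)
     + 1/4 * (\<Sum>m\<in>I. \<Sum>q\<in>I. (E m q)\<^sup>2)"
    unfolding ricci_form_def A_def E_def ..
  then show ?thesis unfolding I_def[symmetric] t1 t2 t3 t4 sq horizontal_form_def by (simp add: algebra_simps)
qed

lemma horizontal_form_homogeneous: "horizontal_form K V D \<tau> \<omega> (\<lambda>i. t * y i) = t\<^sup>2 * horizontal_form K V D \<tau> \<omega> y"
proof -
  have 1: "(\<Sum>i\<in>V. t * y i * f i) = t * (\<Sum>i\<in>V. y i * f i)" for f
    by (simp only: sum_distrib_left mult.assoc)
  have 2: "(\<Sum>i\<in>V. \<Sum>j\<in>V. t * y i * (t * y j * c i j)) = t\<^sup>2 * (\<Sum>i\<in>V. \<Sum>j\<in>V. y i * (y j * c i j))" for c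
    unfolding sum_distrib_left by (intro sum.cong refl) (simp only: power2_eq_square ac_simps)
  have 3: "(\<Sum>m\<in>K. t\<^sup>2 * f m) = t\<^sup>2 * (\<Sum>m\<in>K. f m)" for f
    by (simp only: sum_distrib_left)
  have 4: "(\<Sum>m\<in>V. (t * f m)\<^sup>2) = t\<^sup>2 * (\<Sum>m\<in>V. (f m)\<^sup>2)" for f
    unfolding sum_distrib_left by (intro sum.cong refl) (simp only: power_mult_distrib)
  have 5: "(\<Sum>l\<in>K. f l * (t\<^sup>2 * g l)) = t\<^sup>2 * (\<Sum>l\<in>K. f l * g l)" for f g
    unfolding sum_distrib_left by (intro sum.cong refl) (simp only: ac_simps)
  show ?thesis
    unfolding horizontal_form_def 1 2 3 4 5 by (simp add: algebra_simps)
qed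

lemma tendsto_horizontal_form:
  assumes "\<And>k i j. k \<in> K \<Longrightarrow> i \<in> V \<Longrightarrow> j \<in> V \<Longrightarrow> (\<lambda>n. D n k i j) \<longlonglongrightarrow> D0 k i j"
    and "\<And>i j. i \<in> V \<Longrightarrow> j \<in> V \<Longrightarrow> (\<lambda>n. \<omega> n i j) \<longlonglongrightarrow> \<omega>0 i j"
    and "\<And>i. i \<in> V \<Longrightarrow> (\<lambda>n. y n i) \<longlonglongrightarrow> y0 i"
  shows "(\<lambda>n. horizontal_form K V (D n) \<tau> (\<omega> n) (y n)) \<longlonglongrightarrow> horizontal_form K V D0 \<tau> \<omega>0 y0"
  unfolding horizontal_form_def
  by (intro tendsto_add tendsto_diff tendsto_minus tendsto_mult tendsto_const tendsto_sum tendsto_power assms)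

text \<open>A matrix that is scalar plus skew on blocks is normal, so the two middle sums cancel. The hypothesis on \<open>\<omega>\<close>
  says that each column has at most one nonzero entry, so the last sum is diagonal.\<close>

lemma horizontal_form_normal:
  assumes fin: "finite V"
    and skew: "\<And>k i j. k \<in> K \<Longrightarrow> i \<in> V \<Longrightarrow> j \<in> V \<Longrightarrow> i \<noteq> j \<Longrightarrow> D k i j = - D k j i"
    and diag: "\<And>k i j. k \<in> K \<Longrightarrow> i \<in> V \<Longrightarrow> j \<in> V \<Longrightarrow> D k i j \<noteq> 0 \<Longrightarrow> D k i i = D k j j"
    and \<sigma>: "\<And>i i' m. i \<in> V \<Longrightarrow> i' \<in> V \<Longrightarrow> m \<in> V \<Longrightarrow> \<omega> i m \<noteq> 0 \<Longrightarrow> \<omega> i' m \<noteq> 0 \<Longrightarrow> i = i'"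
  shows "horizontal_form K V D \<tau> \<omega> y =
     - (\<Sum>i\<in>V. (y i)\<^sup>2 * ((\<Sum>l\<in>K. \<tau> l * D l i i) + 1/2 * (\<Sum>m\<in>V. (\<omega> i m)\<^sup>2)))"
proof -
  have q: "(\<Sum>i\<in>V. \<Sum>j\<in>V. y i * (y j * D k i j)) = (\<Sum>i\<in>V. (y i)\<^sup>2 * D k i i)" if k: "k \<in> K" for k
  proof -
    let ?S = "\<Sum>i\<in>V. \<Sum>j\<in>V. y i * (y j * D k i j)"
    have "?S = (\<Sum>j\<in>V. \<Sum>i\<in>V. y i * (y j * D k i j))" by (rule sum.swap)
    then have "2 * ?S = (\<Sum>i\<in>V. \<Sum>j\<in>V. y i * (y j * D k i j) + y j * (y i * D k j i))"
      by (simp only: sum.distrib mult_2)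
    also have "\<dots> = (\<Sum>i\<in>V. \<Sum>j\<in>V. if j = i then 2 * ((y i)\<^sup>2 * D k i i) else 0)"
    proof (intro sum.cong refl)
      fix i j assume ij: "i \<in> V" "j \<in> V"
      show "y i * (y j * D k i j) + y j * (y i * D k j i) = (if j = i then 2 * ((y i)\<^sup>2 * D k i i) else 0)"
        using skew[OF k ij] by (cases "i = j") (simp_all add: power2_eq_square)
    qed
    also have "\<dots> = 2 * (\<Sum>i\<in>V. (y i)\<^sup>2 * D k i i)" using fin by (simp add: sum_distrib_left)
    finally show ?thesis by simp
  qed
  have normal: "(\<Sum>q\<in>V. (\<Sum>i\<in>V. y i * D k i q)\<^sup>2) = (\<Sum>q\<in>V. (\<Sum>i\<in>V. y i * D k q i)\<^sup>2)" if k: "k \<in> K" for k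
  proof -
    define S where "S i j = (if i = j then 0 else D k i j)" for i j
    define s where "s q = (\<Sum>i\<in>V. y i * S q i)" for q
    have S: "S i j = - S j i" if "i \<in> V" "j \<in> V" for i j using skew[OF k that] by (simp add: S_def)
    have r: "(\<Sum>i\<in>V. y i * D k q i) = y q * D k q q + s q" if q: "q \<in> V" for q
    proof -
      have "(\<Sum>i\<in>V. y i * D k q i) = (\<Sum>i\<in>V. (if i = q then y q * D k q q else 0) + y i * S q i)"
        by (intro sum.cong refl) (simp add: S_def)
      then show ?thesis using q fin by (simp add: sum.distrib s_def)
    qed
    have c: "(\<Sum>i\<in>V. y i * D k i q) = y q * D k q q - s q" if q: "q \<in> V" for q
    proof -
      have "(\<Sum>i\<in>V. y i * D k i q) = (\<Sum>i\<in>V. (if i = q then y q * D k q q else 0) + - (y i * S q i))"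
      proof (intro sum.cong refl)
        fix i assume i: "i \<in> V"
        show "y i * D k i q = (if i = q then y q * D k q q else 0) + - (y i * S q i)"
          using skew[OF k i q] by (simp add: S_def)
      qed
      then show ?thesis using q fin by (simp add: sum.distrib s_def sum_negf sum_subtractf)
    qed
    have "(\<Sum>q\<in>V. (\<Sum>i\<in>V. y i * D k q i)\<^sup>2) - (\<Sum>q\<in>V. (\<Sum>i\<in>V. y i * D k i q)\<^sup>2)
        = (\<Sum>q\<in>V. 4 * (y q * D k q q * s q))"
      unfolding sum_subtractf[symmetric]
      by (intro sum.cong refl) (simp add: r c power2_eq_square algebra_simps)
    also have "\<dots> = 4 * (\<Sum>q\<in>V. \<Sum>i\<in>V. y q * (y i * (D k q q * S q i)))"
      by (simp add: s_def sum_distrib_left ac_simps)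
    also have "(\<Sum>q\<in>V. \<Sum>i\<in>V. y q * (y i * (D k q q * S q i))) = 0"
    proof -
      let ?T = "\<Sum>q\<in>V. \<Sum>i\<in>V. y q * (y i * (D k q q * S q i))"
      have "?T = (\<Sum>i\<in>V. \<Sum>q\<in>V. y q * (y i * (D k q q * S q i)))" by (rule sum.swap)
      also have "\<dots> = (\<Sum>i\<in>V. \<Sum>q\<in>V. - (y i * (y q * (D k i i * S i q))))"
      proof (intro sum.cong refl)
        fix i q assume iq: "i \<in> V" "q \<in> V"
        have "D k q q * S q i = - (D k i i * S i q)"
        proof (cases "S q i = 0")
          case True then show ?thesis using S[OF iq(2,1)] by simp
        next
          case False
          then have "D k q i \<noteq> 0" by (auto simp: S_def split: if_splits)
          then show ?thesis using diag[OF k iq(2,1)] S[OF iq(2,1)] by simp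
        qed
        then show "y q * (y i * (D k q q * S q i)) = - (y i * (y q * (D k i i * S i q)))"
          by (simp add: mult.left_commute)
      qed
      also have "\<dots> = - ?T" by (simp only: sum_negf)
      finally show ?thesis by simp
    qed
    finally show ?thesis by simp
  qed
  have om: "(\<Sum>m\<in>V. (\<Sum>i\<in>V. y i * \<omega> i m)\<^sup>2) = (\<Sum>i\<in>V. (y i)\<^sup>2 * (\<Sum>m\<in>V. (\<omega> i m)\<^sup>2))"
  proof -
    have "(\<Sum>i\<in>V. y i * \<omega> i m)\<^sup>2 = (\<Sum>i\<in>V. (y i)\<^sup>2 * (\<omega> i m)\<^sup>2)" if m: "m \<in> V" for m
    proof (cases "\<exists>i\<in>V. \<omega> i m \<noteq> 0")
      case True
      then obtain i where i: "i \<in> V" "\<omega> i m \<noteq> 0" by blast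
      have z: "\<omega> i' m = 0" if "i' \<in> V" "i' \<noteq> i" for i' using \<sigma>[OF that(1) i(1) m _ i(2)] that(2) by blast
      have "(\<Sum>i\<in>V. y i * \<omega> i m) = (\<Sum>i\<in>{i}. y i * \<omega> i m)"
        by (rule sum.mono_neutral_right) (use fin i z in auto)
      moreover have "(\<Sum>i\<in>V. (y i)\<^sup>2 * (\<omega> i m)\<^sup>2) = (\<Sum>i\<in>{i}. (y i)\<^sup>2 * (\<omega> i m)\<^sup>2)"
        by (rule sum.mono_neutral_right) (use fin i z in auto)
      ultimately show ?thesis by (simp add: power_mult_distrib)
    next
      case False
      then show ?thesis by simp
    qed
    then have "(\<Sum>m\<in>V. (\<Sum>i\<in>V. y i * \<omega> i m)\<^sup>2) = (\<Sum>m\<in>V. \<Sum>i\<in>V. (y i)\<^sup>2 * (\<omega> i m)\<^sup>2)"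
      by (rule sum.cong[OF refl])
    also have "\<dots> = (\<Sum>i\<in>V. \<Sum>m\<in>V. (y i)\<^sup>2 * (\<omega> i m)\<^sup>2)" by (rule sum.swap)
    finally show ?thesis by (simp only: sum_distrib_left)
  qed
  have "(\<Sum>l\<in>K. \<tau> l * (\<Sum>i\<in>V. \<Sum>j\<in>V. y i * (y j * D l i j))) = (\<Sum>l\<in>K. \<tau> l * (\<Sum>i\<in>V. (y i)\<^sup>2 * D l i i))"
    by (intro sum.cong refl) (simp only: q)
  also have "\<dots> = (\<Sum>l\<in>K. \<Sum>i\<in>V. (y i)\<^sup>2 * (\<tau> l * D l i i))"
    unfolding sum_distrib_left by (intro sum.cong refl) (simp only: ac_simps)
  also have "\<dots> = (\<Sum>i\<in>V. \<Sum>l\<in>K. (y i)\<^sup>2 * (\<tau> l * D l i i))" by (rule sum.swap)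
  finally have tr: "(\<Sum>l\<in>K. \<tau> l * (\<Sum>i\<in>V. \<Sum>j\<in>V. y i * (y j * D l i j)))
      = (\<Sum>i\<in>V. (y i)\<^sup>2 * (\<Sum>l\<in>K. \<tau> l * D l i i))" by (simp only: sum_distrib_left)
  have nm: "(\<Sum>m\<in>K. \<Sum>q\<in>V. (\<Sum>i\<in>V. y i * D m i q)\<^sup>2) = (\<Sum>m\<in>K. \<Sum>q\<in>V. (\<Sum>i\<in>V. y i * D m q i)\<^sup>2)"
    by (intro sum.cong refl normal)
  show ?thesis unfolding horizontal_form_def tr nm om
    by (simp add: distrib_left sum.distrib sum_distrib_left)
qed

text \<open>
  The three blocks of \<open>ricci_form_semidirect\<close> are treated separately. The condition on \<open>K\<close> says that no
  nonzero combination of the complement acts by a skew map annihilating \<open>z\<close>, and the one on \<open>z\<close> balances the trace term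
  against the form \<open>\<omega>\<close>.
\<close>

lemma ricci_form_semidirect_negative:
  assumes fin: "finite K" "finite V" and dis: "K \<inter> V = {}" "z \<notin> K" "z \<notin> V"
    and \<tau>: "\<And>k. k \<in> K \<Longrightarrow> \<tau> k = (\<Sum>m\<in>V. D k m m) + l k"
    and K: "\<And>x. \<exists>k\<in>K. x k \<noteq> 0 \<Longrightarrow> (\<Sum>k\<in>K. x k * l k) \<noteq> 0 \<or>
        (\<exists>i\<in>V. \<exists>j\<in>V. (\<Sum>k\<in>K. x k * D k i j) + (\<Sum>k\<in>K. x k * D k j i) \<noteq> 0)"
    and V: "\<And>y. \<exists>i\<in>V. y i \<noteq> 0 \<Longrightarrow> horizontal_form K V D \<tau> \<omega> y < 0"
    and Z: "1/4 * (\<Sum>i\<in>V. \<Sum>j\<in>V. (\<omega> i j)\<^sup>2) < (\<Sum>k\<in>K. \<tau> k * l k)"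
    and \<xi>: "\<exists>b\<in>K \<union> V \<union> {z}. \<xi> b \<noteq> 0"
  shows "ricci_form (K \<union> V \<union> {z}) (semidirect K V z D l \<omega>) \<xi> < 0"
proof -
  let ?D = "\<lambda>m q. \<Sum>k\<in>K. \<xi> k * D k m q"
  let ?a = "1/4 * (\<Sum>m\<in>V. \<Sum>q\<in>V. (?D m q + ?D q m)\<^sup>2) + (\<Sum>k\<in>K. \<xi> k * l k)\<^sup>2"
  let ?v = "horizontal_form K V D \<tau> \<omega> \<xi>"
  let ?z = "1/4 * (\<Sum>i\<in>V. \<Sum>j\<in>V. (\<omega> i j)\<^sup>2) - (\<Sum>k\<in>K. \<tau> k * l k)"
  have h: "horizontal_form K V D (\<lambda>k. (\<Sum>m\<in>V. D k m m) + l k) \<omega> \<xi> = ?v"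
    unfolding horizontal_form_def by (simp add: \<tau> cong: sum.cong)
  have t: "(\<Sum>k\<in>K. ((\<Sum>m\<in>V. D k m m) + l k) * l k) = (\<Sum>k\<in>K. \<tau> k * l k)"
    by (simp add: \<tau> cong: sum.cong)
  have eq: "ricci_form (K \<union> V \<union> {z}) (semidirect K V z D l \<omega>) \<xi> = - ?a + ?v + (\<xi> z)\<^sup>2 * ?z"
    using ricci_form_semidirect[OF fin dis, of D l \<omega> \<xi>] unfolding h t by simp
  have s0: "0 \<le> (\<Sum>m\<in>V. \<Sum>q\<in>V. (?D m q + ?D q m)\<^sup>2)" by (intro sum_nonneg) simp
  have a0: "?a \<ge> 0" using s0 by simp
  have a1: "?a > 0" if ex: "\<exists>k\<in>K. \<xi> k \<noteq> 0"
  proof (cases "(\<Sum>k\<in>K. \<xi> k * l k) = 0")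
    case True
    then obtain i j where ij: "i \<in> V" "j \<in> V" "?D i j + ?D j i \<noteq> 0" using K[of \<xi>] ex by blast
    have "0 < (?D i j + ?D j i)\<^sup>2" using ij(3) by simp
    also have "\<dots> \<le> (\<Sum>q\<in>V. (?D i q + ?D q i)\<^sup>2)"
      by (rule member_le_sum[OF ij(2)]) (use fin in auto)
    also have "\<dots> \<le> (\<Sum>m\<in>V. \<Sum>q\<in>V. (?D m q + ?D q m)\<^sup>2)"
      by (rule member_le_sum[OF ij(1)]) (use fin in \<open>auto intro!: sum_nonneg\<close>)
    finally have "0 < (\<Sum>m\<in>V. \<Sum>q\<in>V. (?D m q + ?D q m)\<^sup>2)" .
    then show ?thesis by (intro add_pos_nonneg) simp_all
  next
    case False
    then show ?thesis using s0 by (intro add_nonneg_pos) simp_all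
  qed
  have v0: "?v \<le> 0"
  proof (cases "\<exists>i\<in>V. \<xi> i \<noteq> 0")
    case True then show ?thesis using V[of \<xi>] by simp
  next
    case False then show ?thesis unfolding horizontal_form_def by simp
  qed
  have z0: "(\<xi> z)\<^sup>2 * ?z \<le> 0" using Z by (intro mult_nonneg_nonpos) auto
  consider "\<exists>k\<in>K. \<xi> k \<noteq> 0" | "\<exists>i\<in>V. \<xi> i \<noteq> 0" | "\<xi> z \<noteq> 0" using \<xi> by blast
  then show ?thesis
  proof cases
    case 1 then show ?thesis unfolding eq using a1 v0 z0 by linarith
  next
    case 2 then show ?thesis unfolding eq using a0 V[of \<xi>] z0 by linarith
  next
    case 3
    then have "(\<xi> z)\<^sup>2 * ?z < 0" using Z by (intro mult_pos_neg) auto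
    then show ?thesis unfolding eq using a0 v0 by linarith
  qed
qed

lemma ricci_form_cong:
  assumes "\<And>i j k. i \<in> I \<Longrightarrow> j \<in> I \<Longrightarrow> k \<in> I \<Longrightarrow> C i j k = C' i j k"
  shows "ricci_form I C \<xi> = ricci_form I C' \<xi>"
  unfolding ricci_form_def by (simp add: assms cong: sum.cong)

text \<open>
  An instance of \<open>quadratic_form_negative_stable\<close>, applied to the form extended by minus a sum of squares to
  the coordinates outside \<open>V\<close>.
\<close>

lemma horizontal_form_negative_stable:
  fixes V :: "'a::euclidean_space set"
  assumes V: "independent V"
    and D: "\<And>k i j. k \<in> K \<Longrightarrow> i \<in> V \<Longrightarrow> j \<in> V \<Longrightarrow> (\<lambda>n. D n k i j) \<longlonglongrightarrow> D0 k i j"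
    and \<omega>: "\<And>i j. i \<in> V \<Longrightarrow> j \<in> V \<Longrightarrow> (\<lambda>n. \<omega> n i j) \<longlonglongrightarrow> \<omega>0 i j"
    and neg: "\<And>y. \<exists>i\<in>V. y i \<noteq> 0 \<Longrightarrow> horizontal_form K V D0 \<tau> \<omega>0 y < 0"
  shows "\<exists>n. \<forall>y. (\<exists>i\<in>V. y i \<noteq> 0) \<longrightarrow> horizontal_form K V (D n) \<tau> (\<omega> n) y < 0"
proof -
  obtain B where B: "V \<subseteq> B" "independent B" "UNIV \<subseteq> span B"
    using maximal_independent_subset_extend[of V UNIV] V by auto
  then have spB: "span B = UNIV" by blast
  have fin: "finite B" by (rule independent_imp_finite[OF B(2)])
  define Q where "Q n \<xi> = horizontal_form K V (D n) \<tau> (\<omega> n) \<xi> - (\<Sum>b\<in>B - V. (\<xi> b)\<^sup>2)" for n \<xi>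
  define Q0 where "Q0 \<xi> = horizontal_form K V D0 \<tau> \<omega>0 \<xi> - (\<Sum>b\<in>B - V. (\<xi> b)\<^sup>2)" for \<xi>
  have "\<exists>n. \<forall>x. x \<noteq> 0 \<longrightarrow> Q n (representation B x) < 0"
  proof (rule quadratic_form_negative_stable[OF B(2) spB])
    show "Q n (\<lambda>b. t * \<xi> b) = t\<^sup>2 * Q n \<xi>" for n t \<xi>
      unfolding Q_def horizontal_form_homogeneous
      by (simp add: power_mult_distrib sum_distrib_left right_diff_distrib)
    show "(\<lambda>n. Q (r n) (\<xi> n)) \<longlonglongrightarrow> Q0 \<xi>0"
      if r: "strict_mono r" and \<xi>: "\<And>b. b \<in> B \<Longrightarrow> (\<lambda>n. \<xi> n b) \<longlonglongrightarrow> \<xi>0 b" for \<xi> \<xi>0 r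
      unfolding Q_def Q0_def
      by (intro tendsto_diff tendsto_sum tendsto_power tendsto_horizontal_form \<xi>
          LIMSEQ_subseq_LIMSEQ[unfolded o_def, OF D r] LIMSEQ_subseq_LIMSEQ[unfolded o_def, OF \<omega> r])
        (use B(1) in auto)
    show "Q0 \<xi> < 0" if ex: "\<exists>b\<in>B. \<xi> b \<noteq> 0" for \<xi>
    proof (cases "\<exists>b\<in>V. \<xi> b \<noteq> 0")
      case True
      have "0 \<le> (\<Sum>b\<in>B - V. (\<xi> b)\<^sup>2)" by (intro sum_nonneg) simp
      then show ?thesis using neg[OF True] by (simp add: Q0_def)
    next
      case False
      then obtain b where b: "b \<in> B - V" "\<xi> b \<noteq> 0" using ex by blast
      have "0 < (\<xi> b)\<^sup>2" using b(2) by simp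
      also have "\<dots> \<le> (\<Sum>b\<in>B - V. (\<xi> b)\<^sup>2)" by (rule member_le_sum[OF b(1)]) (use fin in auto)
      finally have "0 < (\<Sum>b\<in>B - V. (\<xi> b)\<^sup>2)" .
      moreover have "horizontal_form K V D0 \<tau> \<omega>0 \<xi> = 0" using False unfolding horizontal_form_def by simp
      ultimately show ?thesis by (simp add: Q0_def)
    qed
  qed
  then obtain n where n: "\<And>x. x \<noteq> 0 \<Longrightarrow> Q n (representation B x) < 0" by blast
  have "horizontal_form K V (D n) \<tau> (\<omega> n) y < 0" if y: "\<exists>i\<in>V. y i \<noteq> 0" for y
  proof -
    define c where "c b = (if b \<in> V then y b else 0)" for b
    define x where "x = (\<Sum>b\<in>B. c b *\<^sub>R b)"
    note R = representation_UNIV[OF B(2) spB]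
    have rep: "representation B x b = c b" if b: "b \<in> B" for b
    proof -
      have l: "linear (\<lambda>x. representation B x b)" by (intro linearI) (simp_all add: R)
      have "representation B x b = (\<Sum>a\<in>B. representation B (c a *\<^sub>R a) b)"
        unfolding x_def by (rule linear_sum[OF l])
      also have "\<dots> = (\<Sum>a\<in>B. if a = b then c b else 0)"
        using real_vector.representation_basis[OF B(2)] by (intro sum.cong refl) (simp add: R(2))
      finally show ?thesis using fin b by simp
    qed
    have "x \<noteq> 0"
    proof
      assume x0: "x = 0"
      obtain i where i: "i \<in> V" "y i \<noteq> 0" using y by blast
      then have "representation B 0 i = c i" using rep[of i] B(1) x0 by auto
      then show False using i by (simp add: c_def real_vector.representation_zero)
    qed
    then have "Q n (representation B x) < 0" by (rule n)
    moreover have "Q n (representation B x) = horizontal_form K V (D n) \<tau> (\<omega> n) y"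
    proof -
      have v: "representation B x b = y b" if "b \<in> V" for b using rep[of b] that B(1) by (auto simp: c_def)
      have "(\<Sum>b\<in>B - V. (representation B x b)\<^sup>2) = 0"
        using rep by (intro sum.neutral) (auto simp: c_def)
      then show ?thesis unfolding Q_def horizontal_form_def by (simp add: v cong: sum.cong)
    qed
    ultimately show ?thesis by simp
  qed
  then show ?thesis by blast
qed

section \<open>Solvable Lie algebras with Heisenberg nilradical\<close>

text \<open>
  The nilradical is handled through the complement \<open>v\<close> of its centre spanned by the given basis: \<open>pr\<close> projects
  \<open>n\<close> onto \<open>v\<close> along \<open>Z\<close>, so \<open>\<Phi> A\<close> represents the induced map on the quotient by the centre.
\<close>

locale heisenberg_nilradical =
  fixes br :: "'a::euclidean_space \<Rightarrow> 'a \<Rightarrow> 'a" and n :: "'a set"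
    and p :: nat and X :: "nat \<Rightarrow> 'a" and Z :: 'a
  assumes lie: "lie_bracket br" and solv: "solvable_lie br"
    and nil: "is_nilradical br n" and heis: "heisenberg_basis br n p X Z"
begin

definition v :: "'a set" where "v = span (X ` {1..2*p})"
definition lam :: "'a \<Rightarrow> real" where "lam A = lambda_coeff br Z A"
definition \<omega> :: "'a \<Rightarrow> 'a \<Rightarrow> real" where "\<omega> x y = (br x y \<bullet> Z) / (Z \<bullet> Z)"
definition pr :: "'a \<Rightarrow> 'a" where "pr = (SOME P. linear P \<and> P Z = 0 \<and> (\<forall>x\<in>v. P x = x))"
definition \<Phi> :: "'a \<Rightarrow> 'a \<Rightarrow> 'a" where "\<Phi> A x = pr (br A x)"

lemma bil: "bilinear br" using lie by (simp add: lie_bracket_def)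
lemma ideal: "lie_ideal br n" using nil by (simp add: is_nilradical_def nilpotent_ideal_def)
lemma sub_n: "subspace n" using ideal by (simp add: lie_ideal_def)
lemma anti: "br x y = - br y x" by (rule lie_bracket_anti[OF lie])
lemma inj: "inj_on X {1..2*p}"
  by (rule heis[unfolded heisenberg_basis_def, THEN conjunct1])
lemma ZX: "Z \<notin> X ` {1..2*p}"
  by (rule heis[unfolded heisenberg_basis_def, THEN conjunct2, THEN conjunct1])
lemma ind: "independent (insert Z (X ` {1..2*p}))"
  by (rule heis[unfolded heisenberg_basis_def, THEN conjunct2, THEN conjunct2, THEN conjunct1])
lemma span_n: "span (insert Z (X ` {1..2*p})) = n"
  by (rule heis[unfolded heisenberg_basis_def, THEN conjunct2, THEN conjunct2, THEN conjunct2, THEN conjunct1])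
lemma bracket_X: "i \<in> {1..p} \<Longrightarrow> br (X i) (X (p + i)) = Z"
  by (rule heis[unfolded heisenberg_basis_def, THEN conjunct2, THEN conjunct2, THEN conjunct2, THEN conjunct2,
      THEN conjunct1, rule_format])
lemma bracket_X_0: "i \<in> {1..2*p} \<Longrightarrow> j \<in> {1..2*p} \<Longrightarrow> \<bar>int i - int j\<bar> \<noteq> int p \<Longrightarrow> br (X i) (X j) = 0"
  by (rule heis[unfolded heisenberg_basis_def, THEN conjunct2, THEN conjunct2, THEN conjunct2, THEN conjunct2,
      THEN conjunct2, THEN conjunct1, rule_format])
lemma centre: "lie_centre br n = span {Z}"
  by (rule heis[unfolded heisenberg_basis_def, THEN conjunct2, THEN conjunct2, THEN conjunct2, THEN conjunct2,
      THEN conjunct2, THEN conjunct2])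
lemma ind_X: "independent (X ` {1..2*p})" using ind by (rule independent_mono) blast
lemma sub_v: "subspace v" by (simp add: v_def)
lemma v_n: "v \<subseteq> n" unfolding v_def span_n[symmetric] by (rule span_mono) blast
lemma Z_n: "Z \<in> n" unfolding span_n[symmetric] by (rule span_base) simp
lemma Z0: "Z \<noteq> 0"
proof
  assume "Z = 0"
  then have "0 \<in> insert Z (X ` {1..2*p})" by simp
  then have "dependent (insert Z (X ` {1..2*p}))" by (rule dependent_zero)
  then show False using ind by contradiction
qed
lemma ZZ: "Z \<bullet> Z \<noteq> 0" using Z0 by simp

lemma bracket_n: "br x y \<in> n"
proof -
  have "bracket_span br UNIV UNIV \<subseteq> n"
    using derived_algebra_nilpotent[OF lie solv] nil by (simp add: is_nilradical_def)
  moreover have "br x y \<in> bracket_span br UNIV UNIV" by (rule bracket_in_span) auto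
  ultimately show ?thesis by blast
qed

lemma Z_central: "x \<in> n \<Longrightarrow> br Z x = 0" "x \<in> n \<Longrightarrow> br x Z = 0"
proof -
  have "Z \<in> lie_centre br n" unfolding centre by (rule span_base) simp
  then show 1: "x \<in> n \<Longrightarrow> br Z x = 0" by (simp add: lie_centre_def)
  show "x \<in> n \<Longrightarrow> br x Z = 0" using 1 anti[of x Z] by simp
qed

lemma bracket_Z: "br A Z = lam A *\<^sub>R Z"
  unfolding lam_def by (rule lambda_coeff_bracket[OF lie ideal heis])

lemma bracket_nn:
  assumes "x \<in> n" "y \<in> n"
  shows "br x y \<in> span {Z}"
proof -
  let ?S = "insert Z (X ` {1..2*p})"
  have base: "br a b \<in> span {Z}" if a: "a \<in> ?S" and b: "b \<in> ?S" for a b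
  proof (cases "a = Z \<or> b = Z")
    case True
    have "a \<in> n" "b \<in> n" unfolding span_n[symmetric] by (rule span_base[OF a], rule span_base[OF b])
    then have "br a b = 0" using True by (auto simp: Z_central)
    then show ?thesis by (simp add: span_zero)
  next
    case False
    then have "a \<in> X ` {1..2*p}" "b \<in> X ` {1..2*p}" using a b by simp_all
    then obtain i j where ij: "i \<in> {1..2*p}" "j \<in> {1..2*p}" "a = X i" "b = X j" by (elim imageE)
    note r = bracket_X and z = bracket_X_0
    consider "\<bar>int i - int j\<bar> \<noteq> int p" | "j = p + i" | "i = p + j" by linarith
    then show ?thesis
    proof cases
      case 1 then show ?thesis using z[OF ij(1,2)] ij by (simp add: span_zero)
    next
      case 2
      then have "i \<in> {1..p}" using ij(1,2) by auto
      then show ?thesis using r[of i] 2 ij by (simp add: span_base)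
    next
      case 3
      then have "j \<in> {1..p}" using ij(1,2) by auto
      then have "br a b = - Z" using r[of j] 3 ij anti[of a b] by simp
      then show ?thesis by (simp add: span_neg span_base)
    qed
  qed
  have 1: "br a y \<in> span {Z}" if a: "a \<in> ?S" for a
  proof -
    have "y \<in> span ?S" using assms(2) span_n by simp
    moreover have "subspace {y. br a y \<in> span {Z}}"
      by (auto simp: subspace_def bilinear_rzero[OF bil] bilinear_radd[OF bil] bilinear_rmul[OF bil]
          span_zero span_add span_scale)
    ultimately show ?thesis
      by (rule span_induct[of y ?S "\<lambda>y. br a y \<in> span {Z}"]) (rule base[OF a])
  qed
  have "x \<in> span ?S" using assms(1) span_n by simp
  moreover have "subspace {x. br x y \<in> span {Z}}"
    by (auto simp: subspace_def bilinear_lzero[OF bil] bilinear_ladd[OF bil] bilinear_lmul[OF bil]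
        span_zero span_add span_scale)
  ultimately show ?thesis by (rule span_induct[of x ?S "\<lambda>x. br x y \<in> span {Z}"]) (rule 1)
qed

lemma bracket_omega: "x \<in> n \<Longrightarrow> y \<in> n \<Longrightarrow> br x y = \<omega> x y *\<^sub>R Z"
proof -
  assume "x \<in> n" "y \<in> n"
  then obtain c where c: "br x y = c *\<^sub>R Z" using bracket_nn by (auto simp: span_singleton)
  then show ?thesis using ZZ by (simp add: \<omega>_def)
qed

lemma omega_anti: "\<omega> x y = - \<omega> y x"
  unfolding \<omega>_def by (subst anti) simp

lemma omega_linear: "linear (\<lambda>x. \<omega> x y)" "linear (\<omega> x)"
  by (intro linearI; simp add: \<omega>_def bilinear_ladd[OF bil] bilinear_radd[OF bil] bilinear_lmul[OF bil]
      bilinear_rmul[OF bil] inner_add_left add_divide_distrib)+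

lemma omega_Z: "x \<in> n \<Longrightarrow> \<omega> x Z = 0" "x \<in> n \<Longrightarrow> \<omega> Z x = 0"
  by (simp_all add: \<omega>_def Z_central)

lemma lam_linear: "linear lam"
proof (rule linearI)
  fix x y
  have "lam (x + y) *\<^sub>R Z = (lam x + lam y) *\<^sub>R Z"
    by (simp only: bracket_Z[symmetric] bilinear_ladd[OF bil] scaleR_add_left)
  then show "lam (x + y) = lam x + lam y" using Z0 by simp
next
  fix c x
  have "lam (c *\<^sub>R x) *\<^sub>R Z = (c * lam x) *\<^sub>R Z"
    by (simp only: bracket_Z[symmetric] bilinear_lmul[OF bil] scaleR_scaleR[symmetric])
  then show "lam (c *\<^sub>R x) = c *\<^sub>R lam x" using Z0 by simp
qed

lemma lam_n: "x \<in> n \<Longrightarrow> lam x = 0"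
  using bracket_Z[of x] Z_central(2)[of x] Z0 by simp

lemma pr: "linear pr" "pr Z = 0" "x \<in> v \<Longrightarrow> pr x = x"
proof -
  obtain P where P0: "linear P \<and> (\<forall>x\<in>insert Z (X ` {1..2*p}). P x = (if x = Z then 0 else x))"
    using linear_independent_extend[OF ind, of "\<lambda>x. if x = Z then 0 else x"] by (rule exE)
  have P: "linear P" "\<And>x. x \<in> insert Z (X ` {1..2*p}) \<Longrightarrow> P x = (if x = Z then 0 else x)"
    by (rule P0[THEN conjunct1], rule P0[THEN conjunct2, rule_format])
  have "P x = id x" if "x \<in> v" for x
  proof (rule linear_eq_on[OF P(1) linear_id that[unfolded v_def]])
    fix b assume b: "b \<in> X ` {1..2*p}"
    then have "b \<noteq> Z" using ZX by metis
    then show "P b = id b" using P(2)[of b] b by simp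
  qed
  then have "linear P \<and> P Z = 0 \<and> (\<forall>x\<in>v. P x = x)" using P(1) P(2)[of Z] by simp
  then have "linear pr \<and> pr Z = 0 \<and> (\<forall>x\<in>v. pr x = x)"
    unfolding pr_def by (rule someI[of "\<lambda>P. linear P \<and> P Z = 0 \<and> (\<forall>x\<in>v. P x = x)"])
  then show "linear pr" "pr Z = 0" "x \<in> v \<Longrightarrow> pr x = x" by blast+
qed

lemma n_decomp:
  assumes "y \<in> n"
  shows "pr y \<in> v" "\<exists>c. y = pr y + c *\<^sub>R Z"
proof -
  obtain k where k: "y - k *\<^sub>R Z \<in> v"
    using assms unfolding span_n[symmetric] span_breakdown_eq v_def by blast
  have "pr (y - k *\<^sub>R Z) = pr y" by (simp add: linear_diff[OF pr(1)] linear_cmul[OF pr(1)] pr(2))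
  then have e: "pr y = y - k *\<^sub>R Z" using pr(3)[OF k] by simp
  then show "pr y \<in> v" "\<exists>c. y = pr y + c *\<^sub>R Z" using k by auto
qed

lemma pr_bracket_pr: "y \<in> n \<Longrightarrow> pr (br A (pr y)) = pr (br A y)"
proof -
  assume y: "y \<in> n"
  obtain c where c: "y = pr y + c *\<^sub>R Z" using n_decomp(2)[OF y] by blast
  have "pr (br A y) = pr (br A (pr y + c *\<^sub>R Z))" by (rule arg_cong[OF c])
  also have "\<dots> = pr (br A (pr y))"
    by (simp only: bilinear_radd[OF bil] bilinear_rmul[OF bil] bracket_Z linear_add[OF pr(1)] linear_cmul[OF pr(1)]
        pr(2) scaleR_zero_right add_0_right)
  finally show ?thesis by (rule sym)
qed

lemma omega_pr: "x \<in> n \<Longrightarrow> y \<in> n \<Longrightarrow> \<omega> (pr x) y = \<omega> x y" "x \<in> n \<Longrightarrow> y \<in> n \<Longrightarrow> \<omega> y (pr x) = \<omega> y x"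
proof -
  assume xy: "x \<in> n" "y \<in> n"
  obtain c where c: "x = pr x + c *\<^sub>R Z" using n_decomp(2)[OF xy(1)] by blast
  have "\<omega> x y = \<omega> (pr x + c *\<^sub>R Z) y" by (rule arg_cong[OF c, of "\<lambda>x. \<omega> x y"])
  also have "\<dots> = \<omega> (pr x) y"
    using linear_add[OF omega_linear(1)] linear_cmul[OF omega_linear(1)] omega_Z(2)[OF xy(2)] by simp
  finally show 1: "\<omega> (pr x) y = \<omega> x y" by (rule sym)
  show "\<omega> y (pr x) = \<omega> y x" using 1 omega_anti[of y x] omega_anti[of y "pr x"] by simp
qed

lemma Phi_linear: "linear (\<Phi> A)"
  by (intro linearI) (simp_all add: \<Phi>_def bilinear_radd[OF bil] bilinear_rmul[OF bil] linear_add[OF pr(1)] linear_cmul[OF pr(1)])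

lemma Phi_v: "\<Phi> A x \<in> v" unfolding \<Phi>_def by (rule n_decomp(1)[OF bracket_n])

text \<open>
  The bracket of two elements lies in the nilradical, whose elements act trivially on the quotient by the centre.
\<close>

lemma Phi_comm: "x \<in> v \<Longrightarrow> \<Phi> A (\<Phi> B x) = \<Phi> B (\<Phi> A x)"
proof -
  assume x: "x \<in> v"
  have e: "\<Phi> A (\<Phi> B x) = pr (br A (br B x))" for A B
    unfolding \<Phi>_def by (rule pr_bracket_pr[OF bracket_n])
  have "br (br A B) x \<in> span {Z}" by (rule bracket_nn[OF bracket_n]) (use x v_n in blast)
  then obtain c where "br (br A B) x = c *\<^sub>R Z" by (auto simp: span_singleton)
  then have "pr (br (br A B) x) = 0" by (simp add: linear_cmul[OF pr(1)] pr(2))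
  then show ?thesis unfolding e lie_bracket_jacobi[OF lie, of A B x] by (simp add: linear_add[OF pr(1)])
qed

text \<open>
  The derivation property of \<open>ad A\<close> on \<open>[x, y] = \<omega> x y Z\<close>.
\<close>

lemma omega_Phi: 
  assumes "x \<in> v" "y \<in> v"
  shows "\<omega> (\<Phi> A x) y = \<omega> x (lam A *\<^sub>R y - \<Phi> A y)"
proof -
  have n: "x \<in> n" "y \<in> n" using assms v_n by auto
  have "br A (br x y) = br (br A x) y + br x (br A y)" by (rule lie_bracket_jacobi[OF lie])
  moreover have "br A (br x y) = (lam A * \<omega> x y) *\<^sub>R Z"
    by (simp add: bracket_omega[OF n] bilinear_rmul[OF bil] bracket_Z)
  moreover have "br (br A x) y = \<omega> (\<Phi> A x) y *\<^sub>R Z"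
    unfolding \<Phi>_def omega_pr(1)[OF bracket_n n(2)] by (rule bracket_omega[OF bracket_n n(2)])
  moreover have "br x (br A y) = \<omega> x (\<Phi> A y) *\<^sub>R Z"
    unfolding \<Phi>_def omega_pr(2)[OF bracket_n n(1)] by (rule bracket_omega[OF n(1) bracket_n])
  ultimately have "(lam A * \<omega> x y) *\<^sub>R Z = (\<omega> (\<Phi> A x) y + \<omega> x (\<Phi> A y)) *\<^sub>R Z"
    by (simp add: scaleR_add_left)
  then have "lam A * \<omega> x y = \<omega> (\<Phi> A x) y + \<omega> x (\<Phi> A y)" using Z0 by simp
  then show ?thesis by (simp add: linear_diff[OF omega_linear(2)] linear_cmul[OF omega_linear(2)])
qed

lemma omega_nondegenerate:
  assumes "x \<in> v" "\<And>y. y \<in> v \<Longrightarrow> \<omega> x y = 0"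
  shows "x = 0"
proof -
  have xn: "x \<in> n" using assms(1) v_n by blast
  have "br x y = 0" if y: "y \<in> n" for y
    using assms(2)[OF n_decomp(1)[OF y]] omega_pr(2)[OF y xn] bracket_omega[OF xn y] by simp
  then have "x \<in> lie_centre br n" using xn by (simp add: lie_centre_def)
  then obtain c where "x = c *\<^sub>R Z" unfolding centre by (auto simp: span_singleton)
  then have "pr x = 0" by (simp add: linear_cmul[OF pr(1)] pr(2))
  then show ?thesis using pr(3)[OF assms(1)] by simp
qed

lemma X_frame: "vector_frame (\<lambda>i. X (Suc i)) (2 * p) v"
proof (rule vector_frame_of_bij[OF _ ind_X])
  show "bij_betw (\<lambda>i. X (Suc i)) {..<2 * p} (X ` {1..2*p})"
  proof -
    have "bij_betw Suc {..<2 * p} {1..2 * p}"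
      by (rule bij_betw_byWitness[of _ "\<lambda>i. i - 1"]) auto
    then have "bij_betw (X \<circ> Suc) {..<2 * p} (X ` {1..2*p})"
      by (rule bij_betw_trans) (rule inj_on_imp_bij_betw[OF inj])
    then show ?thesis by (simp only: o_def)
  qed
qed (simp add: v_def)

lemma Phi_matrix_represents: "represents (\<Phi> Y) (\<lambda>i. X (Suc i)) (2 * p) (Phi_matrix br p X Z Y)"
  unfolding represents_def
proof (intro conjI allI impI)
  show "Phi_matrix br p X Z Y \<in> carrier_mat (2 * p) (2 * p)" by (simp add: Phi_matrix_def)
  fix j assume j: "j < 2 * p"
  let ?s = "\<Sum>i<2*p. Phi_matrix br p X Z Y $$ (i, j) *\<^sub>R X (Suc i)"
  have "br Y (X (Suc j)) - ?s \<in> span {Z}" using Phi_matrix_column[OF ideal heis j, of Y] unfolding centre .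
  then obtain c where "br Y (X (Suc j)) - ?s = c *\<^sub>R Z" by (auto simp: span_singleton)
  then have "br Y (X (Suc j)) = ?s + c *\<^sub>R Z" by (simp add: algebra_simps)
  then have "\<Phi> Y (X (Suc j)) = pr ?s" by (simp add: \<Phi>_def linear_add[OF pr(1)] linear_cmul[OF pr(1)] pr(2))
  also have "\<dots> = ?s"
  proof (rule pr(3))
    show "?s \<in> v" unfolding v_def by (intro span_sum span_scale span_base) auto
  qed
  finally show "\<Phi> Y (X (Suc j)) = ?s" .
qed

lemma negative_eigenvalue_sum:
  assumes "finite B" "independent B" "span B = re_space {..0} (\<Phi> Y) v"
    and "\<And>b. b \<in> B \<Longrightarrow> \<Phi> Y b = (\<Sum>b'\<in>B. c b b' *\<^sub>R b')"
  shows "(\<Sum>d\<in>#filter_mset (\<lambda>d. Re d < 0) (complex_eigenvalues (Phi_matrix br p X Z Y)). Re d) = (\<Sum>b\<in>B. c b b)"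
  by (rule negative_real_parts_sum[OF Phi_linear sub_v Phi_v X_frame Phi_matrix_represents assms])

lemma re_space_Phi_invariant:
  assumes x: "x \<in> re_space S (\<Phi> Y) v"
  shows "\<Phi> A x \<in> re_space S (\<Phi> Y) v"
proof (rule re_space_invariant[where T = "\<Phi> Y" and V = v and S = "\<Phi> A", OF Phi_linear sub_v _ _ _ x])
  show "\<Phi> A (\<Phi> Y x) = \<Phi> Y (\<Phi> A x)" if "x \<in> v" for x by (rule Phi_comm[OF that])
qed (rule Phi_v)+

lemma sub_re: "subspace (re_space S (\<Phi> Y) v)" by (rule subspace_re_space[OF Phi_linear sub_v])

text \<open>
  The adjoint of \<open>\<Phi> Y\<close> with respect to \<open>\<omega>\<close> is \<open>\<lambda>(Y) - \<Phi> Y\<close>, so an operator product that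
  annihilates \<open>x\<close> transfers to \<open>y\<close> with each real part \<open>a\<close> replaced by \<open>\<lambda>(Y) - a\<close>. On the space of \<open>y\<close> that product is
  invertible, so every \<open>y\<close> lies in its image.
\<close>

lemma omega_re_spaces:
  assumes S: "\<And>a b. a \<in> S \<Longrightarrow> b \<in> R \<Longrightarrow> a + b \<noteq> lam Y"
    and x: "x \<in> re_space S (\<Phi> Y) v" and y: "y \<in> re_space R (\<Phi> Y) v"
  shows "\<omega> x y = 0"
proof -
  let ?T = "\<Phi> Y" and ?R = "re_space R (\<Phi> Y) v"
  obtain L where L: "x \<in> v" "fst ` set L \<subseteq> S" "quad_prod L ?T x = 0"
    using x unfolding re_space_def by blast
  define L' where "L' = map (\<lambda>ab. (lam Y - fst ab, snd ab)) L"
  have Rv: "?R \<subseteq> v" by (rule re_space_subset)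
  have TR: "?T w \<in> ?R" if "w \<in> ?R" for w by (rule re_space_Phi_invariant[OF that])
  have adj1: "\<omega> (quad_op a b ?T u) w = \<omega> u (quad_op (lam Y - a) b ?T w)" if "u \<in> v" "w \<in> v" for a b u w
  proof -
    let ?S = "\<lambda>w. lam Y *\<^sub>R w - ?T w"
    have Sv: "?S w \<in> v" by (intro subspace_diff[OF sub_v] subspace_scale[OF sub_v] Phi_v that)
    have "\<omega> (?T (?T u)) w = \<omega> u (?S (?S w))"
      using omega_Phi[OF Phi_v that(2)] omega_Phi[OF that(1) Sv] by simp
    then have "\<omega> (quad_op a b ?T u) w = \<omega> u (?S (?S w) - (2 * a) *\<^sub>R ?S w + (a\<^sup>2 + b\<^sup>2) *\<^sub>R w)"
      using omega_Phi[OF that]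
      by (simp add: quad_op_def linear_add[OF omega_linear(1)] linear_diff[OF omega_linear(1)] linear_cmul[OF omega_linear(1)]
          linear_add[OF omega_linear(2)] linear_diff[OF omega_linear(2)] linear_cmul[OF omega_linear(2)])
    also have "?S (?S w) - (2 * a) *\<^sub>R ?S w + (a\<^sup>2 + b\<^sup>2) *\<^sub>R w = quad_op (lam Y - a) b ?T w"
      unfolding quad_op_def
      by (simp add: linear_diff[OF Phi_linear] linear_cmul[OF Phi_linear] power2_eq_square algebra_simps scaleR_double)
    finally show ?thesis .
  qed
  have adj: "\<omega> (quad_prod M ?T u) w = \<omega> u (quad_prod (map (\<lambda>ab. (lam Y - fst ab, snd ab)) M) ?T w)"
    if "u \<in> v" "w \<in> v" for M u w
    using that(2)
  proof (induction M arbitrary: w)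
    case (Cons ab M)
    let ?M = "map (\<lambda>ab. (lam Y - fst ab, snd ab)) M"
    let ?q = "quad_op (lam Y - fst ab) (snd ab) ?T"
    have q: "?q w \<in> v" by (rule quad_op_in_subspace[OF sub_v Phi_v Cons.prems])
    have "\<omega> (quad_prod (ab # M) ?T u) w = \<omega> (quad_prod M ?T u) (?q w)"
      using adj1[OF quad_prod_in_subspace[OF sub_v Phi_v that(1)] Cons.prems] by simp
    also have "\<dots> = \<omega> u (quad_prod ?M ?T (?q w))" by (rule Cons.IH[OF q])
    also have "quad_prod ?M ?T (?q w) = ?q (quad_prod ?M ?T w)"
      using quad_prod_swap[OF Phi_linear, where L = ?M and M = "[(lam Y - fst ab, snd ab)]" and x = w] by simp
    finally show ?case by simp
  qed simp
  have linL: "linear (quad_prod L' ?T)" by (rule linear_quad_prod[OF Phi_linear])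
  have kerz: "w = 0" if w: "w \<in> ?R" "quad_prod L' ?T w = 0" for w
  proof -
    obtain M where M: "fst ` set M \<subseteq> R" "quad_prod M ?T w = 0" using w(1) unfolding re_space_def by blast
    have "fst ` set L' \<inter> fst ` set M = {}"
    proof (rule ccontr)
      assume "fst ` set L' \<inter> fst ` set M \<noteq> {}"
      then obtain r where r: "r \<in> fst ` set L'" "r \<in> fst ` set M" by blast
      have "fst ` set L' = (\<lambda>a. lam Y - a) ` (fst ` set L)" by (simp add: L'_def image_image)
      then have "r \<in> (\<lambda>a. lam Y - a) ` (fst ` set L)" using r(1) by (simp only:)
      then obtain a where "r = lam Y - a" "a \<in> fst ` set L" by (rule imageE)
      then show False using S[of a r] L(2) M(1) r(2) by auto
    qed
    then show ?thesis by (rule quad_prod_kernels_disjoint[OF Phi_linear _ w(2) M(2)])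
  qed
  have "quad_prod L' ?T ` ?R = ?R"
  proof (rule subspace_dim_equal)
    show "subspace (quad_prod L' ?T ` ?R)" by (rule linear_subspace_image[OF linL sub_re])
    show "quad_prod L' ?T ` ?R \<subseteq> ?R" by (auto intro: quad_prod_in_subspace[OF sub_re TR])
    have "{w \<in> ?R. quad_prod L' ?T w = 0} \<subseteq> {0}" using kerz by blast
    then have d0: "dim {w \<in> ?R. quad_prod L' ?T w = 0} = 0" by (simp only: dim_eq_0)
    show "dim ?R \<le> dim (quad_prod L' ?T ` ?R)" using dim_kernel_image[OF linL sub_re, of R Y] d0 by linarith
  qed (rule sub_re)
  then obtain y' where y': "y' \<in> ?R" "y = quad_prod L' ?T y'" using y by blast
  have "\<omega> x y = \<omega> (quad_prod L ?T x) y'"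
    unfolding y'(2) L'_def by (rule adj[OF L(1), symmetric]) (use y'(1) Rv in blast)
  then show ?thesis unfolding L(3) by (simp add: linear_0[OF omega_linear(1)])
qed

section \<open>Necessity\<close>

text \<open>
  The witness is the mean curvature vector \<open>H\<close>. Applied to the centre, \<open>abelian_ideal_trace_pos\<close> gives
  \<open>\<lambda>(H) > 0\<close>. Then two nonpositive real parts cannot sum to \<open>\<lambda>(H)\<close>, so the preimage \<open>W\<close> in the nilradical
  of the nonpositive part of \<open>\<Phi> H\<close> is an abelian ideal, and a second application to \<open>W\<close> gives the inequality.
\<close>

lemma necessity:
  assumes ip: "inner_product ip" and neg: "negative_ricci br ip"
  shows "\<exists>Y. lambda_coeff br Z Y +
       (\<Sum>d\<in>#filter_mset (\<lambda>d. Re d < 0) (complex_eigenvalues (Phi_matrix br p X Z Y)). Re d) > 0"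
proof -
  let ?H = "mean_curvature_vector br ip"
  have bip: "bilinear ip" and pos: "\<And>x. x \<noteq> 0 \<Longrightarrow> ip x x > 0" using ip by (auto simp: inner_product_def)
  define u where "u = (1 / sqrt (ip Z Z)) *\<^sub>R Z"
  have ZZp: "ip Z Z > 0" by (rule pos[OF Z0])
  have uu: "ip u u = 1" using ZZp by (simp add: u_def bilinear_lmul[OF bip] bilinear_rmul[OF bip])
  have onu: "orthonormal_set ip {u}" using uu by (simp add: orthonormal_set_def)
  have spu: "span {u} = span {Z}"
  proof
    show "span {u} \<subseteq> span {Z}" by (rule span_minimal) (auto simp: u_def intro: span_scale span_base)
    have "Z = sqrt (ip Z Z) *\<^sub>R u" using ZZp by (simp add: u_def)
    also have "\<dots> \<in> span {u}" by (intro span_scale span_base) simp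
    finally show "span {Z} \<subseteq> span {u}" by (intro span_minimal) auto
  qed
  have bu: "br ?H u = lam ?H *\<^sub>R u" by (simp add: u_def bilinear_rmul[OF bil] bracket_Z mult.commute)
  have lamH: "lam ?H > 0"
  proof -
    have "(\<Sum>w\<in>{u}. ip (br ?H w) w) > 0"
    proof (rule abelian_ideal_trace_pos[OF lie ip neg, of "span {Z}"])
      show "lie_ideal br (span {Z})"
        unfolding lie_ideal_def
        by (intro conjI subspace_span) (auto simp: span_singleton bilinear_rmul[OF bil] bracket_Z)
      show "br a b = 0" if "a \<in> span {Z}" "b \<in> span {Z}" for a b
        using that Z_central(1)[OF Z_n] by (auto simp: span_singleton bilinear_rmul[OF bil] bilinear_lmul[OF bil])
      show "span {Z} \<noteq> {0}" using Z0 span_base[of Z "{Z}"] by auto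
    qed (fact onu spu)+
    then show ?thesis using uu by (simp add: bu bilinear_lmul[OF bip])
  qed
  let ?P = "re_space {..0} (\<Phi> ?H) v"
  define W where "W = {x \<in> n. pr x \<in> ?P}"
  have subW: "subspace W"
    using sub_n sub_re unfolding W_def
    by (auto simp: subspace_def linear_0[OF pr(1)] linear_add[OF pr(1)] linear_cmul[OF pr(1)])
  have idW: "lie_ideal br W"
    unfolding lie_ideal_def
  proof (intro conjI allI ballI subW)
    fix A x assume x: "x \<in> W"
    then have "pr (br A x) = \<Phi> A (pr x)" using pr_bracket_pr[of x A] by (simp add: W_def \<Phi>_def)
    then show "br A x \<in> W" using x bracket_n re_space_Phi_invariant[of "pr x" "{..0}" ?H A] by (simp add: W_def)
  qed
  have abW: "br x y = 0" if "x \<in> W" "y \<in> W" for x y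
  proof -
    have xy: "x \<in> n" "y \<in> n" "pr x \<in> ?P" "pr y \<in> ?P" using that by (auto simp: W_def)
    have "\<omega> (pr x) (pr y) = 0" by (rule omega_re_spaces[OF _ xy(3,4)]) (use lamH in auto)
    moreover have "pr y \<in> n" using n_decomp(1)[OF xy(2)] v_n by blast
    ultimately have "\<omega> x y = 0" using omega_pr(1)[OF xy(1)] omega_pr(2)[OF xy(2,1)] by simp
    then show ?thesis using bracket_omega[OF xy(1,2)] by simp
  qed
  have uW: "u \<in> W"
    using Z_n sub_n subspace_0[OF sub_re] unfolding W_def u_def
    by (simp add: linear_cmul[OF pr(1)] pr(2) subspace_scale)
  obtain F where F: "{u} \<subseteq> F" "F \<subseteq> W" "orthonormal_set ip F" "span F = W"
    using orthonormal_extension[OF ip subW onu] uW by auto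
  have finF: "finite F" using F(3) by (simp add: orthonormal_set_def)
  have u0: "u \<noteq> 0" using uu by (auto simp: bilinear_lzero[OF bip])
  have "W \<noteq> {0}" using uW u0 by blast
  then have tr: "(\<Sum>w\<in>F. ip (br ?H w) w) > 0"
    by (intro abelian_ideal_trace_pos[OF lie ip neg idW abW _ F(3,4)])
  define G where "G = F - {u}"
  have G: "F = insert u G" "u \<notin> G" "finite G" using F(1) finF by (auto simp: G_def)
  have pru: "pr u = 0" by (simp add: u_def linear_cmul[OF pr(1)] pr(2))
  have expand: "y = (\<Sum>f\<in>F. ip y f *\<^sub>R f)" if "y \<in> W" for y
  proof -
    have "y \<in> span F" using that F(4) by simp
    then obtain c where c: "y = (\<Sum>f\<in>F. c f *\<^sub>R f)" using span_finite[OF finF] by auto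
    have "ip y f = c f" if "f \<in> F" for f unfolding c by (rule orthonormal_set_coeff[OF bip F(3) that])
    then show ?thesis by (intro trans[OF c] sum.cong) auto
  qed
  have prexp: "pr y = (\<Sum>g\<in>G. ip y g *\<^sub>R pr g)" if "y \<in> W" for y
  proof -
    have "pr y = pr (\<Sum>f\<in>F. ip y f *\<^sub>R f)" by (rule arg_cong[OF expand[OF that]])
    also have "\<dots> = (\<Sum>f\<in>F. ip y f *\<^sub>R pr f)" by (simp only: linear_sum[OF pr(1)] linear_cmul[OF pr(1)])
    also have "\<dots> = (\<Sum>g\<in>G. ip y g *\<^sub>R pr g)" using G(2,3) by (simp add: G(1) pru)
    finally show ?thesis .
  qed
  have indF: "independent F" by (rule orthonormal_set_independent[OF bip F(3)])
  have indG: "c g = 0" if s: "(\<Sum>g\<in>G. c g *\<^sub>R pr g) = 0" and g: "g \<in> G" for c g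
  proof -
    have "pr (\<Sum>g\<in>G. c g *\<^sub>R g) = 0" using s by (simp add: linear_sum[OF pr(1)] linear_cmul[OF pr(1)])
    moreover have "(\<Sum>g\<in>G. c g *\<^sub>R g) \<in> n"
      using F(2) G(1) by (intro subspace_sum[OF sub_n] subspace_scale[OF sub_n]) (auto simp: W_def)
    ultimately obtain k where "(\<Sum>g\<in>G. c g *\<^sub>R g) = k *\<^sub>R Z" using n_decomp(2) by fastforce
    then have "(\<Sum>g\<in>G. c g *\<^sub>R g) \<in> span {u}" unfolding spu by (simp add: span_scale span_base)
    then obtain m where m: "(\<Sum>g\<in>G. c g *\<^sub>R g) = m *\<^sub>R u" by (auto simp: span_singleton)
    define c' where "c' f = (if f = u then - m else c f)" for f
    have "(\<Sum>f\<in>F. c' f *\<^sub>R f) = - m *\<^sub>R u + (\<Sum>g\<in>G. c' g *\<^sub>R g)"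
      using G(2,3) by (simp add: G(1) c'_def)
    also have "(\<Sum>g\<in>G. c' g *\<^sub>R g) = (\<Sum>g\<in>G. c g *\<^sub>R g)"
      using G(2) by (intro sum.cong) (auto simp: c'_def)
    finally have "(\<Sum>f\<in>F. c' f *\<^sub>R f) = 0" using m by simp
    then have "c' g = 0"
      using real_vector.independentD[OF indF finF subset_refl, of c' g] g G(1) by auto
    moreover have "g \<noteq> u" using g G(2) by blast
    ultimately show ?thesis by (simp add: c'_def)
  qed
  have injG: "inj_on pr G"
  proof (rule inj_onI, rule ccontr)
    fix a b assume ab: "a \<in> G" "b \<in> G" "pr a = pr b" "a \<noteq> b"
    have "(\<Sum>g\<in>G. (if g = a then 1 else if g = b then -1 else 0) *\<^sub>R pr g)
        = (\<Sum>g\<in>{a, b}. (if g = a then 1 else if g = b then -1 else (0::real)) *\<^sub>R pr g)"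
      using ab G(3) by (intro sum.mono_neutral_right) auto
    also have "\<dots> = 0" using ab by simp
    finally show False using indG[of "\<lambda>g. if g = a then 1 else if g = b then -1 else 0" a] ab by auto
  qed
  define c where "c b b' = ip (br ?H (the_inv_into G pr b)) (the_inv_into G pr b')" for b b'
  have inv: "the_inv_into G pr (pr g) = g" if "g \<in> G" for g by (rule the_inv_into_f_f[OF injG that])
  have GW: "g \<in> W" if "g \<in> G" for g using that F(2) G(1) by auto
  have "(\<Sum>d\<in>#filter_mset (\<lambda>d. Re d < 0) (complex_eigenvalues (Phi_matrix br p X Z ?H)). Re d) = (\<Sum>b\<in>pr ` G. c b b)"
  proof (rule negative_eigenvalue_sum[where c = c and B = "pr ` G"])
    show "finite (pr ` G)" using G(3) by simp
    show "independent (pr ` G)"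
    proof (rule real_vector.independent_if_scalars_zero)
      fix f b assume "(\<Sum>x\<in>pr ` G. f x *\<^sub>R x) = 0" and b: "b \<in> pr ` G"
      then have "(\<Sum>g\<in>G. f (pr g) *\<^sub>R pr g) = 0" by (simp add: sum.reindex[OF injG])
      then show "f b = 0" using indG[of "\<lambda>g. f (pr g)"] b by auto
    qed (use G(3) in simp)
    show "span (pr ` G) = ?P"
    proof
      show "span (pr ` G) \<subseteq> ?P" using GW by (intro span_minimal sub_re) (auto simp: W_def)
      show "?P \<subseteq> span (pr ` G)"
      proof
        fix x assume x: "x \<in> ?P"
        then have xv: "x \<in> v" using re_space_subset by blast
        then have "x \<in> W" using x v_n pr(3)[OF xv] by (auto simp: W_def)
        then have "pr x \<in> span (pr ` G)"
          using prexp[of x] by (simp add: span_sum span_scale span_base)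
        then show "x \<in> span (pr ` G)" using pr(3)[OF xv] by simp
      qed
    qed
    fix b assume "b \<in> pr ` G"
    then obtain g where g: "g \<in> G" "b = pr g" by blast
    have "\<Phi> ?H b = pr (br ?H g)" unfolding g(2) \<Phi>_def
      by (rule pr_bracket_pr) (use GW[OF g(1)] in \<open>simp add: W_def\<close>)
    also have "\<dots> = (\<Sum>h\<in>G. ip (br ?H g) h *\<^sub>R pr h)"
      by (rule prexp) (use idW GW[OF g(1)] in \<open>simp add: lie_ideal_def\<close>)
    also have "\<dots> = (\<Sum>h\<in>G. c b (pr h) *\<^sub>R pr h)"
      by (intro sum.cong refl) (simp add: c_def g inv)
    also have "\<dots> = (\<Sum>b'\<in>pr ` G. c b b' *\<^sub>R b')" by (simp add: sum.reindex[OF injG])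
    finally show "\<Phi> ?H b = (\<Sum>b'\<in>pr ` G. c b b' *\<^sub>R b')" .
  qed
  also have "\<dots> = (\<Sum>g\<in>G. ip (br ?H g) g)"
    by (simp add: sum.reindex[OF injG] c_def inv cong: sum.cong)
  finally have "lam ?H + (\<Sum>d\<in>#filter_mset (\<lambda>d. Re d < 0) (complex_eigenvalues (Phi_matrix br p X Z ?H)). Re d)
      = (\<Sum>w\<in>F. ip (br ?H w) w)"
    using G(2,3) uu by (simp add: G(1) bu bilinear_lmul[OF bip])
  then show ?thesis using tr unfolding lam_def by (intro exI[of _ ?H]) simp
qed

end

section \<open>A frame adapted to an element with positive rate\<close>

lemma representation_of_sum:
  fixes B :: "'a::euclidean_space set"
  assumes B: "independent B" "span B = UNIV" and S: "S \<subseteq> B" and k: "k \<in> B"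
  shows "representation B (\<Sum>b\<in>S. c b *\<^sub>R b) k = (if k \<in> S then c k else 0)"
proof -
  note R = representation_UNIV[OF B]
  have fin: "finite S" using independent_imp_finite[OF B(1)] S by (rule finite_subset[rotated])
  have l: "linear (\<lambda>x. representation B x k)" by (intro linearI) (simp_all add: R)
  have "representation B (\<Sum>b\<in>S. c b *\<^sub>R b) k = (\<Sum>b\<in>S. representation B (c b *\<^sub>R b) k)"
    by (rule linear_sum[OF l])
  also have "\<dots> = (\<Sum>b\<in>S. if b = k then c k else 0)"
  proof (intro sum.cong refl)
    fix b assume "b \<in> S"
    then have "b \<in> B" using S by blast
    then show "representation B (c b *\<^sub>R b) k = (if b = k then c k else 0)"
      by (simp add: R(2) real_vector.representation_basis[OF B(1)])
  qed
  also have "\<dots> = (if k \<in> S then c k else 0)" using fin by (simp add: sum.delta)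
  finally show ?thesis .
qed

lemma representation_outside:
  fixes B :: "'a::euclidean_space set"
  assumes B: "independent B" "span B = UNIV" and S: "S \<subseteq> B" and k: "k \<in> B" "k \<notin> S" and x: "x \<in> span S"
  shows "representation B x k = 0"
proof -
  have fin: "finite S" using independent_imp_finite[OF B(1)] S by (rule finite_subset[rotated])
  obtain c where "x = (\<Sum>b\<in>S. c b *\<^sub>R b)" using x span_finite[OF fin] by auto
  then show ?thesis using representation_of_sum[OF B S k(1), of c] k(2) by simp
qed

lemma lin_trace_representation:
  fixes B :: "'a::euclidean_space set" and f :: "'a \<Rightarrow> 'a"
  assumes B: "independent B" "span B = UNIV" and f: "linear f"
  shows "lin_trace f = (\<Sum>b\<in>B. representation B (f b) b)"
proof -
  have "\<exists>ip. inner_product ip \<and> inj_on (\<lambda>b. (1 / 1) *\<^sub>R b) B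
     \<and> orthonormal_basis ip ((\<lambda>b. (1 / 1) *\<^sub>R b) ` B)
     \<and> (\<forall>x. \<forall>b\<in>B. ip x ((1 / 1) *\<^sub>R b) = 1 * representation B x b)"
    by (rule diagonal_inner_product[OF B, of "\<lambda>_. 1"]) simp
  then obtain ip where ip: "inner_product ip" "orthonormal_basis ip B" "\<And>x b. b \<in> B \<Longrightarrow> ip x b = representation B x b"
    by (auto simp: image_def)
  show ?thesis unfolding lin_trace_orthonormal[OF ip(1,2) f] by (intro sum.cong refl ip(3))
qed

lemma (in heisenberg_nilradical) re_space_three_way:
  assumes lamY: "lam Y > 0" and x: "x \<in> v"
  shows "\<exists>a\<in>re_space {..0} (\<Phi> Y) v. \<exists>m\<in>re_space {0<..<lam Y} (\<Phi> Y) v.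
    \<exists>q\<in>re_space {lam Y..} (\<Phi> Y) v. x = a + (m + q)"
proof -
  let ?R = "re_space (- {..0}) (\<Phi> Y) v"
  have "\<exists>a\<in>re_space {..0} (\<Phi> Y) v. \<exists>z\<in>?R. x = a + z"
    by (rule re_space_decomposition[OF Phi_linear sub_v Phi_v x])
  then obtain a z where az: "a \<in> re_space {..0} (\<Phi> Y) v" "z \<in> ?R" "x = a + z" by (elim bexE)
  have "\<exists>m\<in>re_space {0<..<lam Y} (\<Phi> Y) ?R. \<exists>q\<in>re_space (- {0<..<lam Y}) (\<Phi> Y) ?R. z = m + q"
  proof (rule re_space_decomposition[OF Phi_linear sub_re _ az(2)])
    show "\<Phi> Y w \<in> ?R" if "w \<in> ?R" for w by (rule re_space_Phi_invariant[OF that])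
  qed
  then obtain m q where mq: "m \<in> re_space {0<..<lam Y} (\<Phi> Y) ?R" "q \<in> re_space (- {0<..<lam Y}) (\<Phi> Y) ?R" "z = m + q"
    by (elim bexE)
  have "m \<in> re_space {0<..<lam Y} (\<Phi> Y) v"
    using mq(1) re_space_subset[of "- {..0}" "\<Phi> Y" v] by (auto simp: re_space_def)
  moreover have "q \<in> re_space {lam Y..} (\<Phi> Y) v"
  proof -
    have "q \<in> ?R" using mq(2) re_space_subset[of _ "\<Phi> Y" ?R] by (rule rev_subsetD)
    moreover have "q \<in> re_space (- {0<..<lam Y}) (\<Phi> Y) v"
      using mq(2) re_space_subset[of "- {..0}" "\<Phi> Y" v] by (auto simp: re_space_def)
    ultimately have "q \<in> re_space (- {..0} \<inter> - {0<..<lam Y}) (\<Phi> Y) v"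
      by (rule re_space_Int[OF Phi_linear])
    moreover have "- {..0} \<inter> - {0<..<lam Y} = {lam Y..}" using lamY by auto
    ultimately show ?thesis by (simp only:)
  qed
  ultimately show ?thesis using az mq(3) by (intro bexI[of _ a] bexI[of _ m] bexI[of _ q]) simp_all
qed

text \<open>
  The low part pairs trivially with itself and with the middle part, so nondegeneracy makes its pairing with the
  high part perfect. In the other variable, the high part is likewise paired only with the low part.
\<close>

lemma (in heisenberg_nilradical) dual_basis_exists:
  assumes lamY: "lam Y > 0" and B: "finite B" "independent B" "span B = re_space {..0} (\<Phi> Y) v"
  shows "\<exists>f. (\<forall>e\<in>B. f e \<in> re_space {lam Y..} (\<Phi> Y) v) \<and>
     (\<forall>e\<in>B. \<forall>e'\<in>B. \<omega> e (f e') = (if e = e' then 1 else 0)) \<and>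
     (\<forall>y\<in>re_space {lam Y..} (\<Phi> Y) v. y = (\<Sum>e\<in>B. \<omega> e y *\<^sub>R f e))"
proof -
  let ?P = "re_space {..0} (\<Phi> Y) v" and ?M = "re_space {0<..<lam Y} (\<Phi> Y) v" and ?Q = "re_space {lam Y..} (\<Phi> Y) v"
  have PP: "\<omega> x y = 0" if "x \<in> ?P" "y \<in> ?P" for x y by (rule omega_re_spaces[OF _ that]) (use lamY in auto)
  have PM: "\<omega> x y = 0" if "x \<in> ?P" "y \<in> ?M" for x y by (rule omega_re_spaces[OF _ that]) auto
  have QQ: "\<omega> x y = 0" if "x \<in> ?Q" "y \<in> ?Q" for x y by (rule omega_re_spaces[OF _ that]) (use lamY in auto)
  have QM: "\<omega> x y = 0" if "x \<in> ?Q" "y \<in> ?M" for x y by (rule omega_re_spaces[OF _ that]) auto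
  have decomp: "\<exists>a\<in>?P. \<exists>m\<in>?M. \<exists>q\<in>?Q. x = a + (m + q)" if "x \<in> v" for x
    by (rule re_space_three_way[OF lamY that])
  have ortho_zero: "x = 0" if xv: "x \<in> v" and z: "\<And>y. y \<in> ?P \<Longrightarrow> \<omega> x y = 0" "\<And>y. y \<in> ?M \<Longrightarrow> \<omega> x y = 0"
      "\<And>y. y \<in> ?Q \<Longrightarrow> \<omega> x y = 0" for x
  proof (rule omega_nondegenerate[OF xv])
    fix y assume "y \<in> v"
    from decomp[OF this] obtain a m q where "a \<in> ?P" "m \<in> ?M" "q \<in> ?Q" "y = a + (m + q)" by (elim bexE)
    then show "\<omega> x y = 0" by (simp add: linear_add[OF omega_linear(2)] z)
  qed
  have vP: "?P \<subseteq> v" and vQ: "?Q \<subseteq> v" by (rule re_space_subset)+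
  define L where "L y = (\<Sum>e\<in>B. \<omega> e y *\<^sub>R e)" for y
  have linL: "linear L"
    by (intro linearI) (simp_all add: L_def linear_add[OF omega_linear(2)] linear_cmul[OF omega_linear(2)]
        scaleR_add_left sum.distrib scaleR_sum_right)
  have LP: "L y \<in> ?P" for y unfolding L_def B(3)[symmetric] by (intro span_sum span_scale span_base)
  have coeff: "c e = d e" if "(\<Sum>e\<in>B. c e *\<^sub>R e) = (\<Sum>e\<in>B. d e *\<^sub>R e)" "e \<in> B" for c d e
  proof -
    have "(\<Sum>e\<in>B. (c e - d e) *\<^sub>R e) = 0" using that(1) by (simp add: scaleR_diff_left sum_subtractf)
    then have "c e - d e = 0" by (rule real_vector.independentD[OF B(2,1) subset_refl _ that(2)])
    then show ?thesis by simp
  qed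
  have Lz: "y = 0" if y: "y \<in> ?Q" "L y = 0" for y
  proof (rule ortho_zero)
    show "y \<in> v" using y vQ by blast
    have e0: "\<omega> e y = 0" if "e \<in> B" for e using coeff[of "\<lambda>e. \<omega> e y" "\<lambda>_. 0" e] y(2) that by (simp add: L_def)
    fix x assume x: "x \<in> ?P"
    have "\<omega> x y = 0"
      by (rule linear_eq_0_on_span[OF omega_linear(1), of B y x]) (use e0 x B(3) in auto)
    then show "\<omega> y x = 0" using omega_anti[of y x] by simp
  qed (use QM QQ y in auto)
  obtain C where C: "independent C" "span C = ?Q" 
    by (rule orthonormal_basis_subspace[OF sub_re[of "{lam Y..}" Y]]) (rule that; assumption)
  have finC: "finite C" by (rule independent_imp_finite[OF C(1)])
  define L' where "L' x = (\<Sum>q\<in>C. \<omega> q x *\<^sub>R q)" for x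
  have linL': "linear L'"
    by (intro linearI) (simp_all add: L'_def linear_add[OF omega_linear(2)] linear_cmul[OF omega_linear(2)]
        scaleR_add_left sum.distrib scaleR_sum_right)
  have L'Q: "L' x \<in> ?Q" for x unfolding L'_def C(2)[symmetric] by (intro span_sum span_scale span_base)
  have L'z: "x = 0" if x: "x \<in> ?P" "L' x = 0" for x
  proof (rule ortho_zero)
    show "x \<in> v" using x vP by blast
    have q0: "\<omega> q x = 0" if "q \<in> C" for q
      using real_vector.independentD[OF C(1) finC subset_refl x(2)[unfolded L'_def] that] .
    fix y assume y: "y \<in> ?Q"
    have "\<omega> y x = 0"
      by (rule linear_eq_0_on_span[OF omega_linear(1), of C x y]) (use q0 y C(2) in auto)
    then show "\<omega> x y = 0" using omega_anti[of x y] by simp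
  qed (use PP PM x in auto)
  have ker: "dim {y \<in> S. g y = 0} = 0" if "\<And>y. y \<in> S \<Longrightarrow> g y = 0 \<Longrightarrow> y = 0" for S :: "'a set" and g :: "'a \<Rightarrow> 'a"
  proof -
    have "{y \<in> S. g y = 0} \<subseteq> {0}" using that by blast
    then show ?thesis by (simp only: dim_eq_0)
  qed
  have "dim (L' ` ?P) \<le> dim ?Q" by (rule dim_subset) (use L'Q in auto)
  then have dPQ: "dim ?P \<le> dim ?Q"
    using dim_kernel_image[OF linL' sub_re, of "{..0}" Y] ker[of ?P L', OF L'z] by linarith
  have dL: "dim (L ` ?Q) = dim ?Q"
    using dim_kernel_image[OF linL sub_re, of "{lam Y..}" Y] ker[of ?Q L, OF Lz] by linarith
  have "L ` ?Q = ?P"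
  proof (rule subspace_dim_equal)
    show "subspace (L ` ?Q)" by (rule linear_subspace_image[OF linL sub_re])
    show "L ` ?Q \<subseteq> ?P" using LP by auto
    show "dim ?P \<le> dim (L ` ?Q)" using dPQ dL by simp
  qed (rule sub_re)
  then have im: "?P = L ` ?Q" by (rule sym)
  have "\<forall>e\<in>B. \<exists>y. y \<in> ?Q \<and> L y = e"
  proof
    fix e assume "e \<in> B"
    then have "e \<in> ?P" unfolding B(3)[symmetric] by (rule span_base)
    then have "e \<in> L ` ?Q" by (simp only: im)
    then obtain y where "e = L y" "y \<in> ?Q" by (rule imageE)
    then show "\<exists>y. y \<in> ?Q \<and> L y = e" by (intro exI[of _ y]) simp
  qed
  from bchoice[OF this] obtain f where f0: "\<forall>e\<in>B. f e \<in> ?Q \<and> L (f e) = e" by (rule exE)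
  have f: "f e \<in> ?Q" "L (f e) = e" if "e \<in> B" for e using bspec[OF f0 that] by simp_all
  have dual: "\<omega> e (f e') = (if e = e' then 1 else 0)" if e: "e \<in> B" "e' \<in> B" for e e'
  proof -
    have "(\<Sum>b\<in>B. \<omega> b (f e') *\<^sub>R b) = (\<Sum>b\<in>B. (if b = e' then 1 else 0) *\<^sub>R b)"
    proof -
      have "(\<Sum>b\<in>B. (if b = e' then 1 else 0) *\<^sub>R b) = (\<Sum>b\<in>B. if b = e' then e' else 0)"
        by (intro sum.cong refl) simp
      also have "\<dots> = e'" using B(1) e(2) by simp
      finally show ?thesis using f(2)[OF e(2)] by (simp add: L_def)
    qed
    from coeff[OF this e(1)] show ?thesis .
  qed
  have exp: "y = (\<Sum>e\<in>B. \<omega> e y *\<^sub>R f e)" if y: "y \<in> ?Q" for y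
  proof -
    let ?s = "\<Sum>e\<in>B. \<omega> e y *\<^sub>R f e"
    have "L ?s = (\<Sum>e\<in>B. \<omega> e y *\<^sub>R L (f e))" by (simp only: linear_sum[OF linL] linear_cmul[OF linL])
    also have "\<dots> = L y" unfolding L_def[of y] by (intro sum.cong refl) (simp add: f(2))
    finally have "L (y - ?s) = 0" by (simp add: linear_diff[OF linL])
    moreover have "y - ?s \<in> ?Q"
      by (intro subspace_diff[OF sub_re] subspace_sum[OF sub_re] subspace_scale[OF sub_re] y f(1))
    ultimately have "y - ?s = 0" by (rule Lz[rotated])
    then show ?thesis by simp
  qed
  show ?thesis
  proof (rule exI[of _ f], intro conjI ballI)
    show "f e \<in> ?Q" if "e \<in> B" for e by (rule f(1)[OF that])
    show "\<omega> e (f e') = (if e = e' then 1 else 0)" if "e \<in> B" "e' \<in> B" for e e' by (rule dual[OF that])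
    show "y = (\<Sum>e\<in>B. \<omega> e y *\<^sub>R f e)" if "y \<in> ?Q" for y by (rule exp[OF that])
  qed
qed

text \<open>
  The data extracted from an element \<open>Y\<close> with \<open>\<lambda>(Y) > 0\<close>: flag bases of the low and middle parts of \<open>v\<close>, and
  the map \<open>f\<close> sending each low basis vector to its dual vector in the high part.
\<close>

locale adapted_basis = heisenberg_nilradical +
  fixes Y :: 'a and BP BM :: "'a set" and lP lM :: "'a \<Rightarrow> nat"
    and dP dM :: "'a \<Rightarrow> 'a \<Rightarrow> 'a \<Rightarrow> real" and f :: "'a \<Rightarrow> 'a"
  assumes lamY: "lam Y > 0"
    and FP: "flag_basis \<Phi> (re_space {..0} (\<Phi> Y) v) BP lP dP"
    and FM: "flag_basis \<Phi> (re_space {0<..<lam Y} (\<Phi> Y) v) BM lM dM"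
    and f_range: "\<forall>e\<in>BP. f e \<in> re_space {lam Y..} (\<Phi> Y) v"
    and f_pairing: "\<forall>e\<in>BP. \<forall>e'\<in>BP. \<omega> e (f e') = (if e = e' then 1 else 0)"
    and f_expansion: "\<forall>y\<in>re_space {lam Y..} (\<Phi> Y) v. y = (\<Sum>e\<in>BP. \<omega> e y *\<^sub>R f e)"
begin

lemmas f_mem = bspec[OF f_range]
lemmas f_dual = bspec[OF bspec[OF f_pairing]]
lemmas f_exp = bspec[OF f_expansion]

sublocale P: flag_basis \<Phi> "re_space {..0} (\<Phi> Y) v" BP lP dP by (rule FP)
sublocale M: flag_basis \<Phi> "re_space {0<..<lam Y} (\<Phi> Y) v" BM lM dM by (rule FM)

abbreviation "v_low \<equiv> re_space {..0} (\<Phi> Y) v"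
abbreviation "v_mid \<equiv> re_space {0<..<lam Y} (\<Phi> Y) v"
abbreviation "v_high \<equiv> re_space {lam Y..} (\<Phi> Y) v"

definition BQ :: "'a set" where "BQ = f ` BP"
definition h :: "'a \<Rightarrow> 'a" where "h = the_inv_into BP f"
definition V :: "'a set" where "V = BP \<union> BM \<union> BQ"
text \<open>
  The matrix of \<open>\<Phi> A\<close> in the basis \<open>V\<close>. On the dual basis of the high part it is minus the transpose of
  the low block, shifted by \<open>\<lambda>(A)\<close>.
\<close>

definition d :: "'a \<Rightarrow> 'a \<Rightarrow> 'a \<Rightarrow> real" where
  "d A i j = (if i \<in> BP then (if j \<in> BP then dP A i j else 0)
     else if i \<in> BM then (if j \<in> BM then dM A i j else 0)
     else if j \<in> BQ then (if i = j then lam A else 0) - dP A (h j) (h i) else 0)"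
text \<open>
  It exceeds every level by enough to make all degrees on \<open>V\<close> positive and smaller than \<open>2 * N\<close>, and those of
  the middle part smaller than \<open>N\<close>.
\<close>

definition N :: nat where "N = 3 + (\<Sum>e\<in>BP. lP e) + (\<Sum>m\<in>BM. lM m)"
text \<open>
  Going down the flag raises the degree, dual vectors have complementary degrees with sum \<open>2 * N = deg Z\<close>, and
  two middle vectors have degree sum below \<open>2 * N\<close>. Hence in the graded limit only the blocks on the diagonal
  of the flags and the pairing between dual vectors survive.
\<close>

definition deg :: "'a \<Rightarrow> nat" where
  "deg b = (if b \<in> BP then N - lP b else if b \<in> BM then N - 1 - lM b
     else if b \<in> BQ then N + lP (h b) else if b = Z then 2 * N else 0)"
text \<open>
  The part of the action that survives in the graded limit.
\<close>

definition dg :: "'a \<Rightarrow> 'a \<Rightarrow> 'a \<Rightarrow> real" where "dg A i j = (if deg i = deg j then d A i j else 0)"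

lemma P_mem: "e \<in> BP \<Longrightarrow> e \<in> v_low" using P.sp span_base[of e BP] by simp
lemma M_mem: "m \<in> BM \<Longrightarrow> m \<in> v_mid" using M.sp span_base[of m BM] by simp
lemma Q_mem: "q \<in> BQ \<Longrightarrow> q \<in> v_high" using f_mem by (auto simp: BQ_def)

lemma f_inj: "inj_on f BP"
proof (rule inj_onI)
  fix e e' assume e: "e \<in> BP" "e' \<in> BP" "f e = f e'"
  have "\<omega> e (f e') = 1" using f_dual[OF e(1,1)] e(3) by simp
  then show "e = e'" using f_dual[OF e(1,2)] by (simp split: if_splits)
qed

lemma h_f: "e \<in> BP \<Longrightarrow> h (f e) = e" unfolding h_def by (rule the_inv_into_f_f[OF f_inj])
lemma h_mem: "q \<in> BQ \<Longrightarrow> h q \<in> BP" by (auto simp: BQ_def h_f)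
lemma f_h: "q \<in> BQ \<Longrightarrow> f (h q) = q" by (auto simp: BQ_def h_f)

lemma omega_zero:
  shows "x \<in> v_low \<Longrightarrow> y \<in> v_low \<Longrightarrow> \<omega> x y = 0"
    and "x \<in> v_low \<Longrightarrow> y \<in> v_mid \<Longrightarrow> \<omega> x y = 0"
    and "x \<in> v_mid \<Longrightarrow> y \<in> v_high \<Longrightarrow> \<omega> x y = 0"
    and "x \<in> v_high \<Longrightarrow> y \<in> v_high \<Longrightarrow> \<omega> x y = 0"
    and "x \<in> v_mid \<Longrightarrow> y \<in> v_low \<Longrightarrow> \<omega> x y = 0"
    and "x \<in> v_high \<Longrightarrow> y \<in> v_mid \<Longrightarrow> \<omega> x y = 0"
proof -
  show "x \<in> v_low \<Longrightarrow> y \<in> v_low \<Longrightarrow> \<omega> x y = 0" by (rule omega_re_spaces[of "{..0}" "{..0}" Y]) (use lamY in auto)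
  show "x \<in> v_low \<Longrightarrow> y \<in> v_mid \<Longrightarrow> \<omega> x y = 0" by (rule omega_re_spaces[of "{..0}" "{0<..<lam Y}" Y]) (use lamY in auto)
  show "x \<in> v_mid \<Longrightarrow> y \<in> v_high \<Longrightarrow> \<omega> x y = 0" by (rule omega_re_spaces[of "{0<..<lam Y}" "{lam Y..}" Y]) (use lamY in auto)
  show "x \<in> v_high \<Longrightarrow> y \<in> v_high \<Longrightarrow> \<omega> x y = 0" by (rule omega_re_spaces[of "{lam Y..}" "{lam Y..}" Y]) (use lamY in auto)
  show "x \<in> v_mid \<Longrightarrow> y \<in> v_low \<Longrightarrow> \<omega> x y = 0" by (rule omega_re_spaces[of "{0<..<lam Y}" "{..0}" Y]) (use lamY in auto)
  show "x \<in> v_high \<Longrightarrow> y \<in> v_mid \<Longrightarrow> \<omega> x y = 0" by (rule omega_re_spaces[of "{lam Y..}" "{0<..<lam Y}" Y]) (use lamY in auto)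
qed

lemma span_BQ: "span BQ = v_high"
proof
  show "span BQ \<subseteq> v_high" by (rule span_minimal) (auto intro: Q_mem sub_re)
  show "v_high \<subseteq> span BQ"
  proof
    fix y assume y: "y \<in> v_high"
    have "(\<Sum>e\<in>BP. \<omega> e y *\<^sub>R f e) \<in> span BQ"
      by (intro span_sum span_scale span_base) (simp add: BQ_def)
    then show "y \<in> span BQ" using f_exp[OF y] by simp
  qed
qed

lemma ind_BQ: "independent BQ"
proof (rule real_vector.independent_if_scalars_zero)
  show "finite BQ" using P.fin by (simp add: BQ_def)
  fix c q assume s: "(\<Sum>x\<in>BQ. c x *\<^sub>R x) = 0" and q: "q \<in> BQ"
  have s': "(\<Sum>e\<in>BP. c (f e) *\<^sub>R f e) = 0" using s unfolding BQ_def sum.reindex[OF f_inj] o_def .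
  have hq: "h q \<in> BP" by (rule h_mem[OF q])
  have "0 = \<omega> (h q) (\<Sum>e\<in>BP. c (f e) *\<^sub>R f e)" unfolding s' by (simp add: linear_0[OF omega_linear(2)])
  also have "\<dots> = (\<Sum>e\<in>BP. c (f e) * \<omega> (h q) (f e))"
    by (simp only: linear_sum[OF omega_linear(2)] linear_cmul[OF omega_linear(2)] real_scaleR_def)
  also have "\<dots> = (\<Sum>e\<in>BP. if e = h q then c q else 0)"
    by (intro sum.cong refl) (auto simp: f_dual[OF hq] f_h[OF q])
  also have "\<dots> = c q" using P.fin hq by simp
  finally show "c q = 0" by (rule sym)
qed

lemma PM_int: "v_low \<inter> v_mid = {0}"
proof -
  have "x = 0" if "x \<in> v_low" "x \<in> v_mid" for x by (rule re_space_disjoint[OF Phi_linear _ that]) auto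
  then show ?thesis using subspace_0[OF sub_re] by blast
qed

lemma re_space_mono: "S \<subseteq> R \<Longrightarrow> x \<in> re_space S T W \<Longrightarrow> x \<in> re_space R T W"
  by (auto simp: re_space_def)

lemma ind_PM: "independent (BP \<union> BM)" "BP \<inter> BM = {}"
  using independent_Un_disjoint_spans[OF P.ind M.ind] PM_int by (simp_all add: P.sp M.sp)

lemma PMQ_int: "span (BP \<union> BM) \<inter> span BQ = {0}"
proof -
  have "span (BP \<union> BM) \<subseteq> re_space {..<lam Y} (\<Phi> Y) v"
  proof (rule span_minimal[OF _ sub_re], rule subsetI)
    fix b assume "b \<in> BP \<union> BM"
    then show "b \<in> re_space {..<lam Y} (\<Phi> Y) v"
    proof
      assume b: "b \<in> BP" show ?thesis by (rule re_space_mono[OF _ P_mem[OF b]]) (use lamY in auto)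
    next
      assume b: "b \<in> BM" show ?thesis by (rule re_space_mono[OF _ M_mem[OF b]]) auto
    qed
  qed
  note sub = this
  have "x = 0" if x: "x \<in> span (BP \<union> BM)" "x \<in> span BQ" for x
  proof (rule re_space_disjoint[OF Phi_linear _ subsetD[OF sub x(1)]])
    show "x \<in> re_space {lam Y..} (\<Phi> Y) v" using x(2) span_BQ by simp
  qed auto
  then show ?thesis using span_zero by blast
qed

lemma ind_V: "independent V" and PMQ_dis: "(BP \<union> BM) \<inter> BQ = {}"
  unfolding V_def using independent_Un_disjoint_spans[OF ind_PM(1) ind_BQ PMQ_int] by simp_all

lemma V_v: "b \<in> V \<Longrightarrow> b \<in> v"
  unfolding V_def using subsetD[OF re_space_subset P_mem[of b]] subsetD[OF re_space_subset M_mem[of b]]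
    subsetD[OF re_space_subset Q_mem[of b]] by (elim UnE) simp_all

lemma fin_V: "finite V" by (rule independent_imp_finite[OF ind_V])

lemma class_dis: "b \<in> BP \<Longrightarrow> b \<notin> BM" "b \<in> BP \<Longrightarrow> b \<notin> BQ" "b \<in> BM \<Longrightarrow> b \<notin> BP" "b \<in> BM \<Longrightarrow> b \<notin> BQ"
  "b \<in> BQ \<Longrightarrow> b \<notin> BP" "b \<in> BQ \<Longrightarrow> b \<notin> BM"
  using ind_PM(2) PMQ_dis by auto

lemma span_V: "span V = v"
proof
  show "span V \<subseteq> v" by (rule span_minimal) (auto intro: V_v sub_v)
  show "v \<subseteq> span V"
  proof
    fix x assume x: "x \<in> v"
    from re_space_three_way[OF lamY x] obtain a m q
      where amq: "a \<in> v_low" "m \<in> v_mid" "q \<in> v_high" "x = a + (m + q)" by (elim bexE)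
    have a: "a \<in> span V" using amq(1) span_mono[of BP V] P.sp by (auto simp: V_def)
    have m: "m \<in> span V" using amq(2) span_mono[of BM V] M.sp by (auto simp: V_def)
    have q: "q \<in> span V" using amq(3) span_mono[of BQ V] span_BQ by (auto simp: V_def)
    show "x \<in> span V" unfolding amq(4) by (intro span_add a m q)
  qed
qed

lemma Z_V: "Z \<notin> span V"
proof
  assume "Z \<in> span V"
  then have "pr Z = Z" using span_V pr(3) by simp
  then show False using pr(2) Z0 by simp
qed

lemma ind_ZV: "independent (insert Z V)"
  using ind_V Z_V by (simp add: independent_insert span_base)

lemma span_ZV: "span (insert Z V) = n"
proof -
  have "x \<in> span (insert Z V) \<longleftrightarrow> x \<in> n" for x
    unfolding span_n[symmetric] span_breakdown_eq span_V v_def ..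
  then show ?thesis by blast
qed

lemma Phi_expand:
  assumes b: "b \<in> V"
  shows "\<Phi> A b = (\<Sum>b'\<in>V. d A b b' *\<^sub>R b')"
proof -
  consider "b \<in> BP" | "b \<in> BM" | "b \<in> BQ" using b by (auto simp: V_def)
  then show ?thesis
  proof cases
    case 1
    have "(\<Sum>b'\<in>V. d A b b' *\<^sub>R b') = (\<Sum>b'\<in>BP. d A b b' *\<^sub>R b')"
      proof (rule sum.mono_neutral_right[OF fin_V])
      show "BP \<subseteq> V" unfolding V_def by blast
      show "\<forall>b'\<in>V - BP. d A b b' *\<^sub>R b' = 0" using 1 by (simp add: d_def)
    qed
    also have "\<dots> = (\<Sum>b'\<in>BP. dP A b b' *\<^sub>R b')" using 1 by (intro sum.cong refl) (simp add: d_def)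
    finally show ?thesis using P.exp[OF 1, of A] by simp
  next
    case 2
    have "(\<Sum>b'\<in>V. d A b b' *\<^sub>R b') = (\<Sum>b'\<in>BM. d A b b' *\<^sub>R b')"
      proof (rule sum.mono_neutral_right[OF fin_V])
      show "BM \<subseteq> V" unfolding V_def by blast
      show "\<forall>b'\<in>V - BM. d A b b' *\<^sub>R b' = 0" using 2 class_dis(3)[OF 2] by (simp add: d_def)
    qed
    also have "\<dots> = (\<Sum>b'\<in>BM. dM A b b' *\<^sub>R b')"
      using 2 class_dis(3)[OF 2] by (intro sum.cong refl) (simp add: d_def)
    finally show ?thesis using M.exp[OF 2, of A] by simp
  next
    case 3
    have bn: "b \<notin> BP" "b \<notin> BM" by (rule class_dis(5)[OF 3], rule class_dis(6)[OF 3])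
    have hb: "h b \<in> BP" by (rule h_mem[OF 3])
    have "(\<Sum>b'\<in>V. d A b b' *\<^sub>R b') = (\<Sum>b'\<in>BQ. d A b b' *\<^sub>R b')"
      proof (rule sum.mono_neutral_right[OF fin_V])
      show "BQ \<subseteq> V" unfolding V_def by blast
      show "\<forall>b'\<in>V - BQ. d A b b' *\<^sub>R b' = 0" using bn by (simp add: d_def)
    qed
    also have "\<dots> = (\<Sum>e\<in>BP. d A b (f e) *\<^sub>R f e)" unfolding BQ_def sum.reindex[OF f_inj] by (simp only: o_def)
    also have "\<dots> = (\<Sum>e\<in>BP. \<omega> e (\<Phi> A b) *\<^sub>R f e)"
    proof (intro sum.cong refl arg_cong2[of _ _ _ _ scaleR])
      fix e assume e: "e \<in> BP"
      have ev: "e \<in> v" by (rule V_v) (simp add: V_def e)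
      have bv: "b \<in> v" by (rule V_v[OF b])
      have "\<omega> (\<Phi> A e) b = lam A * \<omega> e b - \<omega> e (\<Phi> A b)"
        using omega_Phi[OF ev bv, of A] by (simp add: linear_diff[OF omega_linear(2)] linear_cmul[OF omega_linear(2)])
      moreover have "\<omega> (\<Phi> A e) b = dP A e (h b)"
      proof -
        have "\<omega> (\<Phi> A e) b = \<omega> (\<Sum>e'\<in>BP. dP A e e' *\<^sub>R e') b"
          by (rule arg_cong[OF P.exp[OF e], of "\<lambda>x. \<omega> x b"])
        also have "\<dots> = (\<Sum>e'\<in>BP. dP A e e' * \<omega> e' b)"
          by (simp only: linear_sum[OF omega_linear(1)] linear_cmul[OF omega_linear(1)] real_scaleR_def)
        also have "\<dots> = (\<Sum>e'\<in>BP. if e' = h b then dP A e (h b) else 0)"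
        proof (intro sum.cong refl)
          fix e' assume "e' \<in> BP"
          then show "dP A e e' * \<omega> e' b = (if e' = h b then dP A e (h b) else 0)"
            using f_dual[OF _ hb, of e'] f_h[OF 3] by simp
        qed
        also have "\<dots> = dP A e (h b)" using P.fin hb by simp
        finally show ?thesis .
      qed
      moreover have "\<omega> e b = (if b = f e then 1 else 0)"
      proof -
        have "(e = h b) = (b = f e)"
        proof
          assume "e = h b" then show "b = f e" using f_h[OF 3] by simp
        next
          assume "b = f e" then show "e = h b" using h_f[OF e] by simp
        qed
        then show ?thesis using f_dual[OF e hb] f_h[OF 3] by simp
      qed
      ultimately show "d A b (f e) = \<omega> e (\<Phi> A b)"
        using e bn by (simp add: d_def BQ_def h_f)
    qed
    also have "\<dots> = \<Phi> A b" by (rule f_exp[symmetric]) (rule re_space_Phi_invariant[OF Q_mem[OF 3]])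
    finally show ?thesis by (rule sym)
  qed
qed

lemma dP_Y: "e \<in> BP \<Longrightarrow> dP Y e e \<le> 0"
proof -
  assume e: "e \<in> BP"
  have "\<exists>L. fst ` set L \<subseteq> {..0} \<and> (\<forall>x\<in>v_low. quad_prod L (\<Phi> Y) x = 0)"
    by (rule re_space_annihilator[OF Phi_linear sub_v Phi_v])
  then obtain L where L: "fst ` set L \<subseteq> {..0} \<and> (\<forall>x\<in>v_low. quad_prod L (\<Phi> Y) x = 0)" by (rule exE)
  have "dP Y e e \<in> fst ` set L" by (rule P.rate[OF L[THEN conjunct2] e])
  then show ?thesis using L[THEN conjunct1] by auto
qed

lemma dM_Y: "m \<in> BM \<Longrightarrow> dM Y m m > 0"
proof -
  assume m: "m \<in> BM"
  have "\<exists>L. fst ` set L \<subseteq> {0<..<lam Y} \<and> (\<forall>x\<in>v_mid. quad_prod L (\<Phi> Y) x = 0)"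
    by (rule re_space_annihilator[OF Phi_linear sub_v Phi_v])
  then obtain L where L: "fst ` set L \<subseteq> {0<..<lam Y} \<and> (\<forall>x\<in>v_mid. quad_prod L (\<Phi> Y) x = 0)" by (rule exE)
  have "dM Y m m \<in> fst ` set L" by (rule M.rate[OF L[THEN conjunct2] m])
  then show ?thesis using L[THEN conjunct1] by auto
qed

end

context adapted_basis
begin

lemma lP_N: "e \<in> BP \<Longrightarrow> lP e + 3 \<le> N"
  using member_le_sum[of e BP lP] P.fin by (simp add: N_def)
lemma lM_N: "m \<in> BM \<Longrightarrow> lM m + 3 \<le> N"
  using member_le_sum[of m BM lM] M.fin by (simp add: N_def)

lemma Z_notin: "Z \<notin> V" using Z_V span_base[of Z V] by blast

lemma deg_P: "b \<in> BP \<Longrightarrow> deg b = N - lP b" by (simp add: deg_def)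
lemma deg_M: "b \<in> BM \<Longrightarrow> deg b = N - 1 - lM b" using class_dis(3)[of b] by (simp add: deg_def)
lemma deg_Q: "b \<in> BQ \<Longrightarrow> deg b = N + lP (h b)" using class_dis(5,6)[of b] by (simp add: deg_def)
lemma deg_Z: "deg Z = 2 * N" using Z_notin by (simp add: deg_def V_def)
lemma deg_other: "b \<notin> V \<Longrightarrow> b \<noteq> Z \<Longrightarrow> deg b = 0" by (simp add: deg_def V_def)

lemma V_cases:
  assumes "b \<in> V"
  obtains "b \<in> BP" | "b \<in> BM" | "b \<in> BQ"
  using assms unfolding V_def by (elim UnE)

lemma deg_V: "b \<in> V \<Longrightarrow> 0 < deg b" "b \<in> V \<Longrightarrow> deg b < 2 * N"
proof -
  assume "b \<in> V"
  then have "0 < deg b \<and> deg b < 2 * N"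
  proof (cases rule: V_cases)
    case 1 then show ?thesis using lP_N[OF 1] by (simp add: deg_P)
  next
    case 2 then show ?thesis using lM_N[OF 2] by (simp add: deg_M)
  next
    case 3 then show ?thesis using lP_N[OF h_mem[OF 3]] by (simp add: deg_Q)
  qed
  then show "0 < deg b" "deg b < 2 * N" by simp_all
qed

lemma d_P: "i \<in> BP \<Longrightarrow> d A i j = (if j \<in> BP then dP A i j else 0)" by (simp add: d_def)
lemma d_M: "i \<in> BM \<Longrightarrow> d A i j = (if j \<in> BM then dM A i j else 0)"
  using class_dis(3)[of i] by (simp add: d_def)
lemma d_Q: "i \<in> BQ \<Longrightarrow> d A i j = (if j \<in> BQ then (if i = j then lam A else 0) - dP A (h j) (h i) else 0)"
  using class_dis(5,6)[of i] by (simp add: d_def)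

lemma d_same_class:
  assumes i: "i \<in> V" and d: "d A i j \<noteq> 0"
  obtains "i \<in> BP" "j \<in> BP" "d A i j = dP A i j" | "i \<in> BM" "j \<in> BM" "d A i j = dM A i j"
    | "i \<in> BQ" "j \<in> BQ" "d A i j = (if i = j then lam A else 0) - dP A (h j) (h i)"
  using i
proof (cases rule: V_cases)
  case 1 then show ?thesis using d d_P[OF 1, of A j] that(1) by (cases "j \<in> BP") simp_all
next
  case 2 then show ?thesis using d d_M[OF 2, of A j] that(2) by (cases "j \<in> BM") simp_all
next
  case 3 then show ?thesis using d d_Q[OF 3, of A j] that(3) by (cases "j \<in> BQ") simp_all
qed

lemma d_deg:
  assumes i: "i \<in> V" and d: "d A i j \<noteq> 0"
  shows "deg i \<le> deg j"
  using i d
proof (cases rule: d_same_class)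
  case 1 then show ?thesis using P.tri[OF 1(1,2), of A] d by (simp add: deg_P)
next
  case 2 then show ?thesis using M.tri[OF 2(1,2), of A] d by (simp add: deg_M)
next
  case 3
  show ?thesis
  proof (cases "i = j")
    case False
    then have "dP A (h j) (h i) \<noteq> 0" using 3(3) d by simp
    then have "lP (h i) \<le> lP (h j)" by (rule P.tri[OF h_mem[OF 3(2)] h_mem[OF 3(1)]])
    then show ?thesis by (simp add: deg_Q[OF 3(1)] deg_Q[OF 3(2)])
  qed simp
qed

lemma level_P: "i \<in> BP \<Longrightarrow> j \<in> BP \<Longrightarrow> deg i = deg j \<Longrightarrow> lP i = lP j"
  using lP_N[of i] lP_N[of j] by (simp add: deg_P)
lemma level_M: "i \<in> BM \<Longrightarrow> j \<in> BM \<Longrightarrow> deg i = deg j \<Longrightarrow> lM i = lM j"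
  using lM_N[of i] lM_N[of j] by (simp add: deg_M)
lemma level_Q: "i \<in> BQ \<Longrightarrow> j \<in> BQ \<Longrightarrow> deg i = deg j \<Longrightarrow> lP (h i) = lP (h j)"
  by (simp add: deg_Q)

lemma h_neq: "i \<in> BQ \<Longrightarrow> j \<in> BQ \<Longrightarrow> i \<noteq> j \<Longrightarrow> h i \<noteq> h j"
  using f_h[of i] f_h[of j] by force

lemma dg_skew_aux:
  assumes i: "i \<in> V" and j: "j \<in> V" and ne: "i \<noteq> j" and d: "dg A i j \<noteq> 0"
  shows "dg A i j = - dg A j i"
proof -
  have e: "deg i = deg j" and d': "d A i j \<noteq> 0" using d by (simp_all add: dg_def split: if_splits)
  have "d A i j = - d A j i"
    using i d'
  proof (cases rule: d_same_class)
    case 1 then show ?thesis using P.skew[OF 1(1,2) level_P[OF 1(1,2) e] ne, of A] by (simp add: d_P)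
  next
    case 2 then show ?thesis using M.skew[OF 2(1,2) level_M[OF 2(1,2) e] ne, of A] by (simp add: d_M)
  next
    case 3
    have "dP A (h j) (h i) = - dP A (h i) (h j)"
      by (rule P.skew[OF h_mem[OF 3(2)] h_mem[OF 3(1)] level_Q[OF 3(1,2) e, symmetric] h_neq[OF 3(2,1) ne[symmetric]]])
    then show ?thesis using ne 3(1,2) by (simp add: d_Q)
  qed
  then show ?thesis using e by (simp add: dg_def)
qed

lemma dg_skew: "i \<in> V \<Longrightarrow> j \<in> V \<Longrightarrow> i \<noteq> j \<Longrightarrow> dg A i j = - dg A j i"
  using dg_skew_aux[of i j A] dg_skew_aux[of j i A] by (cases "dg A i j = 0"; cases "dg A j i = 0") simp_all

lemma dg_diag:
  assumes i: "i \<in> V" and d: "dg A i j \<noteq> 0"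
  shows "dg B i i = dg B j j"
proof -
  have e: "deg i = deg j" and d': "d A i j \<noteq> 0" using d by (simp_all add: dg_def split: if_splits)
  have "d B i i = d B j j"
    using i d'
  proof (cases rule: d_same_class)
    case 1 then show ?thesis using P.diag[OF 1(1,2) level_P[OF 1(1,2) e], of B] by (simp add: d_P)
  next
    case 2 then show ?thesis using M.diag[OF 2(1,2) level_M[OF 2(1,2) e], of B] by (simp add: d_M)
  next
    case 3
    have "dP B (h i) (h i) = dP B (h j) (h j)"
      by (rule P.diag[OF h_mem[OF 3(1)] h_mem[OF 3(2)] level_Q[OF 3(1,2) e]])
    then show ?thesis using 3(1,2) by (simp add: d_Q)
  qed
  then show ?thesis by (simp add: dg_def)
qed

lemma omega_PQ: "e \<in> BP \<Longrightarrow> q \<in> BQ \<Longrightarrow> \<omega> e q = (if e = h q then 1 else 0)"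
  using f_dual[OF _ h_mem[of q], of e] f_h[of q] by simp

lemma omega_V:
  assumes i: "i \<in> V" and j: "j \<in> V" and w: "\<omega> i j \<noteq> 0"
  obtains "i \<in> BP" "j \<in> BQ" "i = h j" | "j \<in> BP" "i \<in> BQ" "j = h i" | "i \<in> BM" "j \<in> BM"
  using i
proof (cases rule: V_cases)
  case iP: 1
  from j show ?thesis
  proof (cases rule: V_cases)
    case 1 then show ?thesis using omega_zero(1)[OF P_mem[OF iP] P_mem[OF 1]] w by simp
  next
    case 2 then show ?thesis using omega_zero(2)[OF P_mem[OF iP] M_mem[OF 2]] w by simp
  next
    case 3 then show ?thesis using omega_PQ[OF iP 3] w that(1)[OF iP 3] by (cases "i = h j") simp_all
  qed
next
  case iM: 2
  from j show ?thesis
  proof (cases rule: V_cases)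
    case 1 then show ?thesis using omega_zero(5)[OF M_mem[OF iM] P_mem[OF 1]] w by simp
  next
    case 2 then show ?thesis using that(3)[OF iM 2] by simp
  next
    case 3 then show ?thesis using omega_zero(3)[OF M_mem[OF iM] Q_mem[OF 3]] w by simp
  qed
next
  case iQ: 3
  from j show ?thesis
  proof (cases rule: V_cases)
    case 1
    have "\<omega> j i \<noteq> 0" using w omega_anti[of i j] by simp
    then show ?thesis using omega_PQ[OF 1 iQ] that(2)[OF 1 iQ] by (cases "j = h i") simp_all
  next
    case 2 then show ?thesis using omega_zero(6)[OF Q_mem[OF iQ] M_mem[OF 2]] w by simp
  next
    case 3 then show ?thesis using omega_zero(4)[OF Q_mem[OF iQ] Q_mem[OF 3]] w by simp
  qed
qed

lemma deg_pair: "q \<in> BQ \<Longrightarrow> deg (h q) + deg q = 2 * N"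
  using lP_N[OF h_mem[of q]] by (simp add: deg_P[OF h_mem] deg_Q)

lemma omega_deg:
  assumes i: "i \<in> V" and j: "j \<in> V" and w: "\<omega> i j \<noteq> 0"
  shows "deg i + deg j \<le> 2 * N"
  using i j w
proof (cases rule: omega_V)
  case 1 then show ?thesis using deg_pair[OF 1(2)] by simp
next
  case 2 then show ?thesis using deg_pair[OF 2(2)] by simp
next
  case 3 then show ?thesis by (simp add: deg_M)
qed

text \<open>
  The part of the symplectic form that survives in the graded limit: the pairing of dual basis vectors.
\<close>

definition om :: "'a \<Rightarrow> 'a \<Rightarrow> real" where "om i j = (if deg i + deg j = 2 * N then \<omega> i j else 0)"

lemma om_cases:
  assumes i: "i \<in> V" and j: "j \<in> V" and w: "om i j \<noteq> 0"
  obtains "i \<in> BP" "j \<in> BQ" "i = h j" | "j \<in> BP" "i \<in> BQ" "j = h i"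
proof -
  have e: "deg i + deg j = 2 * N" and w': "\<omega> i j \<noteq> 0" using w by (simp_all add: om_def split: if_splits)
  show thesis
    using i j w'
  proof (cases rule: omega_V)
    case 1 then show ?thesis by (rule that(1))
  next
    case 2 then show ?thesis by (rule that(2))
  next
    case 3 then show ?thesis using e lM_N[OF 3(1)] by (simp add: deg_M)
  qed
qed

lemma om_PQ: "q \<in> BQ \<Longrightarrow> om (h q) q = 1" "q \<in> BQ \<Longrightarrow> om q (h q) = - 1"
proof -
  assume q: "q \<in> BQ"
  have w: "\<omega> (h q) q = 1" using omega_PQ[OF h_mem[OF q] q] by simp
  show "om (h q) q = 1" using deg_pair[OF q] w by (simp add: om_def)
  show "om q (h q) = - 1" using deg_pair[OF q] w omega_anti[of q "h q"] by (simp add: om_def add.commute)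
qed

text \<open>
  If \<open>A\<close> kills \<open>Z\<close> and strictly raises degrees, then so does every element of the span of \<open>A\<close> and the
  nilradical. That span is an ideal because all brackets lie in the nilradical, and it is nilpotent because degrees are bounded.
\<close>

lemma nilpotent_mem_nilradical:
  assumes l: "lam A = 0" and dg: "\<And>i j. i \<in> V \<Longrightarrow> j \<in> V \<Longrightarrow> dg A i j = 0"
  shows "A \<in> n"
proof -
  define I where "I = span (insert A n)"
  define F where "F k = span {b \<in> insert Z V. k \<le> deg b}" for k
  have nI: "n \<subseteq> I" unfolding I_def using span_superset[of "insert A n"] by blast
  have AI: "A \<in> I" unfolding I_def by (rule span_base) simp
  have ideal: "lie_ideal br I"
    unfolding lie_ideal_def
  proof (intro conjI allI ballI)
    show "subspace I" by (simp add: I_def)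
    show "br x y \<in> I" for x y by (rule subsetD[OF nI bracket_n])
  qed
  have nF0: "n \<subseteq> F 0"
  proof -
    have "insert Z V = {b \<in> insert Z V. 0 \<le> deg b}" by auto
    then show ?thesis unfolding F_def using span_ZV by simp
  qed
  have subF: "subspace (F k)" for k by (simp add: F_def)
  have ZF: "Z \<in> F k" if "k \<le> 2 * N" for k
    unfolding F_def by (rule span_base) (simp add: deg_Z that)
  have gen: "br x b \<in> F (Suc k)" if x: "x \<in> insert A n" and b: "b \<in> {b \<in> insert Z V. k \<le> deg b}" for x b k
  proof (cases "b = Z")
    case True
    have "br x Z = 0" using x l Z_central(2) by (auto simp: bracket_Z)
    then show ?thesis using True subspace_0[OF subF] by simp
  next
    case False
    then have bV: "b \<in> V" and kb: "k \<le> deg b" using b by simp_all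
    have ZF': "Z \<in> F (Suc k)" by (rule ZF) (use kb deg_V(2)[OF bV] in simp)
    show ?thesis
    proof (cases "x \<in> n")
      case True
      have "b \<in> n" using V_v[OF bV] v_n by blast
      then have "br x b = \<omega> x b *\<^sub>R Z" by (rule bracket_omega[OF True])
      then show ?thesis using subspace_scale[OF subF ZF'] by simp
    next
      case False
      then have xA: "x = A" using x by simp
      obtain c where c: "br A b = pr (br A b) + c *\<^sub>R Z" using n_decomp(2)[OF bracket_n] by blast
      have "pr (br A b) = (\<Sum>b'\<in>V. d A b b' *\<^sub>R b')" using Phi_expand[OF bV, of A] by (simp add: \<Phi>_def)
      also have "\<dots> \<in> F (Suc k)"
      proof (rule subspace_sum[OF subF])
        fix b' assume b': "b' \<in> V"
        show "d A b b' *\<^sub>R b' \<in> F (Suc k)"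
        proof (cases "d A b b' = 0")
          case True then show ?thesis using subspace_0[OF subF] by simp
        next
          case False
          have "deg b \<le> deg b'" by (rule d_deg[OF bV False])
          moreover have "deg b \<noteq> deg b'" using dg[OF bV b'] False by (simp add: dg_def split: if_splits)
          ultimately have "Suc k \<le> deg b'" using kb by simp
          then have "b' \<in> F (Suc k)" unfolding F_def using b' by (intro span_base) simp
          then show ?thesis by (rule subspace_scale[OF subF])
        qed
      qed
      finally have "pr (br A b) + c *\<^sub>R Z \<in> F (Suc k)"
        by (rule subspace_add[OF subF _ subspace_scale[OF subF ZF']])
      then show ?thesis unfolding xA using c by simp
    qed
  qed
  have step: "br x y \<in> F (Suc k)" if x: "x \<in> I" and y: "y \<in> F k" for x y k
  proof -
    have 1: "br a y \<in> F (Suc k)" if a: "a \<in> insert A n" for a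
    proof (rule span_induct[of y "{b \<in> insert Z V. k \<le> deg b}" "\<lambda>y. br a y \<in> F (Suc k)"])
      show "y \<in> span {b \<in> insert Z V. k \<le> deg b}" using y by (simp only: F_def)
      show "subspace {y. br a y \<in> F (Suc k)}"
        using subF[of "Suc k"] by (simp add: subspace_def bilinear_rzero[OF bil] bilinear_radd[OF bil] bilinear_rmul[OF bil])
    qed (rule gen[OF a])
    show ?thesis
    proof (rule span_induct[of x "insert A n" "\<lambda>x. br x y \<in> F (Suc k)"])
      show "x \<in> span (insert A n)" using x by (simp only: I_def)
      show "subspace {x. br x y \<in> F (Suc k)}"
        using subF[of "Suc k"] by (simp add: subspace_def bilinear_lzero[OF bil] bilinear_ladd[OF bil] bilinear_lmul[OF bil])
    qed (rule 1)
  qed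
  have lcs: "lower_central_series br I (Suc j) \<subseteq> F j" for j
  proof (induction j)
    case 0
    show ?case
    proof
      fix x assume "x \<in> lower_central_series br I (Suc 0)"
      then have "x \<in> bracket_span br I I" by simp
      then show "x \<in> F 0" by (rule span_bracket_induct[OF _ subF]) (rule subsetD[OF nF0 bracket_n])
    qed
  next
    case (Suc j)
    show ?case
    proof
      fix x assume "x \<in> lower_central_series br I (Suc (Suc j))"
      then have "x \<in> bracket_span br I (lower_central_series br I (Suc j))" by simp
      then show "x \<in> F (Suc j)"
      proof (rule span_bracket_induct[OF _ subF])
        fix a b assume "a \<in> I" "b \<in> lower_central_series br I (Suc j)"
        then show "br a b \<in> F (Suc j)" using Suc.IH by (intro step) blast+
      qed
    qed
  qed
  have "{b \<in> insert Z V. Suc (2 * N) \<le> deg b} = {}"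
  proof -
    have "deg b \<le> 2 * N" if "b \<in> insert Z V" for b
      using that deg_V(2)[of b] deg_Z by (cases "b = Z") simp_all
    then show ?thesis by fastforce
  qed
  then have "F (Suc (2 * N)) = {0}" unfolding F_def by (simp only: span_empty)
  then have "lower_central_series br I (Suc (Suc (2 * N))) \<subseteq> {0}" using lcs[of "Suc (2 * N)"] by simp
  moreover have "0 \<in> lower_central_series br I (Suc (Suc (2 * N)))" by (simp add: bracket_span_def span_zero)
  ultimately have "lower_central_series br I (Suc (Suc (2 * N))) = {0}" by blast
  then have "nilpotent_ideal br I" unfolding nilpotent_ideal_def using ideal by blast
  then have "I \<subseteq> n" using nil by (simp add: is_nilradical_def)
  then show ?thesis using AI by blast
qed

lemma rep_outside:
  assumes B: "independent B" "span B = UNIV" "insert Z V \<subseteq> B" and k: "k \<in> B" "k \<notin> insert Z V" and x: "x \<in> n"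
  shows "representation B x k = 0"
  by (rule representation_outside[OF B(1,2,3) k]) (use x span_ZV in simp)

lemma rep_Z:
  assumes B: "independent B" "span B = UNIV" "insert Z V \<subseteq> B" and k: "k \<in> B"
  shows "representation B (c *\<^sub>R Z) k = (if k = Z then c else 0)"
proof -
  have "Z \<in> B" using B(3) by simp
  then have "representation B Z k = (if k = Z then 1 else 0)"
    using real_vector.representation_basis[OF B(1), of Z] by simp
  then show ?thesis by (simp add: representation_UNIV(2)[OF B(1,2)])
qed

lemma rep_V:
  assumes B: "independent B" "span B = UNIV" "insert Z V \<subseteq> B" and k: "k \<in> V" and b: "b \<in> V"
  shows "representation B (br A b) k = d A b k"
proof -
  have kB: "k \<in> B" and VB: "V \<subseteq> B" and kZ: "k \<noteq> Z" using B(3) k Z_notin by auto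
  obtain c where c: "br A b = pr (br A b) + c *\<^sub>R Z" using n_decomp(2)[OF bracket_n] by blast
  have p: "pr (br A b) = (\<Sum>b'\<in>V. d A b b' *\<^sub>R b')" using Phi_expand[OF b, of A] by (simp add: \<Phi>_def)
  have "representation B (br A b) k = representation B (pr (br A b) + c *\<^sub>R Z) k"
    by (rule arg_cong[OF c, of "\<lambda>x. representation B x k"])
  also have "\<dots> = representation B (\<Sum>b'\<in>V. d A b b' *\<^sub>R b') k + representation B (c *\<^sub>R Z) k"
    unfolding p by (rule representation_UNIV(1)[OF B(1,2)])
  also have "\<dots> = d A b k" using representation_of_sum[OF B(1,2) VB kB, of "d A b"] rep_Z[OF B kB] k kZ by simp
  finally show ?thesis .
qed

lemma trace_ad: "lin_trace (br A) = (\<Sum>b\<in>V. d A b b) + lam A"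
proof -
  obtain B where B: "insert Z V \<subseteq> B" "independent B" "UNIV \<subseteq> span B"
    using maximal_independent_subset_extend[of "insert Z V" UNIV] ind_ZV by (metis subset_UNIV)
  then have spB: "span B = UNIV" by blast
  note B' = B(2) spB B(1)
  have fin: "finite B" by (rule independent_imp_finite[OF B(2)])
  have lin: "linear (br A)" using bil by (simp add: bilinear_def)
  have "lin_trace (br A) = (\<Sum>b\<in>B. representation B (br A b) b)" by (rule lin_trace_representation[OF B(2) spB lin])
  also have "\<dots> = (\<Sum>b\<in>insert Z V. representation B (br A b) b)"
  proof (rule sum.mono_neutral_right[OF fin B(1)], rule ballI)
    fix b assume b: "b \<in> B - insert Z V"
    show "representation B (br A b) b = 0" by (rule rep_outside[OF B' _ _ bracket_n]) (use b in simp_all)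
  qed
  also have "\<dots> = representation B (br A Z) Z + (\<Sum>b\<in>V. representation B (br A b) b)"
    using fin_V Z_notin by simp
  also have "representation B (br A Z) Z = lam A"
    unfolding bracket_Z using rep_Z[OF B', of Z "lam A"] B(1) by simp
  also have "(\<Sum>b\<in>V. representation B (br A b) b) = (\<Sum>b\<in>V. d A b b)"
    by (intro sum.cong refl rep_V[OF B'])
  finally show ?thesis by simp
qed

lemma sum_V: "(\<Sum>b\<in>V. g b) = (\<Sum>b\<in>BP. g b) + (\<Sum>b\<in>BM. g b) + (\<Sum>e\<in>BP. g (f e))" for g :: "'a \<Rightarrow> real"
proof -
  have "(\<Sum>b\<in>V. g b) = (\<Sum>b\<in>BP \<union> BM. g b) + (\<Sum>b\<in>BQ. g b)"
    unfolding V_def by (rule sum.union_disjoint) (use P.fin M.fin PMQ_dis in \<open>simp_all add: BQ_def\<close>)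
  also have "(\<Sum>b\<in>BP \<union> BM. g b) = (\<Sum>b\<in>BP. g b) + (\<Sum>b\<in>BM. g b)"
    by (rule sum.union_disjoint[OF P.fin M.fin ind_PM(2)])
  also have "(\<Sum>b\<in>BQ. g b) = (\<Sum>e\<in>BP. g (f e))" unfolding BQ_def sum.reindex[OF f_inj] o_def ..
  finally show ?thesis .
qed

lemma f_BQ: "e \<in> BP \<Longrightarrow> f e \<in> BQ" by (simp add: BQ_def)

text \<open>
  Dual vectors have real parts \<open>r\<close> and \<open>\<lambda>(Y) - r\<close>, so each pair contributes \<open>\<lambda>(Y)\<close> to the trace.
\<close>

lemma trace_Y_pos: "lin_trace (br Y) > 0"
proof -
  have "(\<Sum>b\<in>BP. d Y b b) + (\<Sum>e\<in>BP. d Y (f e) (f e)) = (\<Sum>e\<in>BP. lam Y)"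
    unfolding sum.distrib[symmetric]
    by (intro sum.cong refl) (simp add: d_P d_Q f_BQ h_f)
  moreover have "(\<Sum>e\<in>BP. lam Y) \<ge> 0" using lamY by (intro sum_nonneg) simp
  moreover have "(\<Sum>b\<in>BM. d Y b b) \<ge> 0"
    by (intro sum_nonneg) (simp add: d_M less_imp_le[OF dM_Y])
  ultimately show ?thesis unfolding trace_ad sum_V using lamY by linarith
qed

lemma trace_n: "x \<in> n \<Longrightarrow> lin_trace (br x) = 0"
proof -
  assume x: "x \<in> n"
  have "d x b k = 0" if b: "b \<in> V" and k: "k \<in> V" for b k
  proof -
    have "b \<in> n" using V_v[OF b] v_n by blast
    then have "br x b = \<omega> x b *\<^sub>R Z" by (rule bracket_omega[OF x])
    then have "\<Phi> x b = 0" by (simp add: \<Phi>_def linear_cmul[OF pr(1)] pr(2))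
    then have "(\<Sum>b'\<in>V. d x b b' *\<^sub>R b') = 0" using Phi_expand[OF b, of x] by simp
    then show ?thesis by (rule real_vector.independentD[OF ind_V fin_V subset_refl _ k])
  qed
  then show ?thesis unfolding trace_ad using lam_n[OF x] by simp
qed

text \<open>
  Apart from \<open>Y\<close>, the complement of the nilradical can be chosen in the kernel of the linear functional
  \<open>A \<mapsto> Tr (ad A)\<close>. In the resulting metric the mean curvature vector is then a multiple of \<open>Y\<close>.
\<close>

lemma frame_complement:
  "\<exists>K. finite K \<and> Y \<in> K \<and> independent (K \<union> V \<union> {Z}) \<and> span (K \<union> V \<union> {Z}) = UNIV \<and> K \<inter> V = {} \<and> Z \<notin> K
     \<and> (\<forall>k\<in>K. k \<noteq> Y \<longrightarrow> lin_trace (br k) = 0)"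
proof -
  define t where "t A = lin_trace (br A)" for A
  have lint: "linear t"
    by (intro linearI) (simp_all add: t_def lin_trace_def bilinear_ladd[OF bil] bilinear_lmul[OF bil]
        inner_add_left sum.distrib sum_distrib_left)
  define g where "g = {A. t A = 0}"
  have subg: "subspace g" unfolding g_def
    by (simp add: subspace_def linear_0[OF lint] linear_add[OF lint] linear_cmul[OF lint])
  have Vg: "insert Z V \<subseteq> g"
  proof
    fix b assume "b \<in> insert Z V"
    then have "b \<in> n" unfolding span_ZV[symmetric] by (rule span_base)
    then show "b \<in> g" by (simp add: g_def t_def trace_n)
  qed
  obtain B0 where B0: "insert Z V \<subseteq> B0" "B0 \<subseteq> g" "independent B0" "g \<subseteq> span B0"
    using maximal_independent_subset_extend[OF Vg ind_ZV] by metis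
  have tY: "t Y > 0" unfolding t_def by (rule trace_Y_pos)
  have spg: "span B0 \<subseteq> g" by (rule span_minimal[OF B0(2) subg])
  have Yn: "Y \<notin> span B0" using spg tY by (auto simp: g_def)
  have YB: "Y \<notin> B0" using Yn span_base[of Y B0] by blast
  define K where "K = insert Y (B0 - insert Z V)"
  have eq: "K \<union> V \<union> {Z} = insert Y B0" unfolding K_def using B0(1) by blast
  show ?thesis
  proof (rule exI[of _ K], intro conjI ballI impI)
    show ind: "independent (K \<union> V \<union> {Z})" unfolding eq using B0(3) Yn by (simp add: independent_insert)
    show "finite K" using independent_imp_finite[OF B0(3)] by (simp add: K_def)
    show "Y \<in> K" by (simp add: K_def)
    show "K \<inter> V = {}" using YB B0(1) by (auto simp: K_def)
    show "Z \<notin> K" using YB B0(1) by (auto simp: K_def)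
    show "lin_trace (br k) = 0" if "k \<in> K" "k \<noteq> Y" for k
    proof -
      have "k \<in> B0" using that by (simp add: K_def)
      then have "k \<in> g" using B0(2) by blast
      then show ?thesis by (simp add: g_def t_def)
    qed
    have "A \<in> span (insert Y B0)" for A
    proof -
      define c where "c = t A / t Y"
      have "t (A - c *\<^sub>R Y) = 0" using tY by (simp add: linear_diff[OF lint] linear_cmul[OF lint] c_def)
      then have "A - c *\<^sub>R Y \<in> span B0" using B0(4) by (auto simp: g_def)
      then show ?thesis unfolding span_breakdown_eq by blast
    qed
    then show "span (K \<union> V \<union> {Z}) = UNIV" unfolding eq by blast
  qed
qed

end

section \<open>Scaling the frame to a metric of negative Ricci curvature\<close>

lemma sum_single:
  fixes g :: "'b \<Rightarrow> real"
  assumes "finite S" "a \<in> S" "\<And>j. j \<in> S \<Longrightarrow> j \<noteq> a \<Longrightarrow> g j = 0"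
  shows "(\<Sum>j\<in>S. g j) = g a"
proof -
  have "(\<Sum>j\<in>S - {a}. g j) = 0" by (rule sum.neutral) (use assms(3) in simp)
  then show ?thesis using sum.remove[OF assms(1,2), of g] by simp
qed

text \<open>
  The remaining freedom is the scaling of an orthogonal frame. The numbers \<open>\<gamma>\<close> below are the lengths of the
  basis vectors, up to powers of the contraction parameter.
\<close>

locale scaled_frame = adapted_basis +
  fixes K :: "'a set"
  assumes fin_K: "finite K" and Y_K: "Y \<in> K"
    and ind_KVZ: "independent (K \<union> V \<union> {Z})" and span_KVZ: "span (K \<union> V \<union> {Z}) = UNIV"
    and KV: "K \<inter> V = {}" and Z_K: "Z \<notin> K"
    and trace_K: "k \<in> K \<Longrightarrow> k \<noteq> Y \<Longrightarrow> lin_trace (br k) = 0"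
    and rate_pos: "lam Y + (\<Sum>e\<in>BP. dP Y e e) > 0"
begin

definition "B = K \<union> V \<union> {Z}"

lemma ind_B: "independent B" and span_B: "span B = UNIV" and ZV_B: "insert Z V \<subseteq> B"
  unfolding B_def using ind_KVZ span_KVZ by auto
lemma B_iff: "b \<in> B \<longleftrightarrow> b \<in> K \<or> b \<in> V \<or> b = Z" by (auto simp: B_def)
lemmas frame = ind_B span_B ZV_B

text \<open>
  The share of the slack in the inequality for \<open>Y\<close> that is spent on each low basis vector. The denominator keeps the
  total below \<open>\<lambda>(Y) + \<Sum> dP Y e e\<close>, so that something is left for \<open>Z\<close>.
\<close>

definition \<eta> :: real where "\<eta> = (lam Y + (\<Sum>e\<in>BP. dP Y e e)) / (2 * (real (card BP) + 1))"
text \<open>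
  The structure constant of \<open>[e, f e] = c Z\<close> in the scaled frame. Its size makes \<open>dP Y e e + c\<^sup>2/2\<close> equal to \<open>\<eta>\<close>.
\<close>

definition c :: "'a \<Rightarrow> real" where "c e = sqrt (2 * (\<eta> - dP Y e e))"
definition idx :: "'a \<Rightarrow> nat" where "idx = (SOME g. inj_on g (BP \<union> BM))"
text \<open>
  The length of \<open>Y\<close> for which the mean curvature vector, determined by \<open>Tr (ad Y)\<close>, is \<open>Y\<close> itself.
\<close>

definition \<gamma>K :: "'a \<Rightarrow> real" where "\<gamma>K k = (if k = Y then sqrt (lin_trace (br Y)) else 1)"
text \<open>
  Factors close to \<open>1\<close> and distinct for distinct low and middle basis vectors. They tend to \<open>1\<close> as the index grows,
  so negativity on \<open>V\<close> survives, while for each fixed index no nonzero skew block stays skew.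
\<close>

definition g :: "nat \<Rightarrow> 'a \<Rightarrow> real" where "g s b = 1 + real (idx b) * inverse (real (Suc s))"
text \<open>
  On a high vector the factor is chosen so that its pairing with the dual low vector is exactly \<open>c\<close> for every index.
\<close>

definition \<gamma> :: "nat \<Rightarrow> 'a \<Rightarrow> real" where
  "\<gamma> s b = (if b \<in> BP \<union> BM then g s b else if b \<in> BQ then 1 / (g s (h b) * c (h b))
     else if b = Z then 1 else \<gamma>K b)"
definition \<gamma>0 :: "'a \<Rightarrow> real" where "\<gamma>0 b = (if b \<in> BQ then 1 / c (h b) else 1)"
definition D :: "nat \<Rightarrow> 'a \<Rightarrow> 'a \<Rightarrow> 'a \<Rightarrow> real" where "D s k i j = dg k i j * \<gamma> s j / (\<gamma> s i * \<gamma>K k)"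
definition w :: "nat \<Rightarrow> 'a \<Rightarrow> 'a \<Rightarrow> real" where "w s i j = om i j / (\<gamma> s i * \<gamma> s j)"
definition l :: "'a \<Rightarrow> real" where "l k = lam k / \<gamma>K k"
definition \<tau> :: "'a \<Rightarrow> real" where "\<tau> k = lin_trace (br k) / \<gamma>K k"

lemma eta_pos: "\<eta> > 0" unfolding \<eta>_def using rate_pos by simp

lemma c_pos: "e \<in> BP \<Longrightarrow> c e > 0" and c_sq: "e \<in> BP \<Longrightarrow> (c e)\<^sup>2 = 2 * (\<eta> - dP Y e e)"
proof -
  assume e: "e \<in> BP"
  have "\<eta> - dP Y e e > 0" using dP_Y[OF e] eta_pos by simp
  then show "c e > 0" "(c e)\<^sup>2 = 2 * (\<eta> - dP Y e e)" by (simp_all add: c_def)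
qed

lemma gK_pos: "\<gamma>K k > 0" using trace_Y_pos by (simp add: \<gamma>K_def)

lemma g_pos: "g s b > 0"
proof -
  have "real (idx b) * inverse (real (Suc s)) \<ge> 0" by simp
  then show ?thesis unfolding g_def by linarith
qed

lemma gamma_pos: "\<gamma> s b > 0"
  using g_pos[of s b] g_pos[of s "h b"] c_pos[OF h_mem[of b]] gK_pos[of b] by (simp add: \<gamma>_def)

lemma gamma_K: "k \<in> K \<Longrightarrow> \<gamma> s k = \<gamma>K k"
proof -
  assume k: "k \<in> K"
  have "k \<notin> V" "k \<noteq> Z" using k KV Z_K by auto
  then show ?thesis by (simp add: \<gamma>_def V_def)
qed

lemma gamma_Z: "\<gamma> s Z = 1" using Z_notin by (simp add: \<gamma>_def V_def)

lemma gamma_f: "e \<in> BP \<Longrightarrow> \<gamma> s e * \<gamma> s (f e) = 1 / c e"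
  using class_dis(5,6)[OF f_BQ[of e]] f_BQ[of e] g_pos[of s e] by (simp add: \<gamma>_def h_f)

lemma idx_inj: "inj_on idx (BP \<union> BM)"
proof -
  have "finite (BP \<union> BM)" using P.fin M.fin by simp
  then obtain g :: "'a \<Rightarrow> nat" where "inj_on g (BP \<union> BM)" using finite_imp_inj_to_nat_seg by metis
  then show ?thesis unfolding idx_def by (rule someI[of "\<lambda>g. inj_on g (BP \<union> BM)"])
qed

lemma gamma_distinct:
  assumes ij: "i \<in> BP \<union> BM" "j \<in> BP \<union> BM" "i \<noteq> j"
  shows "\<gamma> s i \<noteq> \<gamma> s j"
proof -
  have "idx i \<noteq> idx j" using inj_onD[OF idx_inj _ ij(1,2)] ij(3) by blast
  then show ?thesis using ij(1,2) by (simp add: \<gamma>_def g_def)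
qed

lemma g_limit: "(\<lambda>s. g s b) \<longlonglongrightarrow> 1"
proof -
  have "(\<lambda>s. 1 + real (idx b) * inverse (real (Suc s))) \<longlonglongrightarrow> 1 + real (idx b) * 0"
    by (intro tendsto_intros LIMSEQ_inverse_real_of_nat)
  then show ?thesis by (simp add: g_def)
qed

lemma gamma0_pos: "\<gamma>0 b > 0" using c_pos[OF h_mem[of b]] by (simp add: \<gamma>0_def)

lemma gamma_limit:
  assumes "b \<in> V"
  shows "(\<lambda>s. \<gamma> s b) \<longlonglongrightarrow> \<gamma>0 b"
proof (cases "b \<in> BQ")
  case True
  have "(\<lambda>s. 1 / (g s (h b) * c (h b))) \<longlonglongrightarrow> 1 / (1 * c (h b))"
    by (intro tendsto_intros g_limit) (use c_pos[OF h_mem[OF True]] in simp)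
  then show ?thesis using True class_dis(5,6)[OF True] by (simp add: \<gamma>_def \<gamma>0_def)
next
  case False
  then have "b \<in> BP \<union> BM" using assms by (simp add: V_def)
  then show ?thesis using g_limit[of b] False by (simp add: \<gamma>_def \<gamma>0_def)
qed

lemma gamma0_eq:
  assumes i: "i \<in> V" and d: "dg A i j \<noteq> 0"
  shows "\<gamma>0 i = \<gamma>0 j"
proof -
  have e: "deg i = deg j" and d': "d A i j \<noteq> 0" using d by (simp_all add: dg_def split: if_splits)
  show ?thesis
    using i d'
  proof (cases rule: d_same_class)
    case 1 then show ?thesis using class_dis(2)[of i] class_dis(2)[of j] by (simp add: \<gamma>0_def)
  next
    case 2 then show ?thesis using class_dis(4)[of i] class_dis(4)[of j] by (simp add: \<gamma>0_def)
  next
    case 3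
    have "dP Y (h i) (h i) = dP Y (h j) (h j)"
      by (rule P.diag[OF h_mem[OF 3(1)] h_mem[OF 3(2)] level_Q[OF 3(1,2) e]])
    then show ?thesis using 3(1,2) by (simp add: \<gamma>0_def c_def)
  qed
qed

lemma B_cases:
  assumes "b \<in> B"
  obtains "b \<in> K" "b \<notin> V" "b \<noteq> Z" | "b \<in> V" "b \<notin> K" "b \<noteq> Z" | "b = Z" "b \<notin> V" "b \<notin> K"
  using assms KV Z_K Z_notin by (auto simp: B_iff)

lemma deg_K: "b \<in> K \<Longrightarrow> deg b = 0"
proof -
  assume "b \<in> K"
  then have "b \<notin> V" "b \<noteq> Z" using KV Z_K by auto
  then show ?thesis by (rule deg_other)
qed

lemma rep_K: "k \<in> K \<Longrightarrow> representation B (br x y) k = 0"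
  by (rule rep_outside[OF frame _ _ bracket_n]) (use KV Z_K in \<open>auto simp: B_iff\<close>)

lemma K_deg:
  assumes i: "i \<in> K" and j: "j \<in> B" and k: "k \<in> B" and r: "representation B (br i j) k \<noteq> 0"
  shows "deg j \<le> deg k"
proof -
  have kK: "k \<notin> K" using rep_K r by blast
  from j show ?thesis
  proof (cases rule: B_cases)
    case 1 then show ?thesis by (simp add: deg_K)
  next
    case 2
    show ?thesis
    proof (cases "k = Z")
      case True then show ?thesis using deg_V(2)[OF 2(1)] deg_Z by simp
    next
      case False
      then have kV: "k \<in> V" using k kK by (simp add: B_iff)
      show ?thesis using d_deg[OF 2(1), of i k] r rep_V[OF frame kV 2(1), of i] by simp
    qed
  next
    case 3
    then show ?thesis using r rep_Z[OF frame k, of "lam i"] by (simp add: bracket_Z split: if_splits)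
  qed
qed

lemma rep_nn:
  assumes "i \<in> insert Z V" "j \<in> insert Z V" "k \<in> B"
  shows "representation B (br i j) k = (if k = Z then \<omega> i j else 0)"
proof -
  have "i \<in> n" "j \<in> n" using assms(1,2) V_v v_n Z_n by auto
  then have "br i j = \<omega> i j *\<^sub>R Z" by (rule bracket_omega)
  then show ?thesis using rep_Z[OF frame assms(3), of "\<omega> i j"] by simp
qed

lemma rep_anti: "representation B (br i j) k = - representation B (br j i) k"
proof -
  have "representation B (br i j) k = representation B ((-1) *\<^sub>R br j i) k" using anti[of i j] by simp
  also have "\<dots> = - representation B (br j i) k" unfolding representation_UNIV(2)[OF ind_B span_B] by simp
  finally show ?thesis .
qed

lemma frame_deg:
  assumes i: "i \<in> B" and j: "j \<in> B" and k: "k \<in> B" and r: "representation B (br i j) k \<noteq> 0"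
  shows "deg i + deg j \<le> deg k"
proof (cases "i \<in> K")
  case True
  then show ?thesis using K_deg[OF True j k r] by (simp add: deg_K)
next
  case iK: False
  show ?thesis
  proof (cases "j \<in> K")
    case True
    have "representation B (br j i) k \<noteq> 0" using r rep_anti[of i j k] by simp
    then show ?thesis using K_deg[OF True i k] by (simp add: deg_K[OF True])
  next
    case False
    have iz: "i \<in> insert Z V" and jz: "j \<in> insert Z V" using i j iK False by (auto simp: B_iff)
    have kZ: "k = Z" and o: "\<omega> i j \<noteq> 0" using r rep_nn[OF iz jz k] by (simp_all split: if_splits)
    have "i \<in> n" "j \<in> n" using iz jz V_v v_n Z_n by auto
    then have "i \<noteq> Z" "j \<noteq> Z" using o omega_Z by auto
    then show ?thesis using omega_deg[OF _ _ o] iz jz kZ deg_Z by simp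
  qed
qed

text \<open>
  The structure constants of the graded limit in the scaled frame.
\<close>

definition gsc :: "nat \<Rightarrow> 'a \<Rightarrow> 'a \<Rightarrow> 'a \<Rightarrow> real" where
  "gsc s i j k = (if deg k = deg i + deg j then representation B (br i j) k * \<gamma> s k / (\<gamma> s i * \<gamma> s j) else 0)"

lemma gsc_K:
  assumes i: "i \<in> K" and j: "j \<in> B" and k: "k \<in> B"
  shows "gsc s i j k = (if j \<in> V \<and> k \<in> V then D s i j k else if j = Z \<and> k = Z then l i else 0)"
  using j
proof (cases rule: B_cases)
  case 1
  have "gsc s i j k = 0"
    using k
  proof (cases rule: B_cases)
    case 1 then show ?thesis by (simp add: gsc_def rep_K)
  next
    case 2 then show ?thesis using deg_V(1)[OF 2(1)] by (simp add: gsc_def deg_K i \<open>j \<in> K\<close>)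
  next
    case 3 then show ?thesis using lP_N lM_N deg_Z by (simp add: gsc_def deg_K i \<open>j \<in> K\<close> N_def)
  qed
  then show ?thesis using 1 by simp
next
  case jV: 2
  from k show ?thesis
  proof (cases rule: B_cases)
    case 1 then show ?thesis using jV(3) by (simp add: gsc_def rep_K)
  next
    case 2
    have "deg k = 0 + deg j \<longleftrightarrow> deg j = deg k" by auto
    then show ?thesis using 2 jV
      by (simp add: gsc_def rep_V[OF frame 2(1) jV(1)] deg_K[OF i] D_def dg_def gamma_K[OF i] mult.commute)
  next
    case 3 then show ?thesis using jV deg_V(2)[OF jV(1)] by (simp add: gsc_def deg_K[OF i] deg_Z)
  qed
next
  case 3
  then show ?thesis
    using rep_Z[OF frame k, of "lam i"]
    by (cases "k = Z") (simp_all add: gsc_def bracket_Z deg_K[OF i] gamma_K[OF i] gamma_Z l_def)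
qed

lemma gsc_anti: "gsc s i j k = - gsc s j i k"
  unfolding gsc_def rep_anti[of i j k] by (simp add: add.commute mult.commute)

lemma gsc_semidirect:
  assumes i: "i \<in> B" and j: "j \<in> B" and k: "k \<in> B"
  shows "gsc s i j k = semidirect K V Z (D s) l (w s) i j k"
proof (cases "i \<in> K")
  case True
  then show ?thesis using gsc_K[OF True j k] by (simp add: semidirect_def)
next
  case iK: False
  show ?thesis
  proof (cases "j \<in> K")
    case True
    then show ?thesis using gsc_anti[of s i j k] gsc_K[OF True i k, of s] iK by (simp add: semidirect_def)
  next
    case False
    have iz: "i \<in> insert Z V" and jz: "j \<in> insert Z V" using i j iK False by (auto simp: B_iff)
    have r: "representation B (br i j) k = (if k = Z then \<omega> i j else 0)" by (rule rep_nn[OF iz jz k])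
    show ?thesis
    proof (cases "i \<in> V \<and> j \<in> V \<and> k = Z")
      case True
      then show ?thesis using r iK False
        by (simp add: gsc_def semidirect_def w_def om_def gamma_Z deg_Z eq_commute[of "2 * N"])
    next
      case F: False
      have nn: "i \<in> n" "j \<in> n" using iz jz V_v v_n Z_n by auto
      have "k = Z \<Longrightarrow> \<omega> i j = 0" using F iz jz omega_Z nn by auto
      then have "gsc s i j k = 0" unfolding gsc_def r by simp
      then show ?thesis unfolding semidirect_def if_not_P[OF iK] if_not_P[OF False] if_not_P[OF F] .
    qed
  qed
qed

lemma tau_eq: "\<tau> k = (\<Sum>m\<in>V. D s k m m) + l k"
proof -
  have D: "D s k m m = d k m m / \<gamma>K k" for m using gamma_pos[of s m] by (simp add: D_def dg_def)
  show ?thesis unfolding \<tau>_def trace_ad l_def D by (simp only: sum_divide_distrib add_divide_distrib)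
qed

lemma tau_other: "k \<in> K \<Longrightarrow> k \<noteq> Y \<Longrightarrow> \<tau> k = 0" by (simp add: \<tau>_def trace_K)

lemma tau_sum: "(\<Sum>k\<in>K. \<tau> k * (u k / \<gamma>K k)) = u Y"
proof -
  have "(\<Sum>k\<in>K. \<tau> k * (u k / \<gamma>K k)) = \<tau> Y * (u Y / \<gamma>K Y)"
    by (rule sum_single[OF fin_K Y_K]) (simp add: tau_other)
  also have "\<dots> = lin_trace (br Y) * u Y / (\<gamma>K Y * \<gamma>K Y)" by (simp add: \<tau>_def)
  also have "\<gamma>K Y * \<gamma>K Y = lin_trace (br Y)" using trace_Y_pos by (simp add: \<gamma>K_def)
  finally show ?thesis using trace_Y_pos by simp
qed

text \<open>
  With equal factors all blocks are scalar plus skew and commute with the scaling, so the form is diagonal with entries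
  \<open>- (d Y i i + c\<^sup>2/2)\<close>: the sum is \<open>\<eta>\<close> on low vectors, while on middle and high vectors \<open>d Y i i\<close> is already positive.
\<close>

lemma limit_negative:
  assumes y: "\<exists>i\<in>V. y i \<noteq> 0"
  shows "horizontal_form K V (\<lambda>k i j. dg k i j * \<gamma>0 j / (\<gamma>0 i * \<gamma>K k)) \<tau> (\<lambda>i j. om i j / (\<gamma>0 i * \<gamma>0 j)) y < 0"
proof -
  define D0 where "D0 k i j = dg k i j * \<gamma>0 j / (\<gamma>0 i * \<gamma>K k)" for k i j
  define w0 where "w0 i j = om i j / (\<gamma>0 i * \<gamma>0 j)" for i j
  have D0: "D0 k i j = dg k i j / \<gamma>K k" if "i \<in> V" for k i j
    using gamma0_eq[OF that, of k j] gamma0_pos[of i] by (cases "dg k i j = 0") (simp_all add: D0_def)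
  have eq: "horizontal_form K V D0 \<tau> w0 y
      = - (\<Sum>i\<in>V. (y i)\<^sup>2 * ((\<Sum>l\<in>K. \<tau> l * D0 l i i) + 1/2 * (\<Sum>m\<in>V. (w0 i m)\<^sup>2)))"
  proof (rule horizontal_form_normal[OF fin_V])
    fix k i j assume ij: "i \<in> V" "j \<in> V"
    show "i \<noteq> j \<Longrightarrow> D0 k i j = - D0 k j i" using dg_skew[OF ij, of k] ij by (simp add: D0)
    show "D0 k i j \<noteq> 0 \<Longrightarrow> D0 k i i = D0 k j j" using dg_diag[OF ij(1), of k j k] ij by (simp add: D0)
  next
    fix i i' m assume V: "i \<in> V" "i' \<in> V" "m \<in> V" and o: "w0 i m \<noteq> 0" "w0 i' m \<noteq> 0"
    have o': "om i m \<noteq> 0" "om i' m \<noteq> 0" using o by (simp_all add: w0_def)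
    show "i = i'"
      using V(1,3) o'(1)
    proof (cases rule: om_cases)
      case 1
      from V(2,3) o'(2) show ?thesis
      proof (cases rule: om_cases)
        case b: 1 show ?thesis by (rule trans[OF 1(3) b(3)[symmetric]])
      next
        case 2 then show ?thesis using 1(2) class_dis(2)[of m] by blast
      qed
    next
      case 2
      from V(2,3) o'(2) show ?thesis
      proof (cases rule: om_cases)
        case 1 then show ?thesis using 2(1) class_dis(2)[of m] by blast
      next
        case b: 2
        have "i = f (h i)" by (rule f_h[OF 2(2), symmetric])
        also have "h i = h i'" by (rule trans[OF 2(3)[symmetric] b(3)])
        also have "f (h i') = i'" by (rule f_h[OF b(2)])
        finally show ?thesis .
      qed
    qed
  qed
  have co: "(\<Sum>l\<in>K. \<tau> l * D0 l i i) + 1/2 * (\<Sum>m\<in>V. (w0 i m)\<^sup>2) > 0" if i: "i \<in> V" for i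
  proof -
    have t: "(\<Sum>l\<in>K. \<tau> l * D0 l i i) = d Y i i" unfolding D0[OF i] tau_sum by (simp add: dg_def)
    have nonneg: "(\<Sum>m\<in>V. (w0 i m)\<^sup>2) \<ge> 0" by (rule sum_nonneg) simp
    from i show ?thesis
    proof (cases rule: V_cases)
      case 1
      have fV: "f i \<in> V" using f_BQ[OF 1] by (simp add: V_def)
      have w: "w0 i (f i) = c i"
        using om_PQ(1)[OF f_BQ[OF 1]] h_f[OF 1] f_BQ[OF 1] class_dis(2)[OF 1] by (simp add: w0_def \<gamma>0_def)
      have "(w0 i (f i))\<^sup>2 \<le> (\<Sum>m\<in>V. (w0 i m)\<^sup>2)" by (rule member_le_sum[OF fV _ fin_V]) simp
      then show ?thesis unfolding t w c_sq[OF 1] using 1 eta_pos by (simp add: d_P)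
    next
      case 2
      then show ?thesis unfolding t using nonneg dM_Y[OF 2] by (simp add: d_M)
    next
      case 3
      then show ?thesis unfolding t using nonneg lamY dP_Y[OF h_mem[OF 3]] by (simp add: d_Q)
    qed
  qed
  obtain i where i: "i \<in> V" "y i \<noteq> 0" using y by (elim bexE)
  have "(\<Sum>i\<in>V. (y i)\<^sup>2 * ((\<Sum>l\<in>K. \<tau> l * D0 l i i) + 1/2 * (\<Sum>m\<in>V. (w0 i m)\<^sup>2))) > 0"
  proof (rule sum_pos2[OF fin_V i(1)])
    show "0 < (y i)\<^sup>2 * ((\<Sum>l\<in>K. \<tau> l * D0 l i i) + 1/2 * (\<Sum>m\<in>V. (w0 i m)\<^sup>2))"
      by (rule mult_pos_pos[OF _ co[OF i(1)]]) (use i(2) in simp)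
    show "0 \<le> (y j)\<^sup>2 * ((\<Sum>l\<in>K. \<tau> l * D0 l j j) + 1/2 * (\<Sum>m\<in>V. (w0 j m)\<^sup>2))" if "j \<in> V" for j
      by (rule mult_nonneg_nonneg[OF _ less_imp_le[OF co[OF that]]]) simp
  qed
  then have "horizontal_form K V D0 \<tau> w0 y < 0" unfolding eq by (simp only: neg_less_0_iff_less)
  then show ?thesis unfolding D0_def w0_def .
qed

lemma stable_index:
  "\<exists>s. \<forall>y. (\<exists>i\<in>V. y i \<noteq> 0) \<longrightarrow> horizontal_form K V (D s) \<tau> (w s) y < 0"
proof (rule horizontal_form_negative_stable[OF ind_V,
      where ?D0.0 = "\<lambda>k i j. dg k i j * \<gamma>0 j / (\<gamma>0 i * \<gamma>K k)" and ?\<omega>0.0 = "\<lambda>i j. om i j / (\<gamma>0 i * \<gamma>0 j)"])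
  have ne: "\<gamma>0 b \<noteq> 0" for b using gamma0_pos[of b] by simp
  have nK: "\<gamma>K b \<noteq> 0" for b using gK_pos[of b] by simp
  show "(\<lambda>s. D s k i j) \<longlonglongrightarrow> dg k i j * \<gamma>0 j / (\<gamma>0 i * \<gamma>K k)" if "i \<in> V" "j \<in> V" for k i j
    unfolding D_def
    by (rule tendsto_divide[OF tendsto_mult[OF tendsto_const gamma_limit[OF that(2)]]
          tendsto_mult[OF gamma_limit[OF that(1)] tendsto_const]]) (simp add: ne nK)
  show "(\<lambda>s. w s i j) \<longlonglongrightarrow> om i j / (\<gamma>0 i * \<gamma>0 j)" if "i \<in> V" "j \<in> V" for i j
    unfolding w_def
    by (rule tendsto_divide[OF tendsto_const
          tendsto_mult[OF gamma_limit[OF that(1)] gamma_limit[OF that(2)]]]) (simp add: ne)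
  show "horizontal_form K V (\<lambda>k i j. dg k i j * \<gamma>0 j / (\<gamma>0 i * \<gamma>K k)) \<tau> (\<lambda>i j. om i j / (\<gamma>0 i * \<gamma>0 j)) y < 0"
    if "\<exists>i\<in>V. y i \<noteq> 0" for y by (rule limit_negative[OF that])
qed

text \<open>
  The left side is \<open>\<Sum> c\<^sup>2/2\<close> over the low basis, that is \<open>card BP * \<eta> - \<Sum> dP Y e e\<close>. The hypothesis on
  \<open>Y\<close> enters here.
\<close>

lemma omega_square_sum: "1/4 * (\<Sum>i\<in>V. \<Sum>j\<in>V. (w s i j)\<^sup>2) < (\<Sum>k\<in>K. \<tau> k * l k)"
proof -
  let ?r = "\<lambda>i. \<Sum>j\<in>V. (w s i j)\<^sup>2"
  have w0: "w s i j = 0" if "om i j = 0" for i j using that by (simp add: w_def)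
  have fV: "f e \<in> V" if "e \<in> BP" for e using f_BQ[OF that] by (simp add: V_def)
  have P: "?r e = (c e)\<^sup>2" if e: "e \<in> BP" for e
  proof -
    have eV: "e \<in> V" using e by (simp add: V_def)
    have "?r e = (w s e (f e))\<^sup>2"
    proof (rule sum_single[OF fin_V fV[OF e]])
      fix j assume j: "j \<in> V" "j \<noteq> f e"
      have "om e j = 0"
      proof (rule ccontr)
        assume "om e j \<noteq> 0"
        from eV j(1) this show False
          by (cases rule: om_cases) (use j(2) f_h[of j] class_dis(2)[OF e] in simp_all)
      qed
      then show "(w s e j)\<^sup>2 = 0" by (simp add: w0)
    qed
    then show ?thesis using om_PQ(1)[OF f_BQ[OF e]] by (simp add: w_def gamma_f[OF e] h_f[OF e])
  qed
  have Q: "?r (f e) = (c e)\<^sup>2" if e: "e \<in> BP" for e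
  proof -
    have eV: "e \<in> V" using e by (simp add: V_def)
    have "?r (f e) = (w s (f e) e)\<^sup>2"
    proof (rule sum_single[OF fin_V eV])
      fix j assume j: "j \<in> V" "j \<noteq> e"
      have "om (f e) j = 0"
      proof (rule ccontr)
        assume "om (f e) j \<noteq> 0"
        from fV[OF e] j(1) this show False
          by (cases rule: om_cases) (use j(2) h_f[OF e] class_dis(5)[OF f_BQ[OF e]] in simp_all)
      qed
      then show "(w s (f e) j)\<^sup>2 = 0" by (simp add: w0)
    qed
    then show ?thesis using om_PQ(2)[OF f_BQ[OF e]] gamma_f[OF e, of s]
      by (simp add: w_def h_f[OF e] mult.commute)
  qed
  have M: "?r m = 0" if m: "m \<in> BM" for m
  proof (rule sum.neutral, rule ballI)
    fix j assume j: "j \<in> V"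
    have mV: "m \<in> V" using m by (simp add: V_def)
    have "om m j = 0"
    proof (rule ccontr)
      assume "om m j \<noteq> 0"
      from mV j this show False
        by (cases rule: om_cases) (use class_dis(3,4)[OF m] in simp_all)
    qed
    then show "(w s m j)\<^sup>2 = 0" by (simp add: w0)
  qed
  have "(\<Sum>i\<in>V. ?r i) = (\<Sum>e\<in>BP. ?r e) + (\<Sum>m\<in>BM. ?r m) + (\<Sum>e\<in>BP. ?r (f e))" by (rule sum_V)
  also have "\<dots> = 2 * (\<Sum>e\<in>BP. (c e)\<^sup>2)" using P Q M by simp
  also have "\<dots> = 4 * (real (card BP) * \<eta> - (\<Sum>e\<in>BP. dP Y e e))"
    by (simp add: c_sq sum_distrib_left[symmetric] sum_subtractf)
  finally have s: "1/4 * (\<Sum>i\<in>V. ?r i) = real (card BP) * \<eta> - (\<Sum>e\<in>BP. dP Y e e)" by simp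
  have "2 * (real (card BP) + 1) * \<eta> = lam Y + (\<Sum>e\<in>BP. dP Y e e)"
    unfolding \<eta>_def by simp
  then have "2 * (real (card BP) * \<eta>) + 2 * \<eta> = lam Y + (\<Sum>e\<in>BP. dP Y e e)" by (simp add: algebra_simps)
  moreover have "real (card BP) * \<eta> \<ge> 0" using eta_pos by simp
  ultimately have "real (card BP) * \<eta> - (\<Sum>e\<in>BP. dP Y e e) < lam Y" using eta_pos by linarith
  then show ?thesis using s tau_sum[of lam] by (simp add: l_def)
qed

lemma d_linear: "linear (\<lambda>A. d A i j)" if "i \<in> V" "j \<in> V"
proof -
  have "linear (\<lambda>A. representation B (br A i) j)"
    by (intro linearI) (simp_all add: bilinear_ladd[OF bil] bilinear_lmul[OF bil] representation_UNIV[OF ind_B span_B])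
  then show ?thesis using rep_V[OF frame that(2,1)] by simp
qed

lemma dg_linear: "linear (\<lambda>A. dg A i j)" if "i \<in> V" "j \<in> V"
  using d_linear[OF that] by (cases "deg i = deg j") (simp_all add: dg_def module_hom_zero)

text \<open>
  Let a combination \<open>A\<close> act by a skew map and kill \<open>Z\<close>. The graded blocks of \<open>A\<close> on the low and middle parts are
  scalar plus skew before scaling, and scaling by distinct factors leaves them skew only if they vanish; the high blocks
  vanish by duality. So \<open>A\<close> lies in the nilradical, which meets the span of the complement only in zero.
\<close>

lemma complement_faithful:
  assumes x: "\<exists>k\<in>K. x k \<noteq> 0"
  shows "(\<Sum>k\<in>K. x k * l k) \<noteq> 0 \<or>
        (\<exists>i\<in>V. \<exists>j\<in>V. (\<Sum>k\<in>K. x k * D s k i j) + (\<Sum>k\<in>K. x k * D s k j i) \<noteq> 0)"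
proof (rule ccontr)
  assume H: "\<not> ?thesis"
  define A where "A = (\<Sum>k\<in>K. (x k / \<gamma>K k) *\<^sub>R k)"
  have "lam A = (\<Sum>k\<in>K. x k * l k)"
    unfolding A_def linear_sum[OF lam_linear] linear_cmul[OF lam_linear] l_def by simp
  then have lA: "lam A = 0" using H by simp
  have dgA: "(\<Sum>k\<in>K. x k * D s k i j) = dg A i j * (\<gamma> s j / \<gamma> s i)" if "i \<in> V" "j \<in> V" for i j
    unfolding A_def linear_sum[OF dg_linear[OF that]] linear_cmul[OF dg_linear[OF that]] D_def sum_distrib_right
    by (intro sum.cong refl) (simp add: ac_simps)
  have sym: "dg A i j * (\<gamma> s j / \<gamma> s i) + dg A j i * (\<gamma> s i / \<gamma> s j) = 0" if "i \<in> V" "j \<in> V" for i j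
  proof -
    have "(\<Sum>k\<in>K. x k * D s k i j) + (\<Sum>k\<in>K. x k * D s k j i) = 0" using H that by blast
    then show ?thesis unfolding dgA[OF that] dgA[OF that(2,1)] .
  qed
  have dgPM: "dg A i j = 0" if ij: "i \<in> BP \<union> BM" "j \<in> BP \<union> BM" for i j
  proof -
    have V: "i \<in> V" "j \<in> V" using ij by (auto simp: V_def)
    let ?a = "\<gamma> s i" and ?b = "\<gamma> s j"
    have p: "?a > 0" "?b > 0" by (rule gamma_pos)+
    show ?thesis
    proof (cases "i = j")
      case True then show ?thesis using sym[OF V] p by simp
    next
      case False
      have "dg A i j * (?b / ?a - ?a / ?b) = 0"
        using sym[OF V] dg_skew[OF V False, of A] by (simp add: algebra_simps)
      moreover have "?b / ?a - ?a / ?b \<noteq> 0"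
      proof
        assume "?b / ?a - ?a / ?b = 0"
        then have "?b * ?b = ?a * ?a" using p by (simp add: field_simps)
        then have "?b\<^sup>2 = ?a\<^sup>2" by (simp add: power2_eq_square)
        then have "?b = ?a" using p by (simp add: power2_eq_iff_nonneg)
        then show False using gamma_distinct[OF ij False, of s] by simp
      qed
      ultimately show ?thesis by simp
    qed
  qed
  have "A \<in> n"
  proof (rule nilpotent_mem_nilradical[OF lA])
    fix i j assume V: "i \<in> V" "j \<in> V"
    show "dg A i j = 0"
    proof (rule ccontr)
      assume d: "dg A i j \<noteq> 0"
      then have e: "deg i = deg j" and d': "d A i j \<noteq> 0" by (simp_all add: dg_def split: if_splits)
      show False
        using V(1) d'
      proof (cases rule: d_same_class)
        case 1 then show False using dgPM[of i j] d by simp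
      next
        case 2 then show False using dgPM[of i j] d by simp
      next
        case 3
        have hP: "h i \<in> BP" "h j \<in> BP" by (rule h_mem[OF 3(1)], rule h_mem[OF 3(2)])
        have "deg (h j) = deg (h i)" using deg_pair[OF 3(1)] deg_pair[OF 3(2)] e by simp
        then have "dP A (h j) (h i) = 0" using dgPM[of "h j" "h i"] hP by (simp add: dg_def d_P)
        then show False using 3(3) d' lA by (simp split: if_splits)
      qed
    qed
  qed
  obtain k where k: "k \<in> K" "x k \<noteq> 0" using x by (elim bexE)
  have kB: "k \<in> B" using k(1) by (simp add: B_iff)
  have "representation B A k = 0" by (rule rep_outside[OF frame kB _ \<open>A \<in> n\<close>]) (use k(1) KV Z_K in auto)
  moreover have "representation B A k = x k / \<gamma>K k"
  proof -
    have "K \<subseteq> B" by (auto simp: B_iff)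
    then show ?thesis
      unfolding A_def using representation_of_sum[OF ind_B span_B _ kB, of K "\<lambda>k. x k / \<gamma>K k"] k(1) by simp
  qed
  ultimately show False using k(2) gK_pos[of k] by simp
qed

lemma metric_exists: "\<exists>ip. inner_product ip \<and> negative_ricci br ip"
proof -
  obtain s where s: "\<forall>y. (\<exists>i\<in>V. y i \<noteq> 0) \<longrightarrow> horizontal_form K V (D s) \<tau> (w s) y < 0"
    using stable_index by (rule exE)
  show ?thesis
  proof (rule negative_ricci_by_contraction[OF bil ind_B span_B gamma_pos[of s] frame_deg])
    fix \<xi> :: "'a \<Rightarrow> real" assume \<xi>: "\<exists>b\<in>B. \<xi> b \<noteq> 0"
    have "ricci_form B (gsc s) \<xi> = ricci_form B (semidirect K V Z (D s) l (w s)) \<xi>"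
      by (rule ricci_form_cong) (rule gsc_semidirect)
    also have "\<dots> < 0"
      unfolding B_def
    proof (rule ricci_form_semidirect_negative[OF fin_K fin_V KV Z_K Z_notin tau_eq complement_faithful _ omega_square_sum])
      show "\<exists>b\<in>K \<union> V \<union> {Z}. \<xi> b \<noteq> 0" using \<xi> unfolding B_def .
      show "horizontal_form K V (D s) \<tau> (w s) y < 0" if "\<exists>i\<in>V. y i \<noteq> 0" for y using s that by simp
    qed
    finally show "ricci_form B (\<lambda>i j k. if deg k = deg i + deg j
        then representation B (br i j) k * \<gamma> s k / (\<gamma> s i * \<gamma> s j) else 0) \<xi> < 0"
      unfolding gsc_def .
  qed
qed

end

context adapted_basis
begin

lemma metric_of_positive_rate:
  assumes "lam Y + (\<Sum>e\<in>BP. dP Y e e) > 0"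
  shows "\<exists>ip. inner_product ip \<and> negative_ricci br ip"
proof -
  obtain K where K: "finite K" "Y \<in> K" "independent (K \<union> V \<union> {Z})" "span (K \<union> V \<union> {Z}) = UNIV"
      "K \<inter> V = {}" "Z \<notin> K" "\<forall>k\<in>K. k \<noteq> Y \<longrightarrow> lin_trace (br k) = 0"
    using frame_complement by (elim exE conjE)
  have "scaled_frame br n p X Z Y BP BM lP lM dP dM f K"
  proof (intro scaled_frame.intro scaled_frame_axioms.intro adapted_basis_axioms)
    show "lin_trace (br k) = 0" if "k \<in> K" "k \<noteq> Y" for k using K(7) that by simp
    show "lam Y + (\<Sum>e\<in>BP. dP Y e e) > 0" by (rule assms)
    show "finite K" "Y \<in> K" by (rule K(1), rule K(2))
    show "independent (K \<union> V \<union> {Z})" by (rule K(3))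
    show "span (K \<union> V \<union> {Z}) = UNIV" by (rule K(4))
    show "K \<inter> V = {}" "Z \<notin> K" by (rule K(5), rule K(6))
  qed
  then show ?thesis by (rule scaled_frame.metric_exists)
qed

end

context heisenberg_nilradical
begin

lemma sufficiency:
  assumes Y: "lambda_coeff br Z Y +
       (\<Sum>d\<in>#filter_mset (\<lambda>d. Re d < 0) (complex_eigenvalues (Phi_matrix br p X Z Y)). Re d) > 0"
  shows "\<exists>ip. inner_product ip \<and> negative_ricci br ip"
proof -
  have flags: "\<exists>B lev d. flag_basis \<Phi> (re_space S (\<Phi> Y) v) B lev d" for S
  proof (rule commuting_family_flag[where \<phi> = \<Phi> and V = "re_space S (\<Phi> Y) v"])
    show "linear (\<Phi> A)" for A by (rule Phi_linear)
    show "subspace (re_space S (\<Phi> Y) v)" by (rule sub_re)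
    show "\<Phi> A x \<in> re_space S (\<Phi> Y) v" if "x \<in> re_space S (\<Phi> Y) v" for A x
      by (rule re_space_Phi_invariant[OF that])
    show "\<Phi> A (\<Phi> A' x) = \<Phi> A' (\<Phi> A x)" if "x \<in> re_space S (\<Phi> Y) v" for A A' x
      by (rule Phi_comm[OF subsetD[OF re_space_subset that]])
  qed
  obtain BP lP dP where FP: "flag_basis \<Phi> (re_space {..0} (\<Phi> Y) v) BP lP dP"
    using flags[of "{..0}"] by (elim exE)
  obtain BM lM dM where FM: "flag_basis \<Phi> (re_space {0<..<lam Y} (\<Phi> Y) v) BM lM dM"
    using flags[of "{0<..<lam Y}"] by (elim exE)
  note P = flag_basis.fin[OF FP] flag_basis.ind[OF FP] flag_basis.sp[OF FP]
  have s: "(\<Sum>d\<in>#filter_mset (\<lambda>d. Re d < 0) (complex_eigenvalues (Phi_matrix br p X Z Y)). Re d) = (\<Sum>b\<in>BP. dP Y b b)"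
  proof (rule negative_eigenvalue_sum[where c = "dP Y", OF P])
    fix b assume b: "b \<in> BP"
    show "\<Phi> Y b = (\<Sum>b'\<in>BP. dP Y b b' *\<^sub>R b')" by (rule flag_basis.exp[OF FP b])
  qed
  have pos: "lam Y + (\<Sum>e\<in>BP. dP Y e e) > 0" using Y unfolding s lam_def .
  have "(\<Sum>d\<in>#filter_mset (\<lambda>d. Re d < 0) M. Re d) \<le> 0" for M :: "complex multiset"
    by (induction M) simp_all
  from this[of "complex_eigenvalues (Phi_matrix br p X Z Y)"]
  have "(\<Sum>b\<in>BP. dP Y b b) \<le> 0" unfolding s .
  then have lamY: "lam Y > 0" using pos by linarith
  obtain f where f: "\<forall>e\<in>BP. f e \<in> re_space {lam Y..} (\<Phi> Y) v"
      "\<forall>e\<in>BP. \<forall>e'\<in>BP. \<omega> e (f e') = (if e = e' then 1 else 0)"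
      "\<forall>y\<in>re_space {lam Y..} (\<Phi> Y) v. y = (\<Sum>e\<in>BP. \<omega> e y *\<^sub>R f e)"
    using dual_basis_exists[OF lamY P] by (elim exE conjE)
  have "adapted_basis br n p X Z Y BP BM lP lM dP dM f"
    by (rule adapted_basis.intro[OF heisenberg_nilradical_axioms])
      (rule adapted_basis_axioms.intro[OF lamY FP FM f])
  then show ?thesis using pos by (rule adapted_basis.metric_of_positive_rate)
qed

end

theorem theorem3:
  fixes br :: "'a::euclidean_space \<Rightarrow> 'a \<Rightarrow> 'a" and n :: "'a set"
    and p :: nat and X :: "nat \<Rightarrow> 'a" and Z :: 'a
  assumes "p \<ge> 1"
    and "lie_bracket br"
    and "solvable_lie br"
    and "is_nilradical br n"
    and "heisenberg_basis br n p X Z"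
  shows "(\<exists>ip. inner_product ip \<and> negative_ricci br ip) \<longleftrightarrow>
    (\<exists>Y. lambda_coeff br Z Y +
       (\<Sum>d\<in>#filter_mset (\<lambda>d. Re d < 0) (complex_eigenvalues (Phi_matrix br p X Z Y)). Re d) > 0)"
proof -
  have H: "heisenberg_nilradical br n p X Z" by (rule heisenberg_nilradical.intro) (rule assms)+
  show ?thesis
  proof (rule iffI)
    assume "\<exists>ip. inner_product ip \<and> negative_ricci br ip"
    then show "\<exists>Y. lambda_coeff br Z Y +
       (\<Sum>d\<in>#filter_mset (\<lambda>d. Re d < 0) (complex_eigenvalues (Phi_matrix br p X Z Y)). Re d) > 0"
    proof (rule exE)
      fix ip assume ip: "inner_product ip \<and> negative_ricci br ip"
      show "\<exists>Y. lambda_coeff br Z Y +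
         (\<Sum>d\<in>#filter_mset (\<lambda>d. Re d < 0) (complex_eigenvalues (Phi_matrix br p X Z Y)). Re d) > 0"
        by (rule heisenberg_nilradical.necessity[OF H conjunct1[OF ip] conjunct2[OF ip]])
    qed
  next
    assume "\<exists>Y. lambda_coeff br Z Y +
       (\<Sum>d\<in>#filter_mset (\<lambda>d. Re d < 0) (complex_eigenvalues (Phi_matrix br p X Z Y)). Re d) > 0"
    then show "\<exists>ip. inner_product ip \<and> negative_ricci br ip"
    proof (rule exE)
      fix Y assume Y: "lambda_coeff br Z Y +
         (\<Sum>d\<in>#filter_mset (\<lambda>d. Re d < 0) (complex_eigenvalues (Phi_matrix br p X Z Y)). Re d) > 0"
      show "\<exists>ip. inner_product ip \<and> negative_ricci br ip" by (rule heisenberg_nilradical.sufficiency[OF H Y])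
    qed
  qed
qed

end
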